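(* Let $1<p<+\infty$, let $$\mathcal D=\{(F,f,A,v)\in\mathbb R^4\mid F>0,\ f>0,\ A>0,\ v>0,\ v\ge A,\ f^p\le Fv^{p-1}\},$$ $$\mathcal B(F,f,A,v)=\Big(\frac{p}{p-1}\Big)^pF-\frac{p^p}{p-1}\,\frac{f^p}{(A+(p-1)v)^{p-1}}\qquad\text{for }(F,f,A,v)\in\mathcal D,$$ and let $g$ be the Bellman (value) function of the stochastic optimal control problem with state space $\mathcal D$, controls with values in $\{u\in\mathbb R^5\mid u_5\ge0\}$, drift $b(u,x)=(0,0,-u_5,0)$, diffusion coefficient $\sigma(u,x)=(u_1,u_2,u_3,u_4)$, payoff density $\eta^u(x)=p^p\big(\frac{x_2}{x_3+(p-1)x_4}\big)^pu_5$ and bequest function $K(x)=\liminf_{y\to x,\,y\in\mathcal D}\mathcal B(y)$, $x\in\overline{\mathcal D}$ (defined in detail in the context). Then $$\mathcal B(x)=g(x)\qquad\text{for all }x\in\mathcal D.$$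
   Context: The value function $g$ is defined as follows. Let $\{B_t\}_{t\ge0}$ be a one-dimensional Brownian motion and $\{\mathcal F_t\}_{t\ge0}$ the filtration generated by it. A control is a process $\{u_t\}_{t\ge0}$, $u_t=(u_1(t),\dots,u_5(t))$, measurable with respect to $\mathcal F_t$ at each time $t$ (adapted, with the usual joint measurability and local integrability making the integrals below well defined), with values in $\{u\in\mathbb R^5\mid u_5\ge 0\}$. Given a control and a starting point $x\in\mathcal D$, the controlled process $X_t=(F_t,f_t,A_t,v_t)\in\mathbb R^4$ is the solution of $$X_t=x+\int_0^t b(u_s,X_s)\,ds+\int_0^t\sigma(u_s,X_s)\,dB_s,$$ where $b(u,x)=(0,0,-u_5,0)$ and $\sigma(u,x)=(u_1,u_2,u_3,u_4)$. Its first exit time from $\mathcal D$ is $\tau_{\mathcal D}=\inf\{s>0\mid X_s\notin\mathcal D\}$, with $\tau_{\mathcal D}=+\infty$ if this set is empty. Then $$g(x)=\sup_{\{u_t\}}E^x\Big[\int_0^{\tau_{\mathcal D}}p^p\Big(\frac{f_s}{A_s+(p-1)v_s}\Big)^pu_5(s)\,ds+K(X_{\tau_{\mathcal D}})\chi_{\{\tau_{\mathcal D}<+\infty\}}\Big],$$ where $E^x$ is expectation for the process started at $x$, $\chi$ denotes an indicator function, and the supremum is over all controls $\{u_t\}_{t\ge0}$, that is, all $\{\mathcal F_t\}$-adapted processes with values in $\{u\in\mathbb R^5\mid u_5\ge0\}$ satisfying the usual joint measurability and local integrability conditions that make these integrals well defined. *)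

theory Defs
  imports "HOL-Probability.Probability"
begin

definition natural_filtration :: "'w measure \<Rightarrow> (real \<Rightarrow> 'w \<Rightarrow> real) \<Rightarrow> real \<Rightarrow> 'w measure" where
  "natural_filtration M B t =
     sigma (space M) (\<Union>s\<in>{0..t}. {B s -` A \<inter> space M | A. A \<in> sets borel})"

text \<open>Time is \<open>{t. 0 \<le> t}\<close>; the values of a process at negative times are irrelevant.\<close>

locale brownian_motion = prob_space M for M :: "'w measure" +
  fixes B :: "real \<Rightarrow> 'w \<Rightarrow> real"
  assumes measurable_B: "\<And>t. 0 \<le> t \<Longrightarrow> B t \<in> borel_measurable M"
    and starts_at_0: "AE \<omega> in M. B 0 \<omega> = 0"
    and continuous_paths: "AE \<omega> in M. continuous_on {0..} (\<lambda>t. B t \<omega>)"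
    and normal_increments: "\<And>s t. 0 \<le> s \<Longrightarrow> s < t \<Longrightarrow>
      distributed M lborel (\<lambda>\<omega>. B t \<omega> - B s \<omega>) (normal_density 0 (sqrt (t - s)))"
    and indep_increments: "\<And>n (r :: nat \<Rightarrow> real). 0 \<le> r 0 \<Longrightarrow> (\<forall>i<n. r i \<le> r (Suc i)) \<Longrightarrow>
      indep_vars (\<lambda>_. borel) (\<lambda>i \<omega>. B (r (Suc i)) \<omega> - B (r i) \<omega>) {..<n}"

text \<open>
  The integral is defined for adapted integrands with almost surely square integrable paths:
  \<open>J\<close> is an integral of \<open>H\<close> over \<open>[0,t]\<close> if bounded adapted step processes converge to \<open>H\<close> in
  \<open>L\<^sup>2[0,t]\<close> in probability, and their elementary integrals converge to \<open>J\<close> in probability.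
  Such a \<open>J\<close> is almost surely unique, so the integral is rendered as a relation. The integrand
  may be vector valued, while the Brownian motion is one-dimensional.
\<close>

definition step_data ::
  "'w measure \<Rightarrow> (real \<Rightarrow> 'w \<Rightarrow> real) \<Rightarrow> real \<Rightarrow> nat \<Rightarrow> (nat \<Rightarrow> real) \<Rightarrow> (nat \<Rightarrow> 'w \<Rightarrow> 'a::euclidean_space) \<Rightarrow> bool"
where
  "step_data M B t N r e \<longleftrightarrow>
     0 \<le> r 0 \<and> r N \<le> t \<and> (\<forall>i<N. r i \<le> r (Suc i)) \<and>
     (\<forall>i<N. e i \<in> borel_measurable (natural_filtration M B (r i)) \<and>
            (\<exists>c. \<forall>\<omega>\<in>space M. norm (e i \<omega>) \<le> c))"

definition step_process ::
  "nat \<Rightarrow> (nat \<Rightarrow> real) \<Rightarrow> (nat \<Rightarrow> 'w \<Rightarrow> 'a::euclidean_space) \<Rightarrow> real \<Rightarrow> 'w \<Rightarrow> 'a" where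
  "step_process N r e s \<omega> = (\<Sum>i<N. indicator {r i..<r (Suc i)} s *\<^sub>R e i \<omega>)"

definition step_integral ::
  "(real \<Rightarrow> 'w \<Rightarrow> real) \<Rightarrow> nat \<Rightarrow> (nat \<Rightarrow> real) \<Rightarrow> (nat \<Rightarrow> 'w \<Rightarrow> 'a::euclidean_space) \<Rightarrow> 'w \<Rightarrow> 'a" where
  "step_integral B N r e \<omega> = (\<Sum>i<N. (B (r (Suc i)) \<omega> - B (r i) \<omega>) *\<^sub>R e i \<omega>)"

definition null_in_prob :: "'w measure \<Rightarrow> (nat \<Rightarrow> 'w \<Rightarrow> ennreal) \<Rightarrow> bool" where
  "null_in_prob M Z \<longleftrightarrow>
     (\<forall>n. Z n \<in> borel_measurable M) \<and>
     (\<forall>\<epsilon>>0. (\<lambda>n. measure M {\<omega>\<in>space M. ennreal \<epsilon> < Z n \<omega>}) \<longlonglongrightarrow> 0)"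

definition has_ito_integral ::
  "'w measure \<Rightarrow> (real \<Rightarrow> 'w \<Rightarrow> real) \<Rightarrow> (real \<Rightarrow> 'w \<Rightarrow> 'a::euclidean_space) \<Rightarrow> real \<Rightarrow> ('w \<Rightarrow> 'a) \<Rightarrow> bool"
where
  "has_ito_integral M B H t J \<longleftrightarrow>
     J \<in> borel_measurable M \<and>
     (\<exists>N r e. (\<forall>n. step_data M B t (N n) (r n) (e n)) \<and>
        null_in_prob M
          (\<lambda>n \<omega>. \<integral>\<^sup>+s\<in>{0..t}. ennreal ((norm (step_process (N n) (r n) (e n) s \<omega> - H s \<omega>))\<^sup>2) \<partial>lborel) \<and>
        null_in_prob M (\<lambda>n \<omega>. ennreal (norm (step_integral B (N n) (r n) (e n) \<omega> - J \<omega>))))"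

definition controls ::
  "'w measure \<Rightarrow> (real \<Rightarrow> 'w \<Rightarrow> real) \<Rightarrow> 'u::euclidean_space set \<Rightarrow> (real \<Rightarrow> 'w \<Rightarrow> 'u) set" where
  "controls M B U = {u.
     (\<lambda>(t, \<omega>). u t \<omega>) \<in> borel_measurable (restrict_space borel {0..} \<Otimes>\<^sub>M M) \<and>
     (\<forall>t\<ge>0. u t \<in> borel_measurable (natural_filtration M B t)) \<and>
     (\<forall>t\<ge>0. \<forall>\<omega>\<in>space M. u t \<omega> \<in> U)}"

text \<open>
  The second conjunct is the local integrability of the control that makes the two
  integrals in the state equation well defined.
\<close>

definition solves ::
  "'w measure \<Rightarrow> (real \<Rightarrow> 'w \<Rightarrow> real) \<Rightarrow> ('u \<Rightarrow> 'x \<Rightarrow> 'x) \<Rightarrow> ('u \<Rightarrow> 'x \<Rightarrow> 'x) \<Rightarrow> 'x::euclidean_space \<Rightarrow>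
   (real \<Rightarrow> 'w \<Rightarrow> 'u) \<Rightarrow> (real \<Rightarrow> 'w \<Rightarrow> 'x) \<Rightarrow> bool"
where
  "solves M B b \<sigma> x u X \<longleftrightarrow>
     (AE \<omega> in M. continuous_on {0..} (\<lambda>t. X t \<omega>)) \<and>
     (AE \<omega> in M. \<forall>t\<ge>0. set_integrable lborel {0..t} (\<lambda>s. b (u s \<omega>) (X s \<omega>)) \<and>
                         set_integrable lborel {0..t} (\<lambda>s. (norm (\<sigma> (u s \<omega>) (X s \<omega>)))\<^sup>2)) \<and>
     (\<forall>t\<ge>0. X t \<in> borel_measurable M \<and>
        has_ito_integral M B (\<lambda>s \<omega>. \<sigma> (u s \<omega>) (X s \<omega>)) t
          (\<lambda>\<omega>. X t \<omega> - x - (LINT s:{0..t}|lborel. b (u s \<omega>) (X s \<omega>))))"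

definition exit_time :: "'x set \<Rightarrow> (real \<Rightarrow> 'w \<Rightarrow> 'x) \<Rightarrow> 'w \<Rightarrow> ereal" where
  "exit_time D X \<omega> = Inf {ereal s | s. 0 < s \<and> X s \<omega> \<notin> D}"

text \<open>
  Integral of an extended-real function as the difference of the integrals of its positive
  and negative parts (\<open>e2ennreal\<close> sends negative values to 0).
\<close>

definition ext_integral :: "'w measure \<Rightarrow> ('w \<Rightarrow> ereal) \<Rightarrow> ereal" where
  "ext_integral M f =
     enn2ereal (\<integral>\<^sup>+\<omega>. e2ennreal (f \<omega>) \<partial>M) - enn2ereal (\<integral>\<^sup>+\<omega>. e2ennreal (- f \<omega>) \<partial>M)"

definition performance ::
  "'w measure \<Rightarrow> ('u \<Rightarrow> 'x \<Rightarrow> real) \<Rightarrow> ('x \<Rightarrow> ereal) \<Rightarrow> 'x set \<Rightarrow> (real \<Rightarrow> 'w \<Rightarrow> 'u) \<Rightarrow> (real \<Rightarrow> 'w \<Rightarrow> 'x) \<Rightarrow> ereal"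
where
  "performance M \<eta> K D u X =
     ext_integral M (\<lambda>\<omega>.
       ext_integral (restrict_space lborel {s. 0 \<le> s \<and> ereal s < exit_time D X \<omega>})
         (\<lambda>s. ereal (\<eta> (u s \<omega>) (X s \<omega>))) +
       (if exit_time D X \<omega> < \<infinity> then K (X (real_of_ereal (exit_time D X \<omega>)) \<omega>) else 0))"

text \<open>
  The supremum runs over the controls together with their controlled process. The latter is
  unique up to indistinguishability, so the performance depends on the control only.
\<close>

definition value_function ::
  "'w measure \<Rightarrow> (real \<Rightarrow> 'w \<Rightarrow> real) \<Rightarrow> 'u::euclidean_space set \<Rightarrow>
   ('u \<Rightarrow> 'x \<Rightarrow> 'x) \<Rightarrow> ('u \<Rightarrow> 'x \<Rightarrow> 'x) \<Rightarrow> 'x::euclidean_space set \<Rightarrow>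
   ('u \<Rightarrow> 'x \<Rightarrow> real) \<Rightarrow> ('x \<Rightarrow> ereal) \<Rightarrow> 'x \<Rightarrow> ereal"
where
  "value_function M B U b \<sigma> D \<eta> K x =
     Sup {performance M \<eta> K D u X | u X. u \<in> controls M B U \<and> solves M B b \<sigma> x u X}"

type_synonym state = "real \<times> real \<times> real \<times> real"
type_synonym control = "real \<times> real \<times> real \<times> real \<times> real"

definition domain_D :: "real \<Rightarrow> state set" where
  "domain_D p = {(F, f, A, v).
     F > 0 \<and> f > 0 \<and> A > 0 \<and> v > 0 \<and> v \<ge> A \<and> f powr p \<le> F * v powr (p - 1)}"

definition calB :: "real \<Rightarrow> state \<Rightarrow> real" where
  "calB p = (\<lambda>(F, f, A, v).
     (p / (p - 1)) powr p * F -
     p powr p / (p - 1) * (f powr p / (A + (p - 1) * v) powr (p - 1)))"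

definition control_set :: "control set" where
  "control_set = {(u1, u2, u3, u4, u5). u5 \<ge> 0}"

definition drift :: "control \<Rightarrow> state \<Rightarrow> state" where
  "drift = (\<lambda>(u1, u2, u3, u4, u5) x. (0, 0, - u5, 0))"

definition diffusion :: "control \<Rightarrow> state \<Rightarrow> state" where
  "diffusion = (\<lambda>(u1, u2, u3, u4, u5) x. (u1, u2, u3, u4))"

definition payoff_density :: "real \<Rightarrow> control \<Rightarrow> state \<Rightarrow> real" where
  "payoff_density p = (\<lambda>(u1, u2, u3, u4, u5) (F, f, A, v).
     p powr p * (f / (A + (p - 1) * v)) powr p * u5)"

definition bequest :: "real \<Rightarrow> state \<Rightarrow> ereal" where
  "bequest p x = Liminf (at x within domain_D p) (\<lambda>y. ereal (calB p y))"

definition bellman_g :: "'w measure \<Rightarrow> (real \<Rightarrow> 'w \<Rightarrow> real) \<Rightarrow> real \<Rightarrow> state \<Rightarrow> ereal" where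
  "bellman_g M B p =
     value_function M B control_set drift diffusion (domain_D p) (payoff_density p) (bequest p)"

end

theory Submission
  imports Defs
begin

text \<open>
  \<^bold>\<open>Upper bound.\<close> \<open>calB\<close> is concave on the open wedge \<open>f > 0\<close>, \<open>A + (p-1)v > 0\<close>, with supergradient
  \<open>calB_grad\<close>, and the pairing of \<open>calB_grad\<close> with the drift is exactly minus the payoff density. Summing the
  supergradient inequality over a grid therefore bounds \<open>calB(X)\<close> plus the accumulated payoff by \<open>calB(x)\<close>
  plus a stochastic sum of the martingale part of \<open>X\<close>, so that no Ito formula is needed. The
  stochastic sum is replaced by integrals of step processes whose quadratic variation is cut off at a
  constant; these are centred and bounded in \<open>L\<^sup>2\<close>, and Fatou's lemma applies as the mesh tends to 0
  and as the path is followed through an exhaustion of the domain by compact sets.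

  \<^bold>\<open>Lower bound.\<close> \<open>calB\<close> is constant along the direction \<open>(0, 0, -(p-1), 1)\<close>. Running a Brownian motion
  along this line with \<open>u\<^sub>5 = 0\<close>, the process leaves the domain almost surely, at a point of the wedge,
  where the bequest is at least \<open>calB(x)\<close> by continuity.
\<close>

section \<open>The completed Brownian filtration\<close>

text \<open>What shapes the argument is how weakly the stochastic integral is given. It is a
  relation between a process and a random variable at one fixed time, defined through limits in
  probability of step integrals: each time has its own approximating sequence, and the result is
  fixed only up to null sets. Hence the completed filtration, the search for one approximant that
  serves all times of [0, T], and Borel-Cantelli wherever a pathwise statement is wanted. Stopping
  is realised by an indicator tested at the grid points, so the test for having stayed in a set must
  itself be measurable with respect to the past. For an arbitrary control the stochastic sums have
  no uniform bound; one is forced by confining the path to a compact set, a finite horizon and a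
  bounded quadratic variation, and these three restrictions are relaxed only in the last limit. That
  limit preserves inequalities in one direction, because \<open>calB\<close> is nonnegative on the
  domain and the payoff is nonnegative; this direction is the one the upper bound asks for.\<close>

lemma space_natural_filtration [simp]: "space (natural_filtration M B t) = space M"
  unfolding natural_filtration_def by (rule space_measure_of) auto

lemma sets_natural_filtration:
  "sets (natural_filtration M B t) =
    sigma_sets (space M) (\<Union>s\<in>{0..t}. {B s -` A \<inter> space M | A. A \<in> sets borel})"
  unfolding natural_filtration_def by (rule sets_measure_of) auto

lemma natural_filtration_mono:
  "s \<le> t \<Longrightarrow> sets (natural_filtration M B s) \<subseteq> sets (natural_filtration M B t)"
  unfolding sets_natural_filtration by (rule sigma_sets_mono') (force)

definition completed_filtration :: "'w measure \<Rightarrow> (real \<Rightarrow> 'w \<Rightarrow> real) \<Rightarrow> real \<Rightarrow> 'w measure" where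
  "completed_filtration M B t = sigma (space M)
     {A \<in> sets M. \<exists>A'\<in>sets (natural_filtration M B t). AE \<omega> in M. \<omega> \<in> A \<longleftrightarrow> \<omega> \<in> A'}"

context brownian_motion
begin

abbreviation "\<F> \<equiv> natural_filtration M B"
abbreviation "\<G> \<equiv> completed_filtration M B"

lemma sets_natural_filtration_subset: "sets (\<F> t) \<subseteq> events"
  unfolding sets_natural_filtration
  using measurable_B by (intro sets.sigma_sets_subset) (auto dest: measurable_sets)

lemma sets_completed_filtration:
  "sets (\<G> t) = {A \<in> events. \<exists>A'\<in>sets (\<F> t). AE \<omega> in M. \<omega> \<in> A \<longleftrightarrow> \<omega> \<in> A'}" (is "_ = ?S")
proof -
  have "sigma_algebra (space M) ?S"
    unfolding sigma_algebra_iff2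
  proof (intro conjI ballI allI impI)
    show "?S \<subseteq> Pow (space M)" using sets.sets_into_space by auto
    show "{} \<in> ?S" by (auto intro!: bexI[of _ "{}"])
    show "space M - A \<in> ?S" if "A \<in> ?S" for A
    proof -
      from that obtain A' where A': "A' \<in> sets (\<F> t)" "AE \<omega> in M. \<omega> \<in> A \<longleftrightarrow> \<omega> \<in> A'" "A \<in> events"
        by auto
      then have "space M - A' \<in> sets (\<F> t)"
        using sets.compl_sets[of A' "\<F> t"] by simp
      with A' show ?thesis by (auto intro!: bexI[of _ "space M - A'"])
    qed
    show "\<Union> (range A) \<in> ?S" if "range A \<subseteq> ?S" for A :: "nat \<Rightarrow> 'w set"
    proof -
      have "\<forall>n. \<exists>A'\<in>sets (\<F> t). AE \<omega> in M. \<omega> \<in> A n \<longleftrightarrow> \<omega> \<in> A'" using that by auto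
      then obtain A' where A': "\<And>n. A' n \<in> sets (\<F> t)" "\<And>n. AE \<omega> in M. \<omega> \<in> A n \<longleftrightarrow> \<omega> \<in> A' n"
        by metis
      have "AE \<omega> in M. \<forall>n. \<omega> \<in> A n \<longleftrightarrow> \<omega> \<in> A' n" using A'(2) by (simp add: AE_all_countable)
      then have "AE \<omega> in M. \<omega> \<in> (\<Union>n. A n) \<longleftrightarrow> \<omega> \<in> (\<Union>n. A' n)" by eventually_elim auto
      moreover have "(\<Union>n. A' n) \<in> sets (\<F> t)" using A'(1) by auto
      ultimately show ?thesis using that by blast
    qed
  qed
  then show ?thesis unfolding completed_filtration_def
    by (intro sigma_algebra.sets_measure_of_eq)
qed

lemma space_completed_filtration [simp]: "space (\<G> t) = space M"
  unfolding completed_filtration_def by (rule space_measure_of) (use sets.sets_into_space in auto)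

lemma subalgebra_completed: "subalgebra M (\<G> t)"
  unfolding subalgebra_def by (auto simp: sets_completed_filtration)

lemma subalgebra_natural_completed: "subalgebra (\<G> t) (\<F> t)"
  unfolding subalgebra_def using sets_natural_filtration_subset
  by (auto simp: sets_completed_filtration)

lemma subalgebra_completed_mono: "s \<le> t \<Longrightarrow> subalgebra (\<G> t) (\<G> s)"
  unfolding subalgebra_def using natural_filtration_mono[of s t M B]
  by (auto simp: sets_completed_filtration)

lemma measurable_completed_mono:
  "f \<in> measurable (\<G> s) N \<Longrightarrow> s \<le> t \<Longrightarrow> f \<in> measurable (\<G> t) N"
  using measurable_from_subalg[OF subalgebra_completed_mono] by blast

lemma measurable_completedD: "f \<in> measurable (\<G> s) N \<Longrightarrow> f \<in> measurable M N"
  using measurable_from_subalg[OF subalgebra_completed] by blast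

lemma measurable_naturalD: "f \<in> measurable (\<F> s) N \<Longrightarrow> f \<in> measurable (\<G> s) N"
  using measurable_from_subalg[OF subalgebra_natural_completed] by blast

text \<open>The gate through which all limits pass: adaptedness of an almost sure limit is read off
  from an adapted version. Measurability of \<open>f\<close> in \<open>M\<close> is supplied
  separately because \<open>M\<close> may lack subsets of null sets.\<close>

lemma completed_filtration_AE_eq:
  fixes f g :: "'w \<Rightarrow> 'b::topological_space"
  assumes f: "f \<in> borel_measurable M" and g: "g \<in> borel_measurable (\<G> t)" and eq: "AE \<omega> in M. f \<omega> = g \<omega>"
  shows "f \<in> borel_measurable (\<G> t)"
proof (rule measurableI)
  fix A :: "'b set" assume A: "A \<in> sets borel"
  have "g -` A \<inter> space M \<in> sets (\<G> t)" using measurable_sets[OF g A] by simp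
  then obtain A' where A': "A' \<in> sets (\<F> t)" "AE \<omega> in M. \<omega> \<in> g -` A \<inter> space M \<longleftrightarrow> \<omega> \<in> A'"
    unfolding sets_completed_filtration by auto
  have "AE \<omega> in M. \<omega> \<in> f -` A \<inter> space M \<longleftrightarrow> \<omega> \<in> A'"
    using A'(2) eq by eventually_elim auto
  then show "f -` A \<inter> space (\<G> t) \<in> sets (\<G> t)"
    unfolding sets_completed_filtration using A'(1) measurable_sets[OF f A] by auto
qed simp

section \<open>Independence of Brownian increments from the completed past\<close>

lemma B_measurable_completed: "0 \<le> s \<Longrightarrow> s \<le> t \<Longrightarrow> B s \<in> borel_measurable (\<G> t)"
  by (rule measurable_naturalD, rule measurableI)
    (auto simp: sets_natural_filtration intro!: sigma_sets.Basic[OF UN_I[of s]])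

text \<open>Independence is assumed only along a single finite chain of times. The times in
  \<open>J\<close> are therefore sorted together with 0 and \<open>s\<close> into such a chain, with
  \<open>t\<close> appended; past values are partial sums of the first increments, and
  \<open>B t - B s\<close> is the last one.\<close>

lemma indep_increment_generator:
  assumes J: "finite J" "J \<subseteq> {0..s}" and s: "0 \<le> s" "s \<le> t"
    and A: "\<And>q. A q \<in> sets borel" and C: "C \<in> sets borel"
  shows "prob ({\<omega>\<in>space M. \<forall>q\<in>J. B q \<omega> \<in> A q} \<inter> {\<omega>\<in>space M. B t \<omega> - B s \<omega> \<in> C}) =
    prob {\<omega>\<in>space M. \<forall>q\<in>J. B q \<omega> \<in> A q} * prob {\<omega>\<in>space M. B t \<omega> - B s \<omega> \<in> C}"
proof -
  define qs where "qs = sorted_list_of_set (insert 0 (insert s J))"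
  define n where "n = length qs - 1"
  have fin: "finite (insert 0 (insert s J))" using J by simp
  have set_qs: "set qs = insert 0 (insert s J)" and "sorted qs"
    unfolding qs_def by (simp_all only: set_sorted_list_of_set[OF fin] sorted_sorted_list_of_set)
  have len: "length qs = Suc n" using set_qs unfolding n_def by (cases qs) auto
  have qs0: "qs ! 0 = 0"
  proof -
    obtain i where "i < length qs" "qs ! i = 0" using set_qs by (metis in_set_conv_nth insertI1)
    then have "qs ! 0 \<le> 0" using sorted_nth_mono[OF \<open>sorted qs\<close>, of 0 i] by simp
    moreover have "qs ! 0 \<in> set qs" using len by simp
    then have "qs ! 0 \<ge> 0" unfolding set_qs using J s by auto
    ultimately show ?thesis by simp
  qed
  have qsn: "qs ! n = s"
  proof -
    obtain i where "i < length qs" "qs ! i = s" using set_qs by (metis in_set_conv_nth insertI1 insertI2)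
    then have "s \<le> qs ! n" using sorted_nth_mono[OF \<open>sorted qs\<close>, of i n] len by simp
    moreover have "qs ! n \<in> set qs" using len by simp
    then have "qs ! n \<le> s" unfolding set_qs using J s by auto
    ultimately show ?thesis by simp
  qed
  \<comment> \<open>Index \<open>n\<close> carries \<open>s\<close> and index \<open>Suc n\<close>
    carries \<open>t\<close>, so \<open>X n\<close> below is exactly the increment whose
    independence is claimed.\<close>
  define r where "r i = (if i \<le> n then qs ! i else t)" for i
  have r_mono: "\<forall>i<Suc n. r i \<le> r (Suc i)"
  proof (intro allI impI)
    fix i assume i: "i < Suc n"
    show "r i \<le> r (Suc i)"
    proof (cases "i = n")
      case True
      then show ?thesis using qsn s by (simp add: r_def)
    next
      case False
      then show ?thesis using sorted_nth_mono[OF \<open>sorted qs\<close>, of i "Suc i"] len i by (simp add: r_def)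
    qed
  qed
  define X where "X i \<omega> = B (r (Suc i)) \<omega> - B (r i) \<omega>" for i \<omega>
  have ind: "indep_vars (\<lambda>_. borel) X {..<Suc n}"
    unfolding X_def[abs_def] by (rule indep_increments) (use r_mono qs0 r_def in auto)
  have iv: "indep_var (PiM {..<n} (\<lambda>_. borel)) (\<lambda>\<omega>. restrict (\<lambda>i. X i \<omega>) {..<n})
    (PiM {n} (\<lambda>_. borel)) (\<lambda>\<omega>. restrict (\<lambda>i. X i \<omega>) {n})"
    by (rule indep_var_restrict[OF ind]) auto
  define idx where "idx q = (SOME i. i \<le> n \<and> qs ! i = q)" for q
  have idx: "idx q \<le> n \<and> qs ! idx q = q" if "q \<in> J" for q
  proof -
    have "q \<in> set qs" using that set_qs by auto
    then obtain i where "i < length qs" "qs ! i = q" by (auto simp: in_set_conv_nth)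
    then have "i \<le> n \<and> qs ! i = q" using len by auto
    then show ?thesis unfolding idx_def by (rule someI)
  qed
  define \<phi> where "\<phi> q x = (\<Sum>i<idx q. x i)" for q and x :: "nat \<Rightarrow> real"
  have \<phi>: "\<phi> q (\<lambda>i\<in>{..<n}. X i \<omega>) = B q \<omega> - B 0 \<omega>" if "q \<in> J" for q \<omega>
  proof -
    have "\<phi> q (\<lambda>i\<in>{..<n}. X i \<omega>) = (\<Sum>i<idx q. X i \<omega>)"
      unfolding \<phi>_def by (rule sum.cong) (use idx[OF that] in auto)
    also have "\<dots> = B (r (idx q)) \<omega> - B (r 0) \<omega>"
      unfolding X_def by (rule sum_lessThan_telescope)
    finally show ?thesis using idx[OF that] qs0 by (simp add: r_def)
  qed
  define E where "E = {x \<in> space (PiM {..<n} (\<lambda>_. borel)). \<forall>q\<in>J. \<phi> q x \<in> A q}"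
  have [measurable]: "\<phi> q \<in> borel_measurable (PiM {..<n} (\<lambda>_. borel))" if "q \<in> J" for q
    unfolding \<phi>_def[abs_def] using idx[OF that]
    by (intro borel_measurable_sum measurable_component_singleton) auto
  have E: "E \<in> sets (PiM {..<n} (\<lambda>_. borel))"
    unfolding E_def using J(1) A by (intro sets.sets_Collect_finite_All) (auto intro!: measurable_sets)
  have ev1: "{\<omega>\<in>space M. \<forall>q\<in>J. B q \<omega> \<in> A q} \<in> events"
    using J A measurable_B by (intro sets.sets_Collect_finite_All) (auto simp: subset_iff)
  have "B t \<in> borel_measurable M" "B s \<in> borel_measurable M" using measurable_B s by auto
  then have ev2: "{\<omega>\<in>space M. B t \<omega> - B s \<omega> \<in> C} \<in> events" using C by measurable
  have ev1': "(\<lambda>\<omega>. \<lambda>i\<in>{..<n}. X i \<omega>) -` E \<inter> space M \<in> events"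
    using indep_var_rv1[OF iv] E by (rule measurable_sets)
  \<comment> \<open>\<open>\<phi>\<close> recovers \<open>B q - B 0\<close>, which is
    \<open>B q\<close> only almost surely; the two events agree up to a null set, which is enough
    for their probabilities.\<close>
  have AE1: "AE \<omega> in M. (\<omega> \<in> (\<lambda>\<omega>. \<lambda>i\<in>{..<n}. X i \<omega>) -` E \<inter> space M) = (\<omega> \<in> {\<omega>\<in>space M. \<forall>q\<in>J. B q \<omega> \<in> A q})"
    using starts_at_0 by eventually_elim (auto simp: E_def \<phi> space_PiM)
  have Xn: "X n -` C \<inter> space M = {\<omega>\<in>space M. B t \<omega> - B s \<omega> \<in> C}"
    unfolding X_def r_def using qsn by auto
  have "prob (((\<lambda>\<omega>. \<lambda>i\<in>{..<n}. X i \<omega>) -` E \<inter> space M) \<inter> (X n -` C \<inter> space M)) =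
    prob ((\<lambda>\<omega>. \<lambda>i\<in>{..<n}. X i \<omega>) -` E \<inter> space M) * prob (X n -` C \<inter> space M)"
  proof (rule indep_setD)
    show "indep_set (sigma_sets (space M) {(\<lambda>\<omega>. \<lambda>i\<in>{..<n}. X i \<omega>) -` A \<inter> space M |A. A \<in> sets (PiM {..<n} (\<lambda>_. borel))})
      (sigma_sets (space M) {(\<lambda>\<omega>. \<lambda>i\<in>{n}. X i \<omega>) -` A \<inter> space M |A. A \<in> sets (PiM {n} (\<lambda>_. borel))})"
      using iv unfolding indep_var_eq by blast
    show "(\<lambda>\<omega>. \<lambda>i\<in>{..<n}. X i \<omega>) -` E \<inter> space M \<in>
      sigma_sets (space M) {(\<lambda>\<omega>. \<lambda>i\<in>{..<n}. X i \<omega>) -` A \<inter> space M |A. A \<in> sets (PiM {..<n} (\<lambda>_. borel))}"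
      using E by blast
    have "{f \<in> space (PiM {n} (\<lambda>_. borel)). f n \<in> C} \<in> sets (PiM {n} (\<lambda>_. borel :: real measure))"
      using C by measurable
    moreover have "X n -` C \<inter> space M = (\<lambda>\<omega>. \<lambda>i\<in>{n}. X i \<omega>) -` {f \<in> space (PiM {n} (\<lambda>_. borel)). f n \<in> C} \<inter> space M"
      by (auto simp: space_PiM)
    ultimately show "X n -` C \<inter> space M \<in>
      sigma_sets (space M) {(\<lambda>\<omega>. \<lambda>i\<in>{n}. X i \<omega>) -` A \<inter> space M |A. A \<in> sets (PiM {n} (\<lambda>_. borel))}"
      by blast
  qed
  moreover have "prob ((\<lambda>\<omega>. \<lambda>i\<in>{..<n}. X i \<omega>) -` E \<inter> space M) = prob {\<omega>\<in>space M. \<forall>q\<in>J. B q \<omega> \<in> A q}"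
    by (rule finite_measure_eq_AE[OF AE1 ev1' ev1])
  moreover have "prob (((\<lambda>\<omega>. \<lambda>i\<in>{..<n}. X i \<omega>) -` E \<inter> space M) \<inter> {\<omega>\<in>space M. B t \<omega> - B s \<omega> \<in> C}) =
     prob ({\<omega>\<in>space M. \<forall>q\<in>J. B q \<omega> \<in> A q} \<inter> {\<omega>\<in>space M. B t \<omega> - B s \<omega> \<in> C})"
    by (rule finite_measure_eq_AE) (use AE1 ev1 ev1' ev2 in auto)
  ultimately show ?thesis unfolding Xn by simp
qed

text \<open>Pi-lambda argument: the finite-dimensional events of
  \<open>indep_increment_generator\<close> are stable under intersection and generate the past, so
  the product formula extends to the generated sigma-algebras.\<close>

lemma indep_increment_natural:
  assumes s: "0 \<le> s" "s \<le> t"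
  shows "indep_set (sets (\<F> s)) (sigma_sets (space M) {(\<lambda>\<omega>. B t \<omega> - B s \<omega>) -` C \<inter> space M | C. C \<in> sets borel})"
proof -
  define G where "G = {{\<omega>\<in>space M. \<forall>q\<in>J. B q \<omega> \<in> A q} | J A. finite J \<and> J \<subseteq> {0..s} \<and> (\<forall>q. A q \<in> sets borel)}"
  define H where "H = {(\<lambda>\<omega>. B t \<omega> - B s \<omega>) -` C \<inter> space M | C. C \<in> sets borel}"
  have "B t \<in> borel_measurable M" "B s \<in> borel_measurable M" using measurable_B s by auto
  then have D: "(\<lambda>\<omega>. B t \<omega> - B s \<omega>) \<in> borel_measurable M" by measurable
  have "indep_set G H"
    unfolding indep_sets2_eq
  proof (intro conjI ballI)
    show "G \<subseteq> events"
      unfolding G_def using measurable_B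
      by (auto simp: subset_iff intro!: sets.sets_Collect_finite_All)
    show "H \<subseteq> events"
      unfolding H_def using measurable_sets[OF D] by auto
    fix a b assume "a \<in> G" "b \<in> H"
    then obtain J A C where "finite J" "J \<subseteq> {0..s}" "\<And>q. A q \<in> sets borel" "C \<in> sets borel"
      "a = {\<omega>\<in>space M. \<forall>q\<in>J. B q \<omega> \<in> A q}" "b = {\<omega>\<in>space M. B t \<omega> - B s \<omega> \<in> C}"
      unfolding G_def H_def vimage_def by (auto simp: Int_def conj_commute)
    then show "prob (a \<inter> b) = prob a * prob b"
      using indep_increment_generator[OF _ _ s, of J A C] by simp
  qed
  moreover have "Int_stable G"
  proof (rule Int_stableI)
    fix a b assume "a \<in> G" "b \<in> G"
    then obtain J A K A' where J: "finite J" "J \<subseteq> {0..s}" "\<And>q. A q \<in> sets borel"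
      and K: "finite K" "K \<subseteq> {0..s}" "\<And>q. A' q \<in> sets borel"
      and ab: "a = {\<omega>\<in>space M. \<forall>q\<in>J. B q \<omega> \<in> A q}" "b = {\<omega>\<in>space M. \<forall>q\<in>K. B q \<omega> \<in> A' q}"
      unfolding G_def by blast
    \<comment> \<open>Padding each family with \<open>UNIV\<close> off its own index set writes the
      intersection as one event over \<open>J \<union> K\<close>.\<close>
    define D where "D q = (if q \<in> J then A q else UNIV) \<inter> (if q \<in> K then A' q else UNIV)" for q
    have "a \<inter> b = {\<omega>\<in>space M. \<forall>q\<in>J \<union> K. B q \<omega> \<in> D q}"
      unfolding ab D_def by auto
    moreover have "\<And>q. D q \<in> sets borel" unfolding D_def using J K by auto
    ultimately show "a \<inter> b \<in> G"
      unfolding G_def using J K by (intro CollectI exI[of _ "J \<union> K"] exI[of _ D]) auto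
  qed
  moreover have "Int_stable H"
  proof (rule Int_stableI)
    fix a b assume "a \<in> H" "b \<in> H"
    then obtain C C' where "C \<in> sets borel" "C' \<in> sets borel" "a = (\<lambda>\<omega>. B t \<omega> - B s \<omega>) -` C \<inter> space M"
      "b = (\<lambda>\<omega>. B t \<omega> - B s \<omega>) -` C' \<inter> space M" unfolding H_def by blast
    then show "a \<inter> b \<in> H" unfolding H_def by (intro CollectI exI[of _ "C \<inter> C'"]) auto
  qed
  ultimately have ind: "indep_set (sigma_sets (space M) G) (sigma_sets (space M) H)"
    by (rule indep_set_sigma_sets)
  have "sets (\<F> s) \<subseteq> sigma_sets (space M) G"
    unfolding sets_natural_filtration
  proof (rule sigma_sets_subseteq, safe)
    fix q and A :: "real set" assume "q \<in> {0..s}" "A \<in> sets borel"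
    then show "B q -` A \<inter> space M \<in> G"
      unfolding G_def by (intro CollectI exI[of _ "{q}"] exI[of _ "\<lambda>_. A"]) auto
  qed
  with ind show ?thesis
    unfolding indep_sets2_eq H_def[symmetric] by blast
qed

text \<open>The product formula involves probabilities only, so each completed event may be
  exchanged for the event of the natural filtration from which it differs by a null set.\<close>

lemma indep_increment_completed:
  assumes s: "0 \<le> s" "s \<le> t" and Z: "Z \<in> borel_measurable (\<G> s)"
  shows "indep_var borel Z borel (\<lambda>\<omega>. B t \<omega> - B s \<omega>)"
proof -
  let ?H = "sigma_sets (space M) {(\<lambda>\<omega>. B t \<omega> - B s \<omega>) -` C \<inter> space M | C. C \<in> sets borel}"
  note ind = indep_increment_natural[OF s]
  have [measurable]: "B t \<in> borel_measurable M" "B s \<in> borel_measurable M" using measurable_B s by auto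
  have "sigma_sets (space M) {Z -` A \<inter> space M |A. A \<in> sets borel} \<subseteq> sets (\<G> s)"
    by (rule sets.sigma_sets_subset[of _ "\<G> s", unfolded space_completed_filtration])
      (use measurable_sets[OF Z] in auto)
  moreover have "indep_set (sets (\<G> s)) ?H"
    unfolding indep_sets2_eq
  proof (intro conjI ballI)
    show "sets (\<G> s) \<subseteq> events" unfolding sets_completed_filtration by auto
    show *: "?H \<subseteq> events" using ind unfolding indep_sets2_eq by auto
    fix a b assume a: "a \<in> sets (\<G> s)" and b: "b \<in> ?H"
    then obtain a' where a': "a' \<in> sets (\<F> s)" "AE \<omega> in M. \<omega> \<in> a \<longleftrightarrow> \<omega> \<in> a'" "a \<in> events"
      unfolding sets_completed_filtration by auto
    have ev: "a' \<in> events" "b \<in> events" using a' b * sets_natural_filtration_subset by auto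
    have "prob (a \<inter> b) = prob (a' \<inter> b)"
      by (rule finite_measure_eq_AE) (use a' ev in auto)
    moreover have "prob a = prob a'" by (rule finite_measure_eq_AE) (use a' ev in auto)
    moreover have "prob (a' \<inter> b) = prob a' * prob b"
      using indep_setD[OF ind] a' b by auto
    ultimately show "prob (a \<inter> b) = prob a * prob b" by simp
  qed
  ultimately have "indep_set (sigma_sets (space M) {Z -` A \<inter> space M |A. A \<in> sets borel}) ?H"
    unfolding indep_sets2_eq by blast
  moreover have "Z \<in> borel_measurable M" using Z by (rule measurable_completedD)
  ultimately show ?thesis unfolding indep_var_eq by auto
qed

lemma
  assumes s: "0 \<le> s" "s \<le> t" and Z: "Z \<in> borel_measurable (\<G> s)" and int: "integrable M Z"
  shows integrable_mult_increment: "integrable M (\<lambda>\<omega>. Z \<omega> * (B t \<omega> - B s \<omega>))"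
    and expectation_mult_increment: "expectation (\<lambda>\<omega>. Z \<omega> * (B t \<omega> - B s \<omega>)) = 0"
    and integrable_mult_increment_sq: "integrable M (\<lambda>\<omega>. Z \<omega> * (B t \<omega> - B s \<omega>)\<^sup>2)"
    and expectation_mult_increment_sq: "expectation (\<lambda>\<omega>. Z \<omega> * (B t \<omega> - B s \<omega>)\<^sup>2) = (t - s) * expectation Z"
proof -
  have B: "B t \<in> borel_measurable M" "B s \<in> borel_measurable M" using measurable_B s by auto
  note iv = indep_increment_completed[OF s Z]
  have iv2: "indep_var borel Z borel (\<lambda>\<omega>. (B t \<omega> - B s \<omega>)\<^sup>2)"
    using indep_var_compose[OF iv, of "\<lambda>x. x" borel "\<lambda>x. x\<^sup>2" borel] by (simp add: comp_def)
  have m: "integrable M (\<lambda>\<omega>. B t \<omega> - B s \<omega>) \<and> expectation (\<lambda>\<omega>. B t \<omega> - B s \<omega>) = 0 \<and>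
     integrable M (\<lambda>\<omega>. (B t \<omega> - B s \<omega>)\<^sup>2) \<and> expectation (\<lambda>\<omega>. (B t \<omega> - B s \<omega>)\<^sup>2) = t - s"
  \<comment> \<open>For \<open>s = t\<close> the increment is identically zero and has no normal
    density; otherwise the moments are those of the centred normal law with variance
    \<open>t - s\<close>.\<close>
  proof (cases "s = t")
    case False
    with s have st: "s < t" by simp
    then have pos: "0 < sqrt (t - s)" by simp
    note d = normal_increments[OF s(1) st]
    have 1: "integrable lborel (\<lambda>x. normal_density 0 (sqrt (t - s)) x * x ^ 1)"
      "integrable lborel (\<lambda>x. normal_density 0 (sqrt (t - s)) x * x ^ 2)"
      using integrable_normal_moment[OF pos, of 0 1] integrable_normal_moment[OF pos, of 0 2] by simp_all
    have "integrable M (\<lambda>\<omega>. B t \<omega> - B s \<omega>)"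
      using distributed_integrable[OF d, of "\<lambda>x. x"] 1 by simp
    moreover have "integrable M (\<lambda>\<omega>. (B t \<omega> - B s \<omega>)\<^sup>2)"
      using distributed_integrable[OF d, of "\<lambda>x. x\<^sup>2"] 1 by simp
    moreover have "expectation (\<lambda>\<omega>. B t \<omega> - B s \<omega>) = 0"
      using normal_distributed_expectation[OF pos d] by simp
    moreover have "expectation (\<lambda>\<omega>. (B t \<omega> - B s \<omega>)\<^sup>2) = t - s"
      using normal_distributed_variance[OF pos d] calculation st by simp
    ultimately show ?thesis by simp
  qed simp
  show "integrable M (\<lambda>\<omega>. Z \<omega> * (B t \<omega> - B s \<omega>))"
    by (rule indep_var_integrable[OF iv]) (use m int in auto)
  show "expectation (\<lambda>\<omega>. Z \<omega> * (B t \<omega> - B s \<omega>)) = 0"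
    using indep_var_lebesgue_integral[OF iv] m int by simp
  show "integrable M (\<lambda>\<omega>. Z \<omega> * (B t \<omega> - B s \<omega>)\<^sup>2)"
    by (rule indep_var_integrable[OF iv2]) (use m int in auto)
  show "expectation (\<lambda>\<omega>. Z \<omega> * (B t \<omega> - B s \<omega>)\<^sup>2) = (t - s) * expectation Z"
    using indep_var_lebesgue_integral[OF iv2] m int by simp
qed

end

section \<open>Stochastic integrals of step processes\<close>

text \<open>The intervals of a list may overlap, so that sums and differences of step processes are
  mere concatenations. A common grid is formed only where orthogonality of increments is
  exploited.\<close>

definition list_process :: "(real \<times> real \<times> ('w \<Rightarrow> real)) list \<Rightarrow> real \<Rightarrow> 'w \<Rightarrow> real" where
  "list_process xs s \<omega> = (\<Sum>(a, b, e)\<leftarrow>xs. e \<omega> * indicator {a..<b} s)"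

definition list_integral :: "(real \<Rightarrow> 'w \<Rightarrow> real) \<Rightarrow> (real \<times> real \<times> ('w \<Rightarrow> real)) list \<Rightarrow> 'w \<Rightarrow> real" where
  "list_integral B xs \<omega> = (\<Sum>(a, b, e)\<leftarrow>xs. e \<omega> * (B b \<omega> - B a \<omega>))"

section \<open>Common grids and the cut-off of the quadratic variation\<close>

lemma telescope_subgrid:
  fixes \<phi> :: "real \<Rightarrow> real" and ps :: "real list"
  assumes ps: "sorted_wrt (<) ps" "length ps = Suc n" and ab: "a \<in> set ps" "b \<in> set ps" "a \<le> b"
  shows "\<phi> b - \<phi> a = (\<Sum>k<n. if a \<le> ps ! k \<and> ps ! Suc k \<le> b then \<phi> (ps ! Suc k) - \<phi> (ps ! k) else 0)"
proof -
  obtain i j where i: "i \<le> n" "a = ps ! i" and j: "j \<le> n" "b = ps ! j"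
    using ab ps(2) by (auto simp: in_set_conv_nth less_Suc_eq_le)
  have less: "ps ! k < ps ! l" if "k < l" "l \<le> n" for k l
    using sorted_wrt_nth_less[OF ps(1), of k l] that ps(2) by simp
  have le_iff: "ps ! k \<le> ps ! l \<longleftrightarrow> k \<le> l" if "k \<le> n" "l \<le> n" for k l
    using less[of k l] less[of l k] that by (cases k l rule: linorder_cases) auto
  have "i \<le> j" using ab(3) le_iff i j by simp
  have "(\<Sum>k<n. if a \<le> ps ! k \<and> ps ! Suc k \<le> b then \<phi> (ps ! Suc k) - \<phi> (ps ! k) else 0) =
    (\<Sum>k\<in>{i..<j}. \<phi> (ps ! Suc k) - \<phi> (ps ! k))"
  proof (rule sum.mono_neutral_cong_right)
    show "finite {..<n}" "{i..<j} \<subseteq> {..<n}" using j by auto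
    show "\<forall>k\<in>{..<n} - {i..<j}. (if a \<le> ps ! k \<and> ps ! Suc k \<le> b then \<phi> (ps ! Suc k) - \<phi> (ps ! k) else 0) = 0"
      using le_iff i j by auto
    show "(if a \<le> ps ! k \<and> ps ! Suc k \<le> b then \<phi> (ps ! Suc k) - \<phi> (ps ! k) else 0) = \<phi> (ps ! Suc k) - \<phi> (ps ! k)"
      if "k \<in> {i..<j}" for k using le_iff i j that by auto
  qed
  also have "\<dots> = \<phi> (ps ! j) - \<phi> (ps ! i)"
    by (rule sum_Suc_diff'[OF \<open>i \<le> j\<close>])
  finally show ?thesis using i j by simp
qed

text \<open>The half-open cells are pairwise disjoint, hence all cross terms of the square
  vanish.\<close>

lemma nn_integral_grid_process_sq:
  fixes c r :: "nat \<Rightarrow> real"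
  assumes r: "\<And>i. i < n \<Longrightarrow> r i \<le> r (Suc i)"
  shows "(\<integral>\<^sup>+s. ennreal ((\<Sum>i<n. c i * indicator {r i..<r (Suc i)} s)\<^sup>2) \<partial>lborel) =
    ennreal (\<Sum>i<n. (c i)\<^sup>2 * (r (Suc i) - r i))"
proof -
  have r_mono: "r i \<le> r j" if "i \<le> j" "j \<le> n" for i j
    using that by (induction j rule: dec_induct) (use r in \<open>auto intro: order_trans\<close>)
  have sq: "(\<Sum>i<n. c i * indicator {r i..<r (Suc i)} s)\<^sup>2 = (\<Sum>i<n. (c i)\<^sup>2 * indicator {r i..<r (Suc i)} s)" for s
  proof -
    have "indicator {r i..<r (Suc i)} s * indicator {r j..<r (Suc j)} s = (0::real)" if "i < n" "j < n" "i \<noteq> j" for i j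
      using r_mono[of "Suc i" j] r_mono[of "Suc j" i] that
      by (cases i j rule: linorder_cases) (auto simp: indicator_def)
    then have z: "c i * indicator {r i..<r (Suc i)} s * (c j * indicator {r j..<r (Suc j)} s) =
      (if i = j then (c i)\<^sup>2 * indicator {r i..<r (Suc i)} s else 0)" if "i < n" "j < n" for i j
      using that by (auto simp: power2_eq_square indicator_def)
    show ?thesis unfolding power2_eq_square[of "sum _ _"] sum_product using z by (simp add: sum.delta)
  qed
  have "(\<integral>\<^sup>+s. ennreal ((\<Sum>i<n. c i * indicator {r i..<r (Suc i)} s)\<^sup>2) \<partial>lborel) =
    (\<integral>\<^sup>+s. (\<Sum>i<n. ennreal ((c i)\<^sup>2) * indicator {r i..<r (Suc i)} s) \<partial>lborel)"
  proof (intro nn_integral_cong)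
    fix s :: real
    show "ennreal ((\<Sum>i<n. c i * indicator {r i..<r (Suc i)} s)\<^sup>2) =
      (\<Sum>i<n. ennreal ((c i)\<^sup>2) * indicator {r i..<r (Suc i)} s)"
      unfolding sq by (subst sum_ennreal[symmetric]) (auto intro!: sum.cong simp: indicator_def)
  qed
  also have "\<dots> = (\<Sum>i<n. ennreal ((c i)\<^sup>2) * ennreal (r (Suc i) - r i))"
    by (subst nn_integral_sum) (use r in \<open>auto simp: nn_integral_cmult_indicator\<close>)
  also have "\<dots> = ennreal (\<Sum>i<n. (c i)\<^sup>2 * (r (Suc i) - r i))"
    using r by (subst sum_ennreal[symmetric]) (auto simp: ennreal_mult')
  finally show ?thesis .
qed

context brownian_motion
begin

definition adapted_steps :: "(real \<times> real \<times> ('w \<Rightarrow> real)) list \<Rightarrow> bool" where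
  "adapted_steps xs \<longleftrightarrow> (\<forall>(a, b, e) \<in> set xs. 0 \<le> a \<and> a \<le> b \<and> e \<in> borel_measurable (\<G> a) \<and>
     (\<exists>c. \<forall>\<omega>\<in>space M. \<bar>e \<omega>\<bar> \<le> c))"

text \<open>
  The coefficients are cut off at the first index where the quadratic variation would exceed \<open>L\<close>;
  this is decided at the left end of the interval since the grid is deterministic.
\<close>

lemma grid_cutoff:
  fixes c :: "nat \<Rightarrow> 'w \<Rightarrow> real" and r :: "nat \<Rightarrow> real"
  assumes r: "0 \<le> r 0" "\<And>i. i < n \<Longrightarrow> r i \<le> r (Suc i)"
    and c: "\<And>i. i < n \<Longrightarrow> c i \<in> borel_measurable (\<G> (r i))"
    and bdd: "\<And>i. i < n \<Longrightarrow> \<exists>C. \<forall>\<omega>\<in>space M. \<bar>c i \<omega>\<bar> \<le> C"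
    and L: "0 \<le> L"
  obtains S where "S \<in> borel_measurable M" "integrable M S" "expectation S = 0"
    "integrable M (\<lambda>\<omega>. (S \<omega>)\<^sup>2)" "expectation (\<lambda>\<omega>. (S \<omega>)\<^sup>2) \<le> L"
    "\<And>\<omega>. (\<Sum>i<n. (c i \<omega>)\<^sup>2 * (r (Suc i) - r i)) \<le> L \<Longrightarrow>
      S \<omega> = (\<Sum>i<n. c i \<omega> * (B (r (Suc i)) \<omega> - B (r i) \<omega>))"
proof -
  define d where "d i \<omega> = (if (\<Sum>j\<le>i. (c j \<omega>)\<^sup>2 * (r (Suc j) - r j)) \<le> L then c i \<omega> else 0)" for i \<omega>
  define S where "S k \<omega> = (\<Sum>i<k. d i \<omega> * (B (r (Suc i)) \<omega> - B (r i) \<omega>))" for k \<omega>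
  define Q where "Q k \<omega> = (\<Sum>i<k. (d i \<omega>)\<^sup>2 * (r (Suc i) - r i))" for k \<omega>
  have r_mono: "r i \<le> r j" if "i \<le> j" "j \<le> n" for i j
    using that by (induction j rule: dec_induct) (use r(2) in \<open>auto intro: order_trans\<close>)
  have r_nonneg: "0 \<le> r i" if "i \<le> n" for i using r_mono[of 0 i] that r(1) by simp
  have d_meas: "d i \<in> borel_measurable (\<G> (r i))" if "i < n" for i
  proof -
    have [measurable]: "c j \<in> borel_measurable (\<G> (r i))" if "j \<le> i" for j
      using measurable_completed_mono[OF c[of j] r_mono[of j i]] that \<open>i < n\<close> by simp
    have "(\<lambda>\<omega>. \<Sum>j\<le>i. (c j \<omega>)\<^sup>2 * (r (Suc j) - r j)) \<in> borel_measurable (\<G> (r i))"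
      by (intro borel_measurable_sum borel_measurable_times borel_measurable_power) auto
    then have [measurable]: "{\<omega> \<in> space M. (\<Sum>j\<le>i. (c j \<omega>)\<^sup>2 * (r (Suc j) - r j)) \<le> L} \<in> sets (\<G> (r i))"
      using borel_measurable_le[of _ "\<G> (r i)" "\<lambda>_. L"] by simp
    show ?thesis unfolding d_def[abs_def] by (intro measurable_If) auto
  qed
  have d_bdd: "\<exists>C. \<forall>\<omega>\<in>space M. \<bar>d i \<omega>\<bar> \<le> C" if "i < n" for i
  proof -
    obtain C where C: "\<forall>\<omega>\<in>space M. \<bar>c i \<omega>\<bar> \<le> C" using bdd[OF \<open>i < n\<close>] by blast
    then have "\<forall>\<omega>\<in>space M. \<bar>d i \<omega>\<bar> \<le> max C 0" unfolding d_def by auto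
    then show ?thesis by blast
  qed
  \<comment> \<open>The bound by the uncut sum is carried along in the induction: at an index that
    is not cut, it is the uncut sum that is known to be at most \<open>L\<close>.\<close>
  have Q: "Q k \<omega> \<le> min L (\<Sum>i<k. (c i \<omega>)\<^sup>2 * (r (Suc i) - r i))" if "k \<le> n" for k \<omega>
    using that
  proof (induction k)
    case 0
    then show ?case using L by (simp add: Q_def)
  next
    case (Suc k)
    then have IH: "Q k \<omega> \<le> min L (\<Sum>i<k. (c i \<omega>)\<^sup>2 * (r (Suc i) - r i))" by simp
    have "0 \<le> (c k \<omega>)\<^sup>2 * (r (Suc k) - r k)" using r(2)[of k] Suc.prems by simp
    then show ?case using IH unfolding Q_def d_def
      by (auto simp: lessThan_Suc_atMost[symmetric] split: if_splits)
  qed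
  have d_int: "integrable M (\<lambda>\<omega>. (d i \<omega>)\<^sup>2)" if "i < n" for i
  proof -
    obtain C where C: "\<forall>\<omega>\<in>space M. \<bar>d i \<omega>\<bar> \<le> C" using d_bdd[OF \<open>i < n\<close>] by blast
    have "d i \<in> borel_measurable M" using measurable_completedD[OF d_meas] that by simp
    then show ?thesis
      by (intro integrable_const_bound[of _ "C\<^sup>2"])
        (use C in \<open>auto intro!: AE_I2 simp: abs_le_square_iff[symmetric]\<close>)
  qed
  \<comment> \<open>Ito isometry for a finite sum, by induction. In the cross term the new increment
    is multiplied by a factor known at its left end, so the mean is zero; the squared increment
    contributes the length of the cell.\<close>
  have main: "S k \<in> borel_measurable (\<G> (r k)) \<and> integrable M (\<lambda>\<omega>. (S k \<omega>)\<^sup>2) \<and> expectation (S k) = 0 \<and>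
    expectation (\<lambda>\<omega>. (S k \<omega>)\<^sup>2) = expectation (Q k)" if "k \<le> n" for k
    using that
  proof (induction k)
    case 0
    then show ?case by (simp add: S_def Q_def)
  next
    case (Suc k)
    let ?B = "\<lambda>\<omega>. B (r (Suc k)) \<omega> - B (r k) \<omega>"
    have k: "k < n" and rk: "0 \<le> r k" "r k \<le> r (Suc k)" using Suc r_nonneg r(2) by auto
    have IH: "S k \<in> borel_measurable (\<G> (r k))" "integrable M (\<lambda>\<omega>. (S k \<omega>)\<^sup>2)" "expectation (S k) = 0"
      "expectation (\<lambda>\<omega>. (S k \<omega>)\<^sup>2) = expectation (Q k)" using Suc by auto
    note dm = d_meas[OF k]
    have dM: "d k \<in> borel_measurable M" and SM: "S k \<in> borel_measurable M"
      using measurable_completedD[OF dm] measurable_completedD[OF IH(1)] by auto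
    have S_int: "integrable M (S k)"
      using square_integrable_imp_integrable[OF SM IH(2)] .
    obtain C where C: "\<forall>\<omega>\<in>space M. \<bar>d k \<omega>\<bar> \<le> C" using d_bdd[OF k] by blast
    have di: "integrable M (d k)"
      by (intro integrable_const_bound[of _ C]) (use C dM in auto)
    have di2: "integrable M (\<lambda>\<omega>. (d k \<omega>)\<^sup>2)" by (rule d_int[OF k])
    have Sdi: "integrable M (\<lambda>\<omega>. S k \<omega> * d k \<omega>)"
    proof (rule Bochner_Integration.integrable_bound)
      show "integrable M (\<lambda>\<omega>. C * S k \<omega>)" using S_int by simp
      have "norm (S k \<omega> * d k \<omega>) \<le> norm (C * S k \<omega>)" if "\<omega> \<in> space M" for \<omega>
      proof -
        have "\<bar>d k \<omega>\<bar> \<le> \<bar>C\<bar>" using C that by force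
        then have "\<bar>S k \<omega>\<bar> * \<bar>d k \<omega>\<bar> \<le> \<bar>S k \<omega>\<bar> * \<bar>C\<bar>" by (rule mult_left_mono) simp
        then show ?thesis by (simp add: abs_mult mult.commute)
      qed
      then show "AE \<omega> in M. norm (S k \<omega> * d k \<omega>) \<le> norm (C * S k \<omega>)" by simp
      show "(\<lambda>\<omega>. S k \<omega> * d k \<omega>) \<in> borel_measurable M" using SM dM by measurable
    qed
    have m1: "(\<lambda>\<omega>. S k \<omega> * d k \<omega>) \<in> borel_measurable (\<G> (r k))" using IH(1) dm by measurable
    have m2: "(\<lambda>\<omega>. (d k \<omega>)\<^sup>2) \<in> borel_measurable (\<G> (r k))" using dm by measurable
    have Seq: "S (Suc k) = (\<lambda>\<omega>. S k \<omega> + d k \<omega> * ?B \<omega>)" by (auto simp: S_def)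
    have "?B \<in> borel_measurable (\<G> (r (Suc k)))"
      by (intro borel_measurable_diff B_measurable_completed) (use rk in auto)
    then have "S (Suc k) \<in> borel_measurable (\<G> (r (Suc k)))"
      unfolding Seq
      by (intro borel_measurable_add borel_measurable_times measurable_completed_mono[OF IH(1) rk(2)]
        measurable_completed_mono[OF dm rk(2)])
    moreover have sq: "(S (Suc k) \<omega>)\<^sup>2 = (S k \<omega>)\<^sup>2 + 2 * ((S k \<omega> * d k \<omega>) * ?B \<omega>) + (d k \<omega>)\<^sup>2 * (?B \<omega>)\<^sup>2" for \<omega>
      unfolding Seq by (simp add: power2_eq_square algebra_simps)
    have i1: "integrable M (\<lambda>\<omega>. (S k \<omega> * d k \<omega>) * ?B \<omega>)"
      by (rule integrable_mult_increment[OF rk m1 Sdi])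
    have i2: "integrable M (\<lambda>\<omega>. (d k \<omega>)\<^sup>2 * (?B \<omega>)\<^sup>2)"
      by (rule integrable_mult_increment_sq[OF rk m2 di2])
    have "integrable M (\<lambda>\<omega>. (S (Suc k) \<omega>)\<^sup>2)" unfolding sq using IH(2) i1 i2 by simp
    moreover have "expectation (S (Suc k)) = 0"
      unfolding Seq using S_int IH(3) integrable_mult_increment[OF rk dm di] expectation_mult_increment[OF rk dm di]
      by simp
    moreover have "expectation (\<lambda>\<omega>. (S (Suc k) \<omega>)\<^sup>2) = expectation (Q (Suc k))"
    proof -
      have "expectation (\<lambda>\<omega>. (S (Suc k) \<omega>)\<^sup>2) = expectation (Q k) + (r (Suc k) - r k) * expectation (\<lambda>\<omega>. (d k \<omega>)\<^sup>2)"
        unfolding sq using IH(2,4) i1 i2 expectation_mult_increment[OF rk m1 Sdi]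
          expectation_mult_increment_sq[OF rk m2 di2] by simp
      also have "\<dots> = expectation (Q (Suc k))"
      proof -
        have "integrable M (Q k)" unfolding Q_def[abs_def] using d_int k
          by (intro Bochner_Integration.integrable_sum integrable_mult_left) auto
        moreover have "Q (Suc k) = (\<lambda>\<omega>. Q k \<omega> + (d k \<omega>)\<^sup>2 * (r (Suc k) - r k))" by (auto simp: Q_def)
        ultimately show ?thesis using di2 by simp
      qed
      finally show ?thesis .
    qed
    ultimately show ?case by simp
  qed
  have main: "S n \<in> borel_measurable (\<G> (r n))" "integrable M (\<lambda>\<omega>. (S n \<omega>)\<^sup>2)" "expectation (S n) = 0"
    "expectation (\<lambda>\<omega>. (S n \<omega>)\<^sup>2) = expectation (Q n)" using main[of n] by auto
  show ?thesis
  proof (rule that)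
    show SM: "S n \<in> borel_measurable M" using measurable_completedD[OF main(1)] .
    show "integrable M (S n)" by (rule square_integrable_imp_integrable[OF SM main(2)])
    show "expectation (S n) = 0" "integrable M (\<lambda>\<omega>. (S n \<omega>)\<^sup>2)" by fact+
    have "integrable M (Q n)" unfolding Q_def[abs_def] using d_int
      by (intro Bochner_Integration.integrable_sum integrable_mult_left) auto
    then have "expectation (Q n) \<le> expectation (\<lambda>_. L)"
      by (intro integral_mono) (use Q in auto)
    then show "expectation (\<lambda>\<omega>. (S n \<omega>)\<^sup>2) \<le> L" using main(4) by (simp add: prob_space)
    show "S n \<omega> = (\<Sum>i<n. c i \<omega> * (B (r (Suc i)) \<omega> - B (r i) \<omega>))"
      if "(\<Sum>i<n. (c i \<omega>)\<^sup>2 * (r (Suc i) - r i)) \<le> L" for \<omega>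
    proof -
      have "d i \<omega> = c i \<omega>" if "i < n" for i
      proof -
        have "(\<Sum>j\<le>i. (c j \<omega>)\<^sup>2 * (r (Suc j) - r j)) \<le> (\<Sum>i<n. (c i \<omega>)\<^sup>2 * (r (Suc i) - r i))"
          by (rule sum_mono2) (use \<open>i < n\<close> r(2) in auto)
        then show ?thesis unfolding d_def using \<open>(\<Sum>i<n. (c i \<omega>)\<^sup>2 * (r (Suc i) - r i)) \<le> L\<close> by simp
      qed
      then show ?thesis unfolding S_def by simp
    qed
  qed
qed

text \<open>All endpoints are sorted, together with 0 to keep the list nonempty; the coefficient of
  a cell is the sum over those intervals that contain it. Such intervals start no later than the
  cell, which gives adaptedness.\<close>

lemma adapted_steps_grid:
  assumes xs: "adapted_steps xs"
  obtains n r c where "0 \<le> r 0" "\<And>i. i < n \<Longrightarrow> r i \<le> r (Suc i)"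
    "\<And>i. i < n \<Longrightarrow> c i \<in> borel_measurable (\<G> (r i))"
    "\<And>i. i < n \<Longrightarrow> \<exists>C. \<forall>\<omega>\<in>space M. \<bar>c i \<omega>\<bar> \<le> C"
    "\<And>\<omega>. list_integral B xs \<omega> = (\<Sum>i<n. c i \<omega> * (B (r (Suc i)) \<omega> - B (r i) \<omega>))"
    "\<And>\<omega> s. list_process xs s \<omega> = (\<Sum>i<n. c i \<omega> * indicator {r i..<r (Suc i)} s)"
proof -
  define P where "P = insert 0 (fst ` set xs \<union> (fst \<circ> snd) ` set xs)"
  define ps where "ps = sorted_list_of_set P"
  have P: "finite P" "\<And>q. q \<in> P \<Longrightarrow> 0 \<le> q"
    unfolding P_def using xs by (force simp: adapted_steps_def)+
  have ps: "sorted_wrt (<) ps" "set ps = P" unfolding ps_def using P by simp_all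
  define n where "n = length ps - 1"
  have len: "length ps = Suc n" using ps unfolding n_def by (cases ps) (auto simp: P_def)
  define r where "r i = ps ! i" for i
  define c where "c k \<omega> = (\<Sum>(a, b, e)\<leftarrow>xs. if a \<le> r k \<and> r (Suc k) \<le> b then e \<omega> else 0)" for k \<omega>
  have xsD: "0 \<le> a" "a \<le> b" "e \<in> borel_measurable (\<G> a)" "\<exists>c. \<forall>\<omega>\<in>space M. \<bar>e \<omega>\<bar> \<le> c"
    "a \<in> set ps" "b \<in> set ps" if "(a, b, e) \<in> set xs" for a b e
  proof -
    show "0 \<le> a" "a \<le> b" "e \<in> borel_measurable (\<G> a)" "\<exists>c. \<forall>\<omega>\<in>space M. \<bar>e \<omega>\<bar> \<le> c"
      using xs that unfolding adapted_steps_def by blast+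
    have "fst (a, b, e) \<in> fst ` set xs" "(fst \<circ> snd) (a, b, e) \<in> (fst \<circ> snd) ` set xs"
      using that by (blast intro: imageI)+
    then show "a \<in> set ps" "b \<in> set ps" unfolding ps P_def by auto
  qed
  \<comment> \<open>One identity for arbitrary \<open>\<phi>\<close>: with a path of
    \<open>B\<close> it yields the integral, with \<open>indicator {..<b} s\<close> as a function of
    \<open>b\<close> it yields the process at time \<open>s\<close>.\<close>
  have tele: "(\<Sum>(a, b, e)\<leftarrow>xs. e \<omega> * (\<phi> b - \<phi> a)) = (\<Sum>k<n. c k \<omega> * (\<phi> (r (Suc k)) - \<phi> (r k)))" for \<phi> \<omega>
  proof -
    have "(\<Sum>(a, b, e)\<leftarrow>xs. e \<omega> * (\<phi> b - \<phi> a)) =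
      (\<Sum>x\<leftarrow>xs. case x of (a, b, e) \<Rightarrow> \<Sum>k<n. (if a \<le> r k \<and> r (Suc k) \<le> b then e \<omega> else 0) * (\<phi> (r (Suc k)) - \<phi> (r k)))"
    proof (rule arg_cong[where f = sum_list], rule map_cong[OF refl])
      fix x assume x: "x \<in> set xs"
      obtain a b e where abe: "x = (a, b, e)" by (cases x)
      have "\<phi> b - \<phi> a = (\<Sum>k<n. if a \<le> ps ! k \<and> ps ! Suc k \<le> b then \<phi> (ps ! Suc k) - \<phi> (ps ! k) else 0)"
        by (rule telescope_subgrid[OF ps(1) len]) (use xsD x abe in auto)
      then show "(case x of (a, b, e) \<Rightarrow> e \<omega> * (\<phi> b - \<phi> a)) =
        (case x of (a, b, e) \<Rightarrow> \<Sum>k<n. (if a \<le> r k \<and> r (Suc k) \<le> b then e \<omega> else 0) * (\<phi> (r (Suc k)) - \<phi> (r k)))"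
        unfolding abe r_def by (auto simp: sum_distrib_left intro!: sum.cong)
    qed
    also have "\<dots> = (\<Sum>k<n. c k \<omega> * (\<phi> (r (Suc k)) - \<phi> (r k)))"
      unfolding c_def by (induction xs) (auto simp: sum.distrib distrib_right split: prod.splits)
    finally show ?thesis .
  qed
  have r_mono: "r i \<le> r (Suc i)" if "i < n" for i
    using sorted_wrt_nth_less[OF ps(1), of i "Suc i"] that len unfolding r_def by simp
  show ?thesis
  proof (rule that)
    show "0 \<le> r 0" unfolding r_def using P(2) ps(2) len nth_mem[of 0 ps] by simp
    show "r i \<le> r (Suc i)" if "i < n" for i using r_mono that .
    show "c i \<in> borel_measurable (\<G> (r i))" if "i < n" for i
    proof -
      have "(\<lambda>\<omega>. \<Sum>(a, b, e)\<leftarrow>ys. if a \<le> r i \<and> r (Suc i) \<le> b then e \<omega> else 0) \<in> borel_measurable (\<G> (r i))"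
        if "set ys \<subseteq> set xs" for ys
        using that
      proof (induction ys)
        case (Cons x ys)
        obtain a b e where abe: "x = (a, b, e)" by (cases x)
        then have e: "e \<in> borel_measurable (\<G> a)" using xsD(3) Cons by auto
        have "(\<lambda>\<omega>. if a \<le> r i \<and> r (Suc i) \<le> b then e \<omega> else 0) \<in> borel_measurable (\<G> (r i))"
        proof (cases "a \<le> r i \<and> r (Suc i) \<le> b")
          case True
          then have "e \<in> borel_measurable (\<G> (r i))" by (intro measurable_completed_mono[OF e]) simp
          then show ?thesis using True by simp
        next
          case False
          then show ?thesis by (simp only: if_False) simp
        qed
        with Cons show ?case unfolding abe by simp
      qed simp
      then show ?thesis unfolding c_def[abs_def] by blast
    qed
    show "\<exists>C. \<forall>\<omega>\<in>space M. \<bar>c i \<omega>\<bar> \<le> C" if "i < n" for i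
    proof -
      have "\<exists>C. \<forall>\<omega>\<in>space M. \<bar>\<Sum>(a, b, e)\<leftarrow>ys. if a \<le> r i \<and> r (Suc i) \<le> b then e \<omega> else 0\<bar> \<le> C"
        if "set ys \<subseteq> set xs" for ys
        using that
      proof (induction ys)
        case (Cons x ys)
        obtain a b e where abe: "x = (a, b, e)" by (cases x)
        then have "(a, b, e) \<in> set xs" using Cons.prems by simp
        then obtain C where C: "\<forall>\<omega>\<in>space M. \<bar>e \<omega>\<bar> \<le> C" using xsD(4) by blast
        obtain C' where C': "\<forall>\<omega>\<in>space M. \<bar>\<Sum>(a, b, e)\<leftarrow>ys. if a \<le> r i \<and> r (Suc i) \<le> b then e \<omega> else 0\<bar> \<le> C'"
          using Cons by auto
        have "\<forall>\<omega>\<in>space M. \<bar>\<Sum>(a, b, e)\<leftarrow>x # ys. if a \<le> r i \<and> r (Suc i) \<le> b then e \<omega> else 0\<bar> \<le> \<bar>C\<bar> + C'"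
        proof
          fix \<omega> assume "\<omega> \<in> space M"
          then have "\<bar>e \<omega>\<bar> \<le> C" "\<bar>\<Sum>(a, b, e)\<leftarrow>ys. if a \<le> r i \<and> r (Suc i) \<le> b then e \<omega> else 0\<bar> \<le> C'"
            using C C' by auto
          then show "\<bar>\<Sum>(a, b, e)\<leftarrow>x # ys. if a \<le> r i \<and> r (Suc i) \<le> b then e \<omega> else 0\<bar> \<le> \<bar>C\<bar> + C'"
            unfolding abe by auto
        qed
        then show ?case by blast
      qed auto
      then show ?thesis unfolding c_def[abs_def] by blast
    qed
    show "list_integral B xs \<omega> = (\<Sum>i<n. c i \<omega> * (B (r (Suc i)) \<omega> - B (r i) \<omega>))" for \<omega>
      unfolding list_integral_def by (rule tele)
    show "list_process xs s \<omega> = (\<Sum>i<n. c i \<omega> * indicator {r i..<r (Suc i)} s)" for \<omega> s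
    proof -
      let ?\<phi> = "\<lambda>b. indicator {..<b} s :: real"
      have ind: "indicator {a..<b} s = ?\<phi> b - ?\<phi> a" if "a \<le> b" for a b
        using that by (auto simp: indicator_def)
      have "list_process xs s \<omega> = (\<Sum>(a, b, e)\<leftarrow>xs. e \<omega> * (?\<phi> b - ?\<phi> a))"
        unfolding list_process_def
      proof (rule arg_cong[where f = sum_list], rule map_cong[OF refl])
        fix x assume x: "x \<in> set xs"
        obtain a b e where abe: "x = (a, b, e)" by (cases x)
        show "(case x of (a, b, e) \<Rightarrow> e \<omega> * indicator {a..<b} s) = (case x of (a, b, e) \<Rightarrow> e \<omega> * (?\<phi> b - ?\<phi> a))"
          using ind[of a b] xsD(2)[of a b e] x unfolding abe by simp
      qed
      also have "\<dots> = (\<Sum>k<n. c k \<omega> * (?\<phi> (r (Suc k)) - ?\<phi> (r k)))" by (rule tele)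
      also have "\<dots> = (\<Sum>i<n. c i \<omega> * indicator {r i..<r (Suc i)} s)"
        by (rule sum.cong) (use ind r_mono in auto)
      finally show ?thesis .
    qed
  qed
qed

text \<open>The condition under which the cut-off is inactive is stated for the represented process,
  which makes it insensitive to overlaps in the list.\<close>

lemma list_integral_cutoff:
  assumes xs: "adapted_steps xs" and L: "0 \<le> L"
  obtains S where "S \<in> borel_measurable M" "integrable M S" "expectation S = 0"
    "integrable M (\<lambda>\<omega>. (S \<omega>)\<^sup>2)" "expectation (\<lambda>\<omega>. (S \<omega>)\<^sup>2) \<le> L"
    "\<And>\<omega>. (\<integral>\<^sup>+s. ennreal ((list_process xs s \<omega>)\<^sup>2) \<partial>lborel) \<le> ennreal L \<Longrightarrow> S \<omega> = list_integral B xs \<omega>"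
proof (rule adapted_steps_grid[OF xs])
  fix n :: nat and r :: "nat \<Rightarrow> real" and c :: "nat \<Rightarrow> 'w \<Rightarrow> real"
  assume g: "0 \<le> r 0" "\<And>i. i < n \<Longrightarrow> r i \<le> r (Suc i)"
    "\<And>i. i < n \<Longrightarrow> c i \<in> borel_measurable (\<G> (r i))"
    "\<And>i. i < n \<Longrightarrow> \<exists>C. \<forall>\<omega>\<in>space M. \<bar>c i \<omega>\<bar> \<le> C"
    and eq: "\<And>\<omega>. list_integral B xs \<omega> = (\<Sum>i<n. c i \<omega> * (B (r (Suc i)) \<omega> - B (r i) \<omega>))"
    "\<And>\<omega> s. list_process xs s \<omega> = (\<Sum>i<n. c i \<omega> * indicator {r i..<r (Suc i)} s)"
  show ?thesis
  proof (rule grid_cutoff[of r n c L, OF g L])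
    fix S
    assume S: "S \<in> borel_measurable M" "integrable M S" "expectation S = 0"
      "integrable M (\<lambda>\<omega>. (S \<omega>)\<^sup>2)" "expectation (\<lambda>\<omega>. (S \<omega>)\<^sup>2) \<le> L"
      and S_eq: "\<And>\<omega>. (\<Sum>i<n. (c i \<omega>)\<^sup>2 * (r (Suc i) - r i)) \<le> L \<Longrightarrow>
        S \<omega> = (\<Sum>i<n. c i \<omega> * (B (r (Suc i)) \<omega> - B (r i) \<omega>))"
    show ?thesis
    proof (rule that[OF S])
      fix \<omega> assume "(\<integral>\<^sup>+s. ennreal ((list_process xs s \<omega>)\<^sup>2) \<partial>lborel) \<le> ennreal L"
      then have "ennreal (\<Sum>i<n. (c i \<omega>)\<^sup>2 * (r (Suc i) - r i)) \<le> ennreal L"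
        using nn_integral_grid_process_sq[of n r "\<lambda>i. c i \<omega>", OF g(2)] unfolding eq by simp
      then have "(\<Sum>i<n. (c i \<omega>)\<^sup>2 * (r (Suc i) - r i)) \<le> L" using L by (subst (asm) ennreal_le_iff)
      then show "S \<omega> = list_integral B xs \<omega>" unfolding eq by (rule S_eq)
    qed
  qed
qed

text \<open>A Lenglart-type estimate: outside \<open>Q\<close> the cut-off at level
  \<open>\<delta>\<close> changes nothing, and Chebyshev's inequality applies to the cut-off
  integral. \<open>Q\<close> may be any event containing the exceptional set, so the measurability
  of that set itself is never at issue.\<close>

lemma list_integral_in_prob:
  assumes xs: "adapted_steps xs" and "0 < \<epsilon>" "0 \<le> \<delta>"
    and Q: "{\<omega>\<in>space M. ennreal \<delta> < (\<integral>\<^sup>+s. ennreal ((list_process xs s \<omega>)\<^sup>2) \<partial>lborel)} \<subseteq> Q" "Q \<in> events"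
  shows "prob {\<omega>\<in>space M. \<epsilon> < \<bar>list_integral B xs \<omega>\<bar>} \<le> prob Q + \<delta> / \<epsilon>\<^sup>2"
proof -
  obtain S where S: "S \<in> borel_measurable M" "integrable M (\<lambda>\<omega>. (S \<omega>)\<^sup>2)" "expectation (\<lambda>\<omega>. (S \<omega>)\<^sup>2) \<le> \<delta>"
    "\<And>\<omega>. (\<integral>\<^sup>+s. ennreal ((list_process xs s \<omega>)\<^sup>2) \<partial>lborel) \<le> ennreal \<delta> \<Longrightarrow> S \<omega> = list_integral B xs \<omega>"
    using list_integral_cutoff[OF xs assms(3)] by metis
  let ?A = "{\<omega>\<in>space M. \<epsilon>\<^sup>2 \<le> (S \<omega>)\<^sup>2}"
  have A: "?A \<in> events" using S(1) by measurable
  have "{\<omega>\<in>space M. \<epsilon> < \<bar>list_integral B xs \<omega>\<bar>} \<subseteq> Q \<union> ?A"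
  proof safe
    fix \<omega> assume \<omega>: "\<omega> \<in> space M" "\<epsilon> < \<bar>list_integral B xs \<omega>\<bar>" "\<omega> \<notin> Q"
    then have "S \<omega> = list_integral B xs \<omega>" using Q(1) by (intro S(4)) (metis (mono_tags, lifting) mem_Collect_eq not_less subsetD)
    then have "\<bar>\<epsilon>\<bar> \<le> \<bar>S \<omega>\<bar>" using \<omega> assms(2) by simp
    then show "\<epsilon>\<^sup>2 \<le> (S \<omega>)\<^sup>2" by (simp add: abs_le_square_iff)
  qed
  then have "prob {\<omega>\<in>space M. \<epsilon> < \<bar>list_integral B xs \<omega>\<bar>} \<le> prob (Q \<union> ?A)"
    using Q A by (intro finite_measure_mono) auto
  also have "\<dots> \<le> prob Q + prob ?A" using Q A by (intro measure_Un_le) auto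
  also have "prob ?A \<le> expectation (\<lambda>\<omega>. (S \<omega>)\<^sup>2) / \<epsilon>\<^sup>2"
    using integral_Markov_inequality_measure[OF S(2), of "{}" "\<epsilon>\<^sup>2"] assms(2) by simp
  also have "\<dots> \<le> \<delta> / \<epsilon>\<^sup>2" by (rule divide_right_mono[OF S(3)]) simp
  finally show ?thesis by simp
qed

end

section \<open>Approximation of Ito integrals, and adaptedness\<close>

definition stopped_step_integral ::
  "(real \<Rightarrow> 'w \<Rightarrow> real) \<Rightarrow> nat \<Rightarrow> (nat \<Rightarrow> real) \<Rightarrow> (nat \<Rightarrow> 'w \<Rightarrow> 'a::euclidean_space) \<Rightarrow> real \<Rightarrow> 'w \<Rightarrow> 'a" where
  "stopped_step_integral B N r e t \<omega> = (\<Sum>i<N. (B (min (r (Suc i)) t) \<omega> - B (min (r i) t) \<omega>) *\<^sub>R e i \<omega>)"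

definition step_distance ::
  "real \<Rightarrow> (real \<Rightarrow> 'w \<Rightarrow> 'a::euclidean_space) \<Rightarrow> nat \<Rightarrow> (nat \<Rightarrow> real) \<Rightarrow> (nat \<Rightarrow> 'w \<Rightarrow> 'a) \<Rightarrow> 'w \<Rightarrow> ennreal" where
  "step_distance t H N r e \<omega> =
    (\<integral>\<^sup>+s\<in>{0..t}. ennreal ((norm (step_process N r e s \<omega> - H s \<omega>))\<^sup>2) \<partial>lborel)"

text \<open>These steps encode the product of \<open>g\<close> with the step process on [a, b).
  Clipped left ends are at least \<open>a\<close>, so a factor known at time \<open>a\<close> is
  known at each of them. Intervals whose clipping is reversed are dropped because adapted lists ask
  for left end \<le> right end.\<close>

definition window_steps ::
  "nat \<Rightarrow> (nat \<Rightarrow> real) \<Rightarrow> (nat \<Rightarrow> 'w \<Rightarrow> 'a::euclidean_space) \<Rightarrow> real \<Rightarrow> real \<Rightarrow> ('w \<Rightarrow> 'a) \<Rightarrow>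
    (real \<times> real \<times> ('w \<Rightarrow> real)) list" where
  "window_steps N r e a b g =
    map (\<lambda>i. (max (r i) a, min (r (Suc i)) b, \<lambda>\<omega>. g \<omega> \<bullet> e i \<omega>))
      (filter (\<lambda>i. max (r i) a \<le> min (r (Suc i)) b) [0..<N])"

lemma step_data_mono:
  assumes "step_data M B t N r e" "i \<le> j" "j \<le> N"
  shows "r i \<le> r j"
  using assms(2,3) by (induction j rule: dec_induct) (use assms(1) in \<open>auto simp: step_data_def intro: order_trans\<close>)

lemma step_data_bounds:
  assumes "step_data M B t N r e" "i \<le> N"
  shows "0 \<le> r i" "r i \<le> t"
  using step_data_mono[OF assms(1), of 0 i] step_data_mono[OF assms(1), of i N] assms
  by (auto simp: step_data_def)

lemma stopped_step_integral_eq: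
  assumes "step_data M B t N r e"
  shows "stopped_step_integral B N r e t = step_integral B N r e"
  unfolding stopped_step_integral_def[abs_def] step_integral_def[abs_def]
  using step_data_bounds(2)[OF assms] by (intro ext sum.cong) (auto simp: min_absorb1)

lemma stopped_step_integral_0:
  assumes "step_data M B t N r e"
  shows "stopped_step_integral B N r e 0 \<omega> = 0"
  unfolding stopped_step_integral_def
  using step_data_bounds(1)[OF assms] by (intro sum.neutral) (auto simp: min_absorb2)

lemma list_integral_append: "list_integral B (xs @ ys) \<omega> = list_integral B xs \<omega> + list_integral B ys \<omega>"
  by (simp add: list_integral_def)

lemma list_process_append: "list_process (xs @ ys) s \<omega> = list_process xs s \<omega> + list_process ys s \<omega>"
  by (simp add: list_process_def)

text \<open>Stopping at \<open>b\<close> and at \<open>a\<close> and subtracting leaves exactly the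
  increments inside the window; for intervals that miss the window the stopped increments
  cancel.\<close>

lemma list_integral_window_steps:
  assumes r: "\<forall>i<N. r i \<le> r (Suc i)" and "a \<le> b"
  shows "list_integral B (window_steps N r e a b g) \<omega> =
    g \<omega> \<bullet> (stopped_step_integral B N r e b \<omega> - stopped_step_integral B N r e a \<omega>)"
proof -
  have "list_integral B (window_steps N r e a b g) \<omega> =
    (\<Sum>i<N. if max (r i) a \<le> min (r (Suc i)) b
      then (g \<omega> \<bullet> e i \<omega>) * (B (min (r (Suc i)) b) \<omega> - B (max (r i) a) \<omega>) else 0)"
    unfolding list_integral_def window_steps_def
    by (simp add: comp_def sum_list_map_filter' interv_sum_list_conv_sum_set_nat atLeast0LessThan del: max.bounded_iff min.bounded_iff)
  also have "\<dots> = (\<Sum>i<N. (g \<omega> \<bullet> e i \<omega>) *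
    ((B (min (r (Suc i)) b) \<omega> - B (min (r i) b) \<omega>) - (B (min (r (Suc i)) a) \<omega> - B (min (r i) a) \<omega>)))"
  proof (intro sum.cong refl)
    fix i assume "i \<in> {..<N}"
    then have ri: "r i \<le> r (Suc i)" using r by simp
    show "(if max (r i) a \<le> min (r (Suc i)) b
        then (g \<omega> \<bullet> e i \<omega>) * (B (min (r (Suc i)) b) \<omega> - B (max (r i) a) \<omega>) else 0) =
      (g \<omega> \<bullet> e i \<omega>) * ((B (min (r (Suc i)) b) \<omega> - B (min (r i) b) \<omega>) -
        (B (min (r (Suc i)) a) \<omega> - B (min (r i) a) \<omega>))"
    proof (cases "max (r i) a \<le> min (r (Suc i)) b")
      case True
      then have "min (r i) b = r i" "min (r (Suc i)) a = a" by simp_all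
      \<comment> \<open>\<open>max\<close> and \<open>min\<close> only permute \<open>r i\<close>
        and \<open>a\<close>, so the two values of \<open>B\<close> have the same sum as
        \<open>B (r i)\<close> and \<open>B a\<close>.\<close>
      moreover have "B (max (r i) a) \<omega> = B (r i) \<omega> + B a \<omega> - B (min (r i) a) \<omega>"
        by (simp add: min_def max_def)
      ultimately show ?thesis using True by simp
    next
      case False
      then have "b < r i \<or> r (Suc i) < a" using ri \<open>a \<le> b\<close> by auto
      then show ?thesis using False ri \<open>a \<le> b\<close> by (auto simp: min_def)
    qed
  qed
  also have "\<dots> = g \<omega> \<bullet> (stopped_step_integral B N r e b \<omega> - stopped_step_integral B N r e a \<omega>)"
    unfolding stopped_step_integral_def sum_subtractf[symmetric] inner_sum_right
    by (intro sum.cong) (auto simp: algebra_simps)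
  finally show ?thesis .
qed

lemma list_process_window_steps:
  assumes r: "\<forall>i<N. r i \<le> r (Suc i)"
  shows "list_process (window_steps N r e a b g) s \<omega> = indicator {a..<b} s * (g \<omega> \<bullet> step_process N r e s \<omega>)"
proof -
  have "list_process (window_steps N r e a b g) s \<omega> =
    (\<Sum>i<N. if max (r i) a \<le> min (r (Suc i)) b
      then (g \<omega> \<bullet> e i \<omega>) * indicator {max (r i) a..<min (r (Suc i)) b} s else 0)"
    unfolding list_process_def window_steps_def
    by (simp add: comp_def sum_list_map_filter' interv_sum_list_conv_sum_set_nat atLeast0LessThan
      del: max.bounded_iff min.bounded_iff sum_mult_indicator)
  also have "\<dots> = (\<Sum>i<N. indicator {a..<b} s * (indicator {r i..<r (Suc i)} s * (g \<omega> \<bullet> e i \<omega>)))"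
    by (intro sum.cong refl) (auto simp: indicator_def)
  also have "\<dots> = indicator {a..<b} s * (g \<omega> \<bullet> step_process N r e s \<omega>)"
    unfolding step_process_def by (simp only: inner_sum_right sum_distrib_left inner_scaleR_right)
  finally show ?thesis .
qed

lemma step_process_measurable:
  "(\<lambda>s. step_process N r e s \<omega>) \<in> borel_measurable borel"
  unfolding step_process_def[abs_def] by measurable

lemma norm_diff_sq_le: "(norm (a - b :: 'b::real_normed_vector))\<^sup>2 \<le> 2 * ((norm (a - c))\<^sup>2 + (norm (b - c))\<^sup>2)"
proof -
  have "norm (a - b) \<le> norm (a - c) + norm (b - c)"
    using norm_triangle_ineq4[of "a - c" "b - c"] by simp
  then have "(norm (a - b))\<^sup>2 \<le> (norm (a - c) + norm (b - c))\<^sup>2" by (rule power_mono) simp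
  also have "\<dots> \<le> 2 * ((norm (a - c))\<^sup>2 + (norm (b - c))\<^sup>2)"
    using sum_squares_bound[of "norm (a - c)" "norm (b - c)"] by (simp add: power2_sum)
  finally show ?thesis .
qed

context brownian_motion
begin

lemma adapted_steps_window:
  fixes e :: "nat \<Rightarrow> 'w \<Rightarrow> 'a::euclidean_space"
  assumes sd: "step_data M B t N r e" and "0 \<le> a" and g: "g \<in> borel_measurable (\<G> a)"
    and bdd: "\<And>\<omega>. \<omega> \<in> space M \<Longrightarrow> norm (g \<omega>) \<le> C"
  shows "adapted_steps (window_steps N r e a b g)"
  unfolding adapted_steps_def
proof clarify
  fix u v f assume "(u, v, f) \<in> set (window_steps N r e a b g)"
  then obtain i where i: "i < N" "max (r i) a \<le> min (r (Suc i)) b"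
    and f: "u = max (r i) a" "v = min (r (Suc i)) b" "f = (\<lambda>\<omega>. g \<omega> \<bullet> e i \<omega>)"
    unfolding window_steps_def by auto
  have "e i \<in> borel_measurable (\<F> (r i))" using sd i(1) by (auto simp: step_data_def)
  then have "e i \<in> borel_measurable (\<G> u)"
    by (rule measurable_completed_mono[OF measurable_naturalD]) (simp add: f)
  moreover have "g \<in> borel_measurable (\<G> u)" by (rule measurable_completed_mono[OF g]) (simp add: f)
  ultimately have "f \<in> borel_measurable (\<G> u)" unfolding f by simp
  obtain c where c: "\<And>\<omega>. \<omega> \<in> space M \<Longrightarrow> norm (e i \<omega>) \<le> c"
    using sd i(1) unfolding step_data_def by blast
  have "\<bar>f \<omega>\<bar> \<le> C * c" if "\<omega> \<in> space M" for \<omega>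
  proof -
    have "\<bar>f \<omega>\<bar> \<le> norm (g \<omega>) * norm (e i \<omega>)" unfolding f by (rule Cauchy_Schwarz_ineq2)
    also have "\<dots> \<le> C * c"
      using bdd[OF that] c[OF that] by (intro mult_mono) (auto intro: order_trans[OF norm_ge_zero])
    finally show ?thesis .
  qed
  then have "\<exists>c. \<forall>\<omega>\<in>space M. \<bar>f \<omega>\<bar> \<le> c" by blast
  with \<open>f \<in> _\<close> i f \<open>0 \<le> a\<close> show "0 \<le> u \<and> u \<le> v \<and> f \<in> borel_measurable (\<G> u) \<and> (\<exists>c. \<forall>\<omega>\<in>space M. \<bar>f \<omega>\<bar> \<le> c)"
    by auto
qed

lemma measurable_stopped_step_integral:
  fixes e :: "nat \<Rightarrow> 'w \<Rightarrow> 'a::euclidean_space"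
  assumes sd: "step_data M B T N r e" and "0 \<le> t"
  shows "stopped_step_integral B N r e t \<in> borel_measurable M"
  unfolding stopped_step_integral_def[abs_def]
proof (intro borel_measurable_sum borel_measurable_scaleR borel_measurable_diff)
  fix i assume "i \<in> {..<N}"
  then have i: "i < N" by simp
  show "B (min (r (Suc i)) t) \<in> borel_measurable M" "B (min (r i) t) \<in> borel_measurable M"
    using step_data_bounds(1)[OF sd] i \<open>0 \<le> t\<close> by (auto intro!: measurable_B)
  have "e i \<in> borel_measurable (\<F> (r i))" using sd i by (auto simp: step_data_def)
  then show "e i \<in> borel_measurable M" by (intro measurable_completedD measurable_naturalD)
qed

lemma measurable_step_integral:
  fixes e :: "nat \<Rightarrow> 'w \<Rightarrow> 'a::euclidean_space"
  assumes sd: "step_data M B t N r e"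
  shows "step_integral B N r e \<in> borel_measurable (\<G> t)"
  unfolding step_integral_def[abs_def]
proof (intro borel_measurable_sum borel_measurable_scaleR borel_measurable_diff)
  fix i assume "i \<in> {..<N}"
  then have i: "i < N" by simp
  show "B (r (Suc i)) \<in> borel_measurable (\<G> t)" "B (r i) \<in> borel_measurable (\<G> t)"
    using step_data_bounds[OF sd] i by (auto intro!: B_measurable_completed)
  have "e i \<in> borel_measurable (\<F> (r i))" using sd i by (auto simp: step_data_def)
  then show "e i \<in> borel_measurable (\<G> t)"
    by (rule measurable_completed_mono[OF measurable_naturalD]) (use step_data_bounds(2)[OF sd, of i] i in simp)
qed

lemma has_ito_integral_approx:
  fixes H :: "real \<Rightarrow> 'w \<Rightarrow> 'a::euclidean_space"
  assumes ito: "has_ito_integral M B H t J" and "0 < \<epsilon>"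
  obtains N r e where "step_data M B t N r e" "step_distance t H N r e \<in> borel_measurable M"
    "prob {\<omega>\<in>space M. ennreal \<epsilon> < step_distance t H N r e \<omega>} < \<epsilon>"
    "prob {\<omega>\<in>space M. \<epsilon> < norm (step_integral B N r e \<omega> - J \<omega>)} < \<epsilon>"
proof -
  from ito obtain N r e where sd: "\<And>n. step_data M B t (N n) (r n) (e n)"
    and n1: "null_in_prob M (\<lambda>n. step_distance t H (N n) (r n) (e n))"
    and n2: "null_in_prob M (\<lambda>n \<omega>. ennreal (norm (step_integral B (N n) (r n) (e n) \<omega> - J \<omega>)))"
    unfolding has_ito_integral_def step_distance_def[abs_def] by blast
  have "eventually (\<lambda>n. prob {\<omega>\<in>space M. ennreal \<epsilon> < step_distance t H (N n) (r n) (e n) \<omega>} < \<epsilon>) sequentially"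
    using n1 \<open>0 < \<epsilon>\<close> unfolding null_in_prob_def by (auto intro: order_tendstoD)
  moreover have "eventually (\<lambda>n. prob {\<omega>\<in>space M. ennreal \<epsilon> < ennreal (norm (step_integral B (N n) (r n) (e n) \<omega> - J \<omega>))} < \<epsilon>) sequentially"
    using n2 \<open>0 < \<epsilon>\<close> unfolding null_in_prob_def by (auto intro: order_tendstoD)
  ultimately have "eventually (\<lambda>n. prob {\<omega>\<in>space M. ennreal \<epsilon> < step_distance t H (N n) (r n) (e n) \<omega>} < \<epsilon> \<and>
     prob {\<omega>\<in>space M. ennreal \<epsilon> < ennreal (norm (step_integral B (N n) (r n) (e n) \<omega> - J \<omega>))} < \<epsilon>) sequentially"
    by eventually_elim simp
  then obtain n where "prob {\<omega>\<in>space M. ennreal \<epsilon> < step_distance t H (N n) (r n) (e n) \<omega>} < \<epsilon>"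
     "prob {\<omega>\<in>space M. ennreal \<epsilon> < ennreal (norm (step_integral B (N n) (r n) (e n) \<omega> - J \<omega>))} < \<epsilon>"
    by (auto simp: eventually_sequentially)
  then show ?thesis
    using that[of "N n" "r n" "e n"] sd n1 \<open>0 < \<epsilon>\<close> by (simp add: null_in_prob_def ennreal_less_iff)
qed

text \<open>The definition of the integral offers unrelated approximants for \<open>T\<close> and
  for \<open>t\<close>. On [0, t] both are close to \<open>H\<close> in L2, so their difference is a
  step process of small quadratic variation, and its integral is small in probability. Testing
  against one basis vector makes the problem scalar.\<close>

lemma ito_approximants_consistent:
  fixes H :: "real \<Rightarrow> 'w \<Rightarrow> 'a::euclidean_space"
  assumes sd: "step_data M B T N r e" and sdist: "step_distance T H N r e \<in> borel_measurable M"
    and prob: "prob {\<omega>\<in>space M. ennreal \<delta> < step_distance T H N r e \<omega>} \<le> \<delta>"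
    and sd': "step_data M B t N' r' e'" and sdist': "step_distance t H N' r' e' \<in> borel_measurable M"
    and prob': "prob {\<omega>\<in>space M. ennreal \<delta> < step_distance t H N' r' e' \<omega>} \<le> \<delta>"
    and t: "0 \<le> t" "t \<le> T" and "0 < \<delta>" "0 < \<eta>" and b: "b \<in> Basis"
    and H: "\<And>\<omega>. \<omega> \<in> space M \<Longrightarrow> (\<lambda>s. indicator {0..} s *\<^sub>R H s \<omega>) \<in> borel_measurable borel"
  shows "prob {\<omega>\<in>space M. \<eta> < \<bar>b \<bullet> (stopped_step_integral B N r e t \<omega> - step_integral B N' r' e' \<omega>)\<bar>} \<le>
    2 * \<delta> + 4 * \<delta> / \<eta>\<^sup>2"
proof -
  \<comment> \<open>The minus sign in the second window turns concatenation into a difference. The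
    factor 4 in the bound arises from the factor 2 of \<open>norm_diff_sq_le\<close> and the two
    distances, each at most \<open>\<delta>\<close> off \<open>Q\<close>.\<close>
  define xs where "xs = window_steps N r e 0 t (\<lambda>_. b) @ window_steps N' r' e' 0 t (\<lambda>_. - b)"
  define Q where "Q = {\<omega>\<in>space M. ennreal \<delta> < step_distance T H N r e \<omega>} \<union>
    {\<omega>\<in>space M. ennreal \<delta> < step_distance t H N' r' e' \<omega>}"
  have r: "\<forall>i<N. r i \<le> r (Suc i)" "\<forall>i<N'. r' i \<le> r' (Suc i)"
    using sd sd' by (auto simp: step_data_def)
  have ad: "adapted_steps xs"
    using adapted_steps_window[OF sd order_refl, of "\<lambda>_. b" "norm b" t]
      adapted_steps_window[OF sd' order_refl, of "\<lambda>_. - b" "norm b" t]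
    unfolding xs_def adapted_steps_def by auto
  have int: "list_integral B xs \<omega> = b \<bullet> (stopped_step_integral B N r e t \<omega> - step_integral B N' r' e' \<omega>)" for \<omega>
    unfolding xs_def list_integral_append list_integral_window_steps[OF r(1) t(1)] list_integral_window_steps[OF r(2) t(1)]
      stopped_step_integral_0[OF sd] stopped_step_integral_0[OF sd'] stopped_step_integral_eq[OF sd']
    by (simp add: inner_diff_right)
  have proc: "list_process xs s \<omega> = indicator {0..<t} s * (b \<bullet> (step_process N r e s \<omega> - step_process N' r' e' s \<omega>))" for s \<omega>
    unfolding xs_def list_process_append list_process_window_steps[OF r(1)] list_process_window_steps[OF r(2)]
    by (simp add: inner_diff_right algebra_simps)
  have qv: "(\<integral>\<^sup>+s. ennreal ((list_process xs s \<omega>)\<^sup>2) \<partial>lborel) \<le>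
    2 * (step_distance T H N r e \<omega> + step_distance t H N' r' e' \<omega>)" if \<omega>: "\<omega> \<in> space M" for \<omega>
  proof -
    let ?f = "\<lambda>s. ennreal ((norm (step_process N r e s \<omega> - H s \<omega>))\<^sup>2) * indicator {0..T} s"
    let ?g = "\<lambda>s. ennreal ((norm (step_process N' r' e' s \<omega> - H s \<omega>))\<^sup>2) * indicator {0..t} s"
    note [measurable] = H[OF \<omega>] step_process_measurable
    have "?f = (\<lambda>s. ennreal ((norm (step_process N r e s \<omega> - indicator {0..} s *\<^sub>R H s \<omega>))\<^sup>2) * indicator {0..T} s)"
      "?g = (\<lambda>s. ennreal ((norm (step_process N' r' e' s \<omega> - indicator {0..} s *\<^sub>R H s \<omega>))\<^sup>2) * indicator {0..t} s)"
      by (auto simp: indicator_def)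
    then have [measurable]: "?f \<in> borel_measurable lborel" "?g \<in> borel_measurable lborel"
      by simp_all
    have "(\<integral>\<^sup>+s. ennreal ((list_process xs s \<omega>)\<^sup>2) \<partial>lborel) \<le> (\<integral>\<^sup>+s. 2 * (?f s + ?g s) \<partial>lborel)"
    proof (rule nn_integral_mono)
      fix s :: real
      show "ennreal ((list_process xs s \<omega>)\<^sup>2) \<le> 2 * (?f s + ?g s)"
      proof (cases "0 \<le> s \<and> s < t")
        case True
        let ?a = "step_process N r e s \<omega>" and ?b = "step_process N' r' e' s \<omega>"
        have "\<bar>b \<bullet> (?a - ?b)\<bar> \<le> norm (?a - ?b)"
          using Cauchy_Schwarz_ineq2[of b "?a - ?b"] b by simp
        then have "(b \<bullet> (?a - ?b))\<^sup>2 \<le> (norm (?a - ?b))\<^sup>2" by (simp add: abs_le_square_iff[symmetric])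
        also have "\<dots> \<le> 2 * ((norm (?a - H s \<omega>))\<^sup>2 + (norm (?b - H s \<omega>))\<^sup>2)" by (rule norm_diff_sq_le)
        finally have "ennreal ((b \<bullet> (?a - ?b))\<^sup>2) \<le> ennreal (2 * ((norm (?a - H s \<omega>))\<^sup>2 + (norm (?b - H s \<omega>))\<^sup>2))"
          by (rule ennreal_leI)
        then show ?thesis using True t by (simp add: proc ennreal_mult' ennreal_plus)
      qed (auto simp: proc)
    qed
    also have "\<dots> = 2 * (step_distance T H N r e \<omega> + step_distance t H N' r' e' \<omega>)"
      unfolding step_distance_def by (subst nn_integral_cmult, simp, subst nn_integral_add) auto
    finally show ?thesis .
  qed
  have Q: "Q \<in> events" unfolding Q_def using sdist sdist' by measurable
  have "{\<omega>\<in>space M. ennreal (4 * \<delta>) < (\<integral>\<^sup>+s. ennreal ((list_process xs s \<omega>)\<^sup>2) \<partial>lborel)} \<subseteq> Q"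
  proof clarify
    fix \<omega> assume \<omega>: "\<omega> \<in> space M" "ennreal (4 * \<delta>) < (\<integral>\<^sup>+s. ennreal ((list_process xs s \<omega>)\<^sup>2) \<partial>lborel)"
    show "\<omega> \<in> Q"
    proof (rule ccontr)
      assume "\<omega> \<notin> Q"
      then have "step_distance T H N r e \<omega> \<le> ennreal \<delta>" "step_distance t H N' r' e' \<omega> \<le> ennreal \<delta>"
        using \<omega> by (auto simp: Q_def not_less)
      then have "2 * (step_distance T H N r e \<omega> + step_distance t H N' r' e' \<omega>) \<le> 2 * (ennreal \<delta> + ennreal \<delta>)"
        by (intro mult_left_mono add_mono) auto
      also have "\<dots> = ennreal (4 * \<delta>)"
        using \<open>0 < \<delta>\<close> by (simp flip: ennreal_plus ennreal_numeral ennreal_mult')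
      finally show False using \<omega> qv[OF \<omega>(1)] by (auto simp: not_le[symmetric])
    qed
  qed
  from list_integral_in_prob[OF ad \<open>0 < \<eta>\<close> _ this Q] \<open>0 < \<delta>\<close>
  have "prob {\<omega>\<in>space M. \<eta> < \<bar>list_integral B xs \<omega>\<bar>} \<le> prob Q + 4 * \<delta> / \<eta>\<^sup>2" by simp
  also have "prob Q \<le> \<delta> + \<delta>"
    unfolding Q_def using sdist sdist' prob prob' by (intro order_trans[OF measure_Un_le] add_mono) auto
  finally show ?thesis unfolding int by simp
qed

text \<open>An approximant made for the horizon \<open>T\<close> and stopped at \<open>t\<close>
  serves every \<open>t\<close>, by comparison with an approximant made for \<open>t\<close> itself.
  The quantifier over \<open>t\<close> stays outside the probability, which suffices for the
  finitely many points of a grid.\<close>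

lemma ito_approximant_uniform:
  fixes H :: "real \<Rightarrow> 'w \<Rightarrow> 'a::euclidean_space"
  assumes ito: "\<And>t. 0 \<le> t \<Longrightarrow> t \<le> T \<Longrightarrow> has_ito_integral M B H t (J t)" and "0 \<le> T" "0 < \<epsilon>"
    and H: "\<And>\<omega>. \<omega> \<in> space M \<Longrightarrow> (\<lambda>s. indicator {0..} s *\<^sub>R H s \<omega>) \<in> borel_measurable borel"
  obtains N r e where "step_data M B T N r e" "step_distance T H N r e \<in> borel_measurable M"
    "prob {\<omega>\<in>space M. ennreal \<epsilon> < step_distance T H N r e \<omega>} \<le> \<epsilon>"
    "\<And>t. 0 \<le> t \<Longrightarrow> t \<le> T \<Longrightarrow> prob {\<omega>\<in>space M. \<epsilon> < norm (stopped_step_integral B N r e t \<omega> - J t \<omega>)} \<le> \<epsilon>"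
proof -
  define d where "d = real DIM('a)"
  have d: "0 < d" by (simp add: d_def)
  \<comment> \<open>\<open>\<eta>\<close> lets the \<open>d\<close> coordinates add up to
    \<open>\<epsilon> / 2\<close>. In units of \<open>\<delta>\<close>, \<open>k\<close> counts the
    lost probability: \<open>2 + 4 / \<eta>\<^sup>2\<close> per coordinate from the comparison, and
    1 for the approximant at \<open>t\<close>.\<close>
  define \<eta> where "\<eta> = \<epsilon> / (2 * d)"
  have \<eta>: "0 < \<eta>" using d \<open>0 < \<epsilon>\<close> by (simp add: \<eta>_def)
  define k where "k = d * (2 + 4 / \<eta>\<^sup>2) + 1"
  have k: "1 \<le> k" using d by (simp add: k_def)
  define \<delta> where "\<delta> = min (\<epsilon> / 2) (\<epsilon> / k)"
  have \<delta>: "0 < \<delta>" "\<delta> \<le> \<epsilon> / 2" "\<delta> \<le> \<epsilon> / k"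
    unfolding \<delta>_def using k \<open>0 < \<epsilon>\<close> by (simp_all only: min.cobounded1 min.cobounded2 min_less_iff_conj) auto
  have "\<delta> * k \<le> \<epsilon>" using \<delta>(3) k by (simp add: field_simps)
  obtain N r e where sd: "step_data M B T N r e" and sdm: "step_distance T H N r e \<in> borel_measurable M"
    and p: "prob {\<omega>\<in>space M. ennreal \<delta> < step_distance T H N r e \<omega>} < \<delta>"
      "prob {\<omega>\<in>space M. \<delta> < norm (step_integral B N r e \<omega> - J T \<omega>)} < \<delta>"
    by (rule has_ito_integral_approx[OF ito[OF \<open>0 \<le> T\<close> order_refl] \<delta>(1)])
  show ?thesis
  proof (rule that[OF sd sdm])
    have "prob {\<omega>\<in>space M. ennreal \<epsilon> < step_distance T H N r e \<omega>} \<le> prob {\<omega>\<in>space M. ennreal \<delta> < step_distance T H N r e \<omega>}"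
    proof (rule finite_measure_mono)
      have "ennreal \<delta> \<le> ennreal \<epsilon>" using \<delta> \<open>0 < \<epsilon>\<close> by (intro ennreal_leI) linarith
      then show "{\<omega>\<in>space M. ennreal \<epsilon> < step_distance T H N r e \<omega>} \<subseteq> {\<omega>\<in>space M. ennreal \<delta> < step_distance T H N r e \<omega>}"
        by (auto intro: le_less_trans)
      show "{\<omega>\<in>space M. ennreal \<delta> < step_distance T H N r e \<omega>} \<in> events" using sdm by measurable
    qed
    then show "prob {\<omega>\<in>space M. ennreal \<epsilon> < step_distance T H N r e \<omega>} \<le> \<epsilon>" using p \<delta> \<open>0 < \<epsilon>\<close> by linarith
    fix t assume t: "0 \<le> t" "t \<le> T"
    have Jm: "J t \<in> borel_measurable M" using ito[OF t] by (simp add: has_ito_integral_def)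
    obtain N' r' e' where sd': "step_data M B t N' r' e'" and sdm': "step_distance t H N' r' e' \<in> borel_measurable M"
      and p': "prob {\<omega>\<in>space M. ennreal \<delta> < step_distance t H N' r' e' \<omega>} < \<delta>"
        "prob {\<omega>\<in>space M. \<delta> < norm (step_integral B N' r' e' \<omega> - J t \<omega>)} < \<delta>"
      by (rule has_ito_integral_approx[OF ito[OF t] \<delta>(1)])
    have m: "stopped_step_integral B N r e t \<in> borel_measurable M" "step_integral B N' r' e' \<in> borel_measurable M"
      using measurable_stopped_step_integral[OF sd t(1)] measurable_completedD[OF measurable_step_integral[OF sd']] by auto
    define A where "A b = {\<omega>\<in>space M. \<eta> < \<bar>b \<bullet> (stopped_step_integral B N r e t \<omega> - step_integral B N' r' e' \<omega>)\<bar>}" for b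
    define C where "C = {\<omega>\<in>space M. \<delta> < norm (step_integral B N' r' e' \<omega> - J t \<omega>)}"
    have A: "A b \<in> events" for b unfolding A_def using m by measurable
    have C: "C \<in> events" unfolding C_def using m Jm by measurable
    have UA: "(\<Union>b\<in>Basis. A b) \<in> events" using A by (intro sets.finite_UN) auto
    have "{\<omega>\<in>space M. \<epsilon> < norm (stopped_step_integral B N r e t \<omega> - J t \<omega>)} \<subseteq> (\<Union>b\<in>Basis. A b) \<union> C"
    proof (rule subsetI, rule ccontr)
      fix \<omega> assume "\<omega> \<in> {\<omega>\<in>space M. \<epsilon> < norm (stopped_step_integral B N r e t \<omega> - J t \<omega>)}"
        and n: "\<omega> \<notin> (\<Union>b\<in>Basis. A b) \<union> C"
      then have \<omega>: "\<omega> \<in> space M" "\<epsilon> < norm (stopped_step_integral B N r e t \<omega> - J t \<omega>)" by auto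
      let ?z = "stopped_step_integral B N r e t \<omega> - step_integral B N' r' e' \<omega>"
      have "norm ?z \<le> (\<Sum>b\<in>Basis. \<bar>?z \<bullet> b\<bar>)" by (rule norm_le_l1)
      also have "\<dots> \<le> (\<Sum>b\<in>(Basis::'a set). \<eta>)"
        using n \<omega> by (intro sum_mono) (auto simp: A_def not_less inner_commute)
      also have "\<dots> = \<epsilon> / 2" using d by (simp add: \<eta>_def d_def)
      finally have "norm ?z \<le> \<epsilon> / 2" .
      moreover have "norm (step_integral B N' r' e' \<omega> - J t \<omega>) \<le> \<epsilon> / 2"
        using n \<omega> \<delta> by (auto simp: C_def not_less)
      ultimately show False
        using \<omega>(2) norm_triangle_ineq[of ?z "step_integral B N' r' e' \<omega> - J t \<omega>"] by simp
    qed
    then have "prob {\<omega>\<in>space M. \<epsilon> < norm (stopped_step_integral B N r e t \<omega> - J t \<omega>)} \<le> prob ((\<Union>b\<in>Basis. A b) \<union> C)"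
      using UA C by (intro finite_measure_mono sets.Un)
    also have "\<dots> \<le> prob (\<Union>b\<in>Basis. A b) + prob C" using UA C by (intro measure_Un_le)
    also have "prob (\<Union>b\<in>Basis. A b) \<le> (\<Sum>b\<in>Basis. prob (A b))" using A by (intro measure_UNION_le) auto
    also have "\<dots> \<le> (\<Sum>b\<in>(Basis::'a set). 2 * \<delta> + 4 * \<delta> / \<eta>\<^sup>2)"
      unfolding A_def using p p' t \<delta>(1) \<eta> H
      by (intro sum_mono ito_approximants_consistent[OF sd sdm _ sd' sdm']) auto
    also have "\<dots> + prob C \<le> \<delta> * k" using p'(2) by (simp add: C_def k_def d_def algebra_simps)
    also have "\<dots> \<le> \<epsilon>" by fact
    finally show "prob {\<omega>\<in>space M. \<epsilon> < norm (stopped_step_integral B N r e t \<omega> - J t \<omega>)} \<le> \<epsilon>" by simp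
  qed
qed

section \<open>Adaptedness of stochastic integrals and of time integrals\<close>

lemma AE_eventually_not_in:
  assumes A: "\<And>n. A n \<in> events" "\<And>n. prob (A n) \<le> (1 / 2) ^ n"
  shows "AE \<omega> in M. eventually (\<lambda>n. \<omega> \<notin> A n) sequentially"
proof -
  have "AE \<omega> in M. eventually (\<lambda>n. \<omega> \<in> space M - A n) sequentially"
  proof (rule borel_cantelli_AE1)
    show "summable (\<lambda>n. prob (A n))"
      by (rule summable_comparison_test'[OF summable_geometric[of "1/2::real"]]) (use A(2) in auto)
  qed (use A in \<open>auto simp: less_top[symmetric]\<close>)
  then show ?thesis by eventually_elim (auto elim: eventually_mono)
qed

text \<open>Approximants with errors \<open>(1 / 2) ^ n\<close> converge almost surely by
  Borel-Cantelli, and each is adapted because all its times are at most \<open>t\<close>.\<close>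

lemma has_ito_integral_adapted:
  fixes H :: "real \<Rightarrow> 'w \<Rightarrow> 'a::euclidean_space"
  assumes ito: "has_ito_integral M B H t J"
  shows "J \<in> borel_measurable (\<G> t)"
proof -
  have Jm: "J \<in> borel_measurable M" using ito by (simp add: has_ito_integral_def)
  have "\<exists>S. S \<in> borel_measurable (\<G> t) \<and> prob {\<omega>\<in>space M. (1 / 2) ^ n < norm (S \<omega> - J \<omega>)} \<le> (1 / 2) ^ n" for n
  proof -
    have "0 < (1 / 2 :: real) ^ n" by simp
    from has_ito_integral_approx[OF ito this] obtain N r e where sd: "step_data M B t N r e"
      and p: "prob {\<omega>\<in>space M. (1 / 2) ^ n < norm (step_integral B N r e \<omega> - J \<omega>)} < (1 / 2) ^ n" by metis
    then show ?thesis using measurable_step_integral[OF sd] less_imp_le by blast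
  qed
  then obtain S where S: "\<And>n. S n \<in> borel_measurable (\<G> t)"
    "\<And>n. prob {\<omega>\<in>space M. (1 / 2) ^ n < norm (S n \<omega> - J \<omega>)} \<le> (1 / 2) ^ n" by metis
  have [measurable]: "S n \<in> borel_measurable M" for n using measurable_completedD[OF S(1)] .
  have "AE \<omega> in M. eventually (\<lambda>n. \<omega> \<notin> {\<omega>\<in>space M. (1 / 2) ^ n < norm (S n \<omega> - J \<omega>)}) sequentially"
    by (rule AE_eventually_not_in[OF _ S(2)]) (use Jm in measurable)
  then have "AE \<omega> in M. J \<omega> = lim (\<lambda>n. S n \<omega>)"
    using AE_space
  proof eventually_elim
    case (elim \<omega>)
    have "(\<lambda>n. S n \<omega> - J \<omega>) \<longlonglongrightarrow> 0"
    proof (rule Lim_null_comparison)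
      show "eventually (\<lambda>n. norm (S n \<omega> - J \<omega>) \<le> (1 / 2) ^ n) sequentially"
        using elim(1) by eventually_elim (use elim(2) in auto)
      show "(\<lambda>n. (1 / 2) ^ n :: real) \<longlonglongrightarrow> 0" by (rule LIMSEQ_power_zero) simp
    qed
    then have "(\<lambda>n. S n \<omega>) \<longlonglongrightarrow> J \<omega>" by (simp add: Lim_null[symmetric])
    then show ?case by (simp add: limI)
  qed
  moreover have "(\<lambda>\<omega>. lim (\<lambda>n. S n \<omega>)) \<in> borel_measurable (\<G> t)"
    using S(1) by (rule borel_measurable_lim_metric)
  ultimately show ?thesis using completed_filtration_AE_eq[OF Jm] by blast
qed

text \<open>At horizon 0 all step times are 0, so every approximating integral vanishes.\<close>

lemma has_ito_integral_at_0:
  fixes H :: "real \<Rightarrow> 'w \<Rightarrow> 'a::euclidean_space"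
  assumes ito: "has_ito_integral M B H 0 J"
  shows "AE \<omega> in M. J \<omega> = 0"
proof -
  have Jm: "J \<in> borel_measurable M" using ito by (simp add: has_ito_integral_def)
  have 1: "prob {\<omega>\<in>space M. (1 / 2) ^ n < norm (J \<omega>)} \<le> (1 / 2) ^ n" for n
  proof -
    have "0 < (1 / 2 :: real) ^ n" by simp
    from has_ito_integral_approx[OF ito this] obtain N r e where sd: "step_data M B 0 N r e"
      and p: "prob {\<omega>\<in>space M. (1 / 2) ^ n < norm (step_integral B N r e \<omega> - J \<omega>)} < (1 / 2) ^ n" by metis
    have "step_integral B N r e = (\<lambda>_. 0)"
      using stopped_step_integral_eq[OF sd] stopped_step_integral_0[OF sd] by auto
    then show ?thesis using p by simp
  qed
  have "AE \<omega> in M. eventually (\<lambda>n. \<omega> \<notin> {\<omega>\<in>space M. (1 / 2) ^ n < norm (J \<omega>)}) sequentially"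
    by (rule AE_eventually_not_in[OF _ 1]) (use Jm in measurable)
  then show ?thesis using AE_space
  proof eventually_elim
    case (elim \<omega>)
    have "(\<lambda>n. (1 / 2) ^ n :: real) \<longlonglongrightarrow> 0" by (rule LIMSEQ_power_zero) simp
    moreover have "eventually (\<lambda>n. norm (J \<omega>) \<le> (1 / 2) ^ n) sequentially"
      using elim(1) by eventually_elim (use elim(2) in auto)
    ultimately have "norm (J \<omega>) \<le> 0" by (intro tendsto_lowerbound) auto
    then show ?case by simp
  qed
qed

text \<open>
  Joint measurability and adaptedness do not make a process progressively measurable, yet its time
  integral \<open>\<xi>\<close> is adapted up to null sets: \<open>\<xi>\<close> minus its conditional expectation is orthogonal
  to every value of the process, hence by Fubini to \<open>\<xi>\<close> itself.
\<close>

lemma bounded_time_integral_adapted: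
  fixes u :: "real \<Rightarrow> 'w \<Rightarrow> real"
  assumes m: "(\<lambda>(s, \<omega>). u s \<omega>) \<in> borel_measurable (lborel \<Otimes>\<^sub>M M)"
    and ad: "\<And>s. u s \<in> borel_measurable (\<G> t)"
    and bdd: "\<And>s \<omega>. \<bar>u s \<omega>\<bar> \<le> c * indicator {0..t} s" and c: "0 \<le> c" and "0 \<le> t"
  shows "(\<lambda>\<omega>. LINT s|lborel. u s \<omega>) \<in> borel_measurable (\<G> t)"
proof -
  interpret F: finite_measure_subalgebra M "\<G> t"
    by unfold_locales (rule subalgebra_completed)
  interpret P: pair_sigma_finite lborel M ..
  note [measurable] = m
  have ind: "integrable lborel (indicator {0..t} :: real \<Rightarrow> real)"
    by (rule integrable_real_indicator) (use \<open>0 \<le> t\<close> in auto)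
  define \<xi> where "\<xi> \<omega> = (LINT s|lborel. u s \<omega>)" for \<omega>
  have [measurable]: "\<xi> \<in> borel_measurable M" unfolding \<xi>_def[abs_def] by measurable
  have \<xi>_bdd: "\<bar>\<xi> \<omega>\<bar> \<le> c * t" for \<omega>
  proof -
    have "\<bar>\<xi> \<omega>\<bar> \<le> (LINT s|lborel. \<bar>u s \<omega>\<bar>)" unfolding \<xi>_def by (rule integral_abs_bound)
    also have "\<dots> \<le> (LINT s|lborel. c * indicator {0..t} s)"
      using bdd c ind by (intro integral_mono_AE') auto
    also have "\<dots> = c * t" using \<open>0 \<le> t\<close> by simp
    finally show ?thesis .
  qed
  define \<zeta> where "\<zeta> = real_cond_exp M (\<G> t) \<xi>"
  have \<xi>_int: "integrable M \<xi>" by (rule integrable_const_bound[of _ "c * t"]) (use \<xi>_bdd in auto)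
  have \<zeta>_G: "\<zeta> \<in> borel_measurable (\<G> t)" unfolding \<zeta>_def by (rule borel_measurable_cond_exp)
  have [measurable]: "\<zeta> \<in> borel_measurable M" using measurable_completedD[OF \<zeta>_G] .
  have \<zeta>_int: "integrable M \<zeta>" unfolding \<zeta>_def using F.real_cond_exp_int(1)[OF \<xi>_int] .
  have mult_int: "integrable M (\<lambda>\<omega>. f \<omega> * g \<omega>)"
    if "integrable M f" "g \<in> borel_measurable M" "\<And>\<omega>. \<bar>g \<omega>\<bar> \<le> C" for f g :: "'w \<Rightarrow> real" and C
  proof (rule Bochner_Integration.integrable_bound)
    show "integrable M (\<lambda>\<omega>. C * \<bar>f \<omega>\<bar>)" using that(1) by simp
    have "norm (f \<omega> * g \<omega>) \<le> norm (C * \<bar>f \<omega>\<bar>)" for \<omega>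
    proof -
      have "0 \<le> C" using that(3)[of \<omega>] by linarith
      then show ?thesis using mult_left_mono[OF that(3)[of \<omega>], of "\<bar>f \<omega>\<bar>"] by (simp add: abs_mult mult.commute)
    qed
    then show "AE \<omega> in M. norm (f \<omega> * g \<omega>) \<le> norm (C * \<bar>f \<omega>\<bar>)" by simp
    show "(\<lambda>\<omega>. f \<omega> * g \<omega>) \<in> borel_measurable M" using that(1,2) by measurable
  qed
  define d where "d \<omega> = \<xi> \<omega> - \<zeta> \<omega>" for \<omega>
  have d_int: "integrable M d" unfolding d_def using \<xi>_int \<zeta>_int by simp
  have [measurable]: "d \<in> borel_measurable M" using d_int by simp
  have u_M [measurable]: "u s \<in> borel_measurable M" for s using measurable_completedD[OF ad] .
  have u_bdd: "\<bar>u s \<omega>\<bar> \<le> c" for s \<omega>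
    using bdd[of s \<omega>] c by (cases "s \<in> {0..t}") auto
  have \<zeta>\<xi>_int: "integrable M (\<lambda>\<omega>. \<zeta> \<omega> * \<xi> \<omega>)" by (rule mult_int[OF \<zeta>_int _ \<xi>_bdd]) simp
  \<comment> \<open>The defining property of conditional expectation, tested with
    \<open>u s\<close>, which is bounded and measurable in \<open>\<G> t\<close>.\<close>
  have du: "expectation (\<lambda>\<omega>. d \<omega> * u s \<omega>) = 0" for s
  proof -
    have i: "integrable M (\<lambda>\<omega>. u s \<omega> * \<xi> \<omega>)"
      using mult_int[OF \<xi>_int u_M u_bdd] by (simp add: mult.commute)
    note F.real_cond_exp_intg[OF i ad, folded \<zeta>_def]
    moreover have "d \<omega> * u s \<omega> = u s \<omega> * \<xi> \<omega> - u s \<omega> * \<zeta> \<omega>" for \<omega> by (simp add: d_def algebra_simps)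
    ultimately show ?thesis using i by simp
  qed
  have d\<xi>: "expectation (\<lambda>\<omega>. d \<omega> * \<xi> \<omega>) = 0"
  proof -
    have int: "integrable (lborel \<Otimes>\<^sub>M M) (\<lambda>(s, \<omega>). d \<omega> * u s \<omega>)"
    proof (rule P.Fubini_integrable)
      show "(\<lambda>(s, \<omega>). d \<omega> * u s \<omega>) \<in> borel_measurable (lborel \<Otimes>\<^sub>M M)" by measurable
      show "AE s in lborel. integrable M (\<lambda>\<omega>. case (s, \<omega>) of (s, \<omega>) \<Rightarrow> d \<omega> * u s \<omega>)"
        using mult_int[OF d_int u_M u_bdd] by simp
      show "integrable lborel (\<lambda>s. LINT \<omega>|M. norm (case (s, \<omega>) of (s, \<omega>) \<Rightarrow> d \<omega> * u s \<omega>))"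
      proof (rule Bochner_Integration.integrable_bound)
        show "integrable lborel (\<lambda>s. expectation (\<lambda>\<omega>. \<bar>d \<omega>\<bar>) * (c * indicator {0..t} s))"
          using ind by (intro integrable_mult_right)
        show "(\<lambda>s. LINT \<omega>|M. norm (case (s, \<omega>) of (s, \<omega>) \<Rightarrow> d \<omega> * u s \<omega>)) \<in> borel_measurable lborel"
          by measurable
        show "AE s in lborel. norm (LINT \<omega>|M. norm (case (s, \<omega>) of (s, \<omega>) \<Rightarrow> d \<omega> * u s \<omega>)) \<le>
          norm (expectation (\<lambda>\<omega>. \<bar>d \<omega>\<bar>) * (c * indicator {0..t} s))"
        proof (rule AE_I2)
          fix s :: real
          have "(LINT \<omega>|M. \<bar>d \<omega> * u s \<omega>\<bar>) \<le> (LINT \<omega>|M. \<bar>d \<omega>\<bar> * (c * indicator {0..t} s))"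
            using d_int integrable_abs[OF mult_int[OF d_int u_M u_bdd, of s], unfolded abs_mult] bdd ind
            by (intro integral_mono) (auto simp: abs_mult intro!: mult_left_mono)
          then show "norm (LINT \<omega>|M. norm (case (s, \<omega>) of (s, \<omega>) \<Rightarrow> d \<omega> * u s \<omega>)) \<le>
            norm (expectation (\<lambda>\<omega>. \<bar>d \<omega>\<bar>) * (c * indicator {0..t} s))"
            using c by (simp add: abs_mult)
        qed
      qed
    qed
    have "expectation (\<lambda>\<omega>. d \<omega> * \<xi> \<omega>) = (LINT \<omega>|M. LINT s|lborel. d \<omega> * u s \<omega>)"
      unfolding \<xi>_def by simp
    also have "\<dots> = (LINT s|lborel. LINT \<omega>|M. d \<omega> * u s \<omega>)"
      using P.Fubini_integral[OF int] by simp
    finally show ?thesis using du by simp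
  qed
  have "integrable M (\<lambda>\<omega>. \<zeta> \<omega> * \<zeta> \<omega>)" and \<zeta>\<zeta>: "expectation (\<lambda>\<omega>. \<zeta> \<omega> * \<zeta> \<omega>) = expectation (\<lambda>\<omega>. \<zeta> \<omega> * \<xi> \<omega>)"
    using F.real_cond_exp_intg[OF \<zeta>\<xi>_int \<zeta>_G, folded \<zeta>_def] by auto
  moreover have "integrable M (\<lambda>\<omega>. d \<omega> * \<xi> \<omega>)" by (rule mult_int[OF d_int _ \<xi>_bdd]) simp
  \<comment> \<open>\<open>d\<close> is orthogonal to \<open>\<xi>\<close> by Fubini and to
    \<open>\<zeta>\<close> by conditioning, so its square has mean zero.\<close>
  moreover have dd: "(d \<omega>)\<^sup>2 = d \<omega> * \<xi> \<omega> - (\<zeta> \<omega> * \<xi> \<omega> - \<zeta> \<omega> * \<zeta> \<omega>)" for \<omega>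
    by (simp add: d_def power2_eq_square algebra_simps)
  ultimately have "integrable M (\<lambda>\<omega>. (d \<omega>)\<^sup>2)" "expectation (\<lambda>\<omega>. (d \<omega>)\<^sup>2) = 0"
    using \<zeta>\<xi>_int d\<xi> by simp_all
  then have "AE \<omega> in M. (d \<omega>)\<^sup>2 = 0"
    by (subst (asm) integral_nonneg_eq_0_iff_AE) auto
  then have "AE \<omega> in M. \<xi> \<omega> = \<zeta> \<omega>" by eventually_elim (simp add: d_def)
  then show ?thesis
    using completed_filtration_AE_eq[OF _ \<zeta>_G, of \<xi>] unfolding \<xi>_def by simp
qed

text \<open>Truncation to [-n, n] reduces to the bounded case; dominated convergence recovers the
  integral wherever the path is integrable, that is, almost surely.\<close>

lemma time_integral_adapted:
  fixes u :: "real \<Rightarrow> 'w \<Rightarrow> real"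
  assumes m: "(\<lambda>(s, \<omega>). u s \<omega>) \<in> borel_measurable (restrict_space borel {0..} \<Otimes>\<^sub>M M)"
    and ad: "\<And>s. 0 \<le> s \<Longrightarrow> u s \<in> borel_measurable (\<G> s)"
    and int: "AE \<omega> in M. set_integrable lborel {0..t} (\<lambda>s. u s \<omega>)" and "0 \<le> t"
  shows "(\<lambda>\<omega>. LINT s:{0..t}|lborel. u s \<omega>) \<in> borel_measurable (\<G> t)"
proof -
  \<comment> \<open>\<open>max 0 s\<close> extends the process to negative times, where nothing is
    known about it, without changing it on \<open>{0..t}\<close>.\<close>
  define w where "w s \<omega> = indicator {0..t} s * u (max 0 s) \<omega>" for s \<omega>
  have "(\<lambda>(s, \<omega>). (max 0 s, \<omega>)) \<in> (lborel \<Otimes>\<^sub>M M) \<rightarrow>\<^sub>M (restrict_space borel {0::real..} \<Otimes>\<^sub>M M)"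
    by (intro measurable_pair) (auto intro!: measurable_restrict_space2 simp: comp_def split_beta')
  from measurable_compose[OF this m]
  have wm [measurable]: "(\<lambda>(s, \<omega>). w s \<omega>) \<in> borel_measurable (lborel \<Otimes>\<^sub>M M)"
    unfolding w_def by (simp add: split_beta')
  have w_ad: "w s \<in> borel_measurable (\<G> t)" for s
  proof (cases "0 \<le> s \<and> s \<le> t")
    case True
    then have "u s \<in> borel_measurable (\<G> t)" by (intro measurable_completed_mono[OF ad]) auto
    then show ?thesis using True by (simp add: w_def[abs_def])
  qed (simp add: w_def[abs_def])
  define v where "v n s \<omega> = max (- real n) (min (real n) (w s \<omega>))" for n s \<omega>
  have v_ad: "(\<lambda>\<omega>. LINT s|lborel. v n s \<omega>) \<in> borel_measurable (\<G> t)" for n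
  proof (rule bounded_time_integral_adapted[of _ _ "real n"])
    show "(\<lambda>(s, \<omega>). v n s \<omega>) \<in> borel_measurable (lborel \<Otimes>\<^sub>M M)" unfolding v_def by measurable
    show "v n s \<in> borel_measurable (\<G> t)" for s
      unfolding v_def[abs_def] using w_ad by (intro borel_measurable_max borel_measurable_min) auto
    show "\<bar>v n s \<omega>\<bar> \<le> real n * indicator {0..t} s" for s \<omega>
      unfolding v_def w_def by (cases "s \<in> {0..t}") auto
  qed (use \<open>0 \<le> t\<close> in auto)
  have w_eq: "(LINT s:{0..t}|lborel. u s \<omega>) = (LINT s|lborel. w s \<omega>)" for \<omega>
    unfolding set_lebesgue_integral_def w_def by (intro Bochner_Integration.integral_cong) (auto simp: indicator_def)
  have "AE \<omega> in M. (LINT s:{0..t}|lborel. u s \<omega>) = lim (\<lambda>n. LINT s|lborel. v n s \<omega>)"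
    using int
  proof eventually_elim
    case (elim \<omega>)
    then have wi: "integrable lborel (\<lambda>s. w s \<omega>)"
      unfolding set_integrable_def w_def
      by (rule Bochner_Integration.integrable_cong[THEN iffD1, rotated 2]) (auto simp: indicator_def)
    then have [measurable]: "(\<lambda>s. w s \<omega>) \<in> borel_measurable lborel" by simp
    have "(\<lambda>n. LINT s|lborel. v n s \<omega>) \<longlonglongrightarrow> (LINT s|lborel. w s \<omega>)"
    proof (rule integral_dominated_convergence[where w = "\<lambda>s. \<bar>w s \<omega>\<bar>"])
      show "AE s in lborel. (\<lambda>n. v n s \<omega>) \<longlonglongrightarrow> w s \<omega>"
      proof (rule AE_I2)
        fix s
        obtain N :: nat where "\<bar>w s \<omega>\<bar> \<le> real N" using real_arch_simple by blast
        then have "v n s \<omega> = w s \<omega>" if "N \<le> n" for n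
        proof -
          have "\<bar>w s \<omega>\<bar> \<le> real n" using that \<open>\<bar>w s \<omega>\<bar> \<le> real N\<close> by linarith
          then show ?thesis unfolding v_def by linarith
        qed
        then show "(\<lambda>n. v n s \<omega>) \<longlonglongrightarrow> w s \<omega>"
          by (intro tendsto_eventually) (auto simp: eventually_sequentially)
      qed
      show "AE s in lborel. norm (v n s \<omega>) \<le> \<bar>w s \<omega>\<bar>" for n
        unfolding v_def by (intro AE_I2) (auto simp: max_def min_def)
    qed (use wi in \<open>auto simp: v_def\<close>)
    then show ?case unfolding w_eq by (simp add: limI)
  qed
  moreover have "(\<lambda>\<omega>. lim (\<lambda>n. LINT s|lborel. v n s \<omega>)) \<in> borel_measurable (\<G> t)"
    using v_ad by (rule borel_measurable_lim_metric)
  moreover have "(\<lambda>\<omega>. LINT s:{0..t}|lborel. u s \<omega>) \<in> borel_measurable M"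
    unfolding w_eq by measurable
  ultimately show ?thesis using completed_filtration_AE_eq by blast
qed

end

section \<open>The supergradient inequality along a path\<close>

definition grid :: "real \<Rightarrow> nat \<Rightarrow> nat \<Rightarrow> real" where
  "grid T n k = real k * T / real (Suc n)"

text \<open>The first index strictly beyond \<open>\<theta>\<close>, capped at the end of the grid.
  The cell in which \<open>\<theta>\<close> falls is thus counted in full, and whether a cell counts
  is decided at its left end, as adapted coefficients demand.\<close>

definition grid_stop :: "real \<Rightarrow> real \<Rightarrow> nat \<Rightarrow> nat" where
  "grid_stop T \<theta> n = (LEAST k. k = Suc n \<or> \<theta> < grid T n k)"

lemma grid_0 [simp]: "grid T n 0 = 0"
  by (simp add: grid_def)

lemma grid_last [simp]: "grid T n (Suc n) = T"
  by (simp add: grid_def)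

lemma grid_Suc: "grid T n (Suc k) = grid T n k + T / real (Suc n)"
  by (simp add: grid_def add_divide_distrib distrib_right)

lemma grid_mono: "0 \<le> T \<Longrightarrow> k \<le> l \<Longrightarrow> grid T n k \<le> grid T n l"
  unfolding grid_def by (intro divide_right_mono mult_right_mono) auto

lemma grid_bounds: "0 \<le> T \<Longrightarrow> k \<le> Suc n \<Longrightarrow> 0 \<le> grid T n k \<and> grid T n k \<le> T"
  using grid_mono[of T 0 k n] grid_mono[of T k "Suc n" n] by simp

lemma grid_stop_le: "grid_stop T \<theta> n \<le> Suc n"
  unfolding grid_stop_def by (rule Least_le) simp

lemma less_grid_stop_iff:
  assumes "0 \<le> T" "k \<le> n"
  shows "k < grid_stop T \<theta> n \<longleftrightarrow> grid T n k \<le> \<theta>"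
proof
  assume "k < grid_stop T \<theta> n"
  from not_less_Least[OF this[unfolded grid_stop_def]] show "grid T n k \<le> \<theta>" by auto
next
  assume k: "grid T n k \<le> \<theta>"
  show "k < grid_stop T \<theta> n"
  proof (rule ccontr)
    assume "\<not> k < grid_stop T \<theta> n"
    then have le: "grid_stop T \<theta> n \<le> k" by simp
    have "grid_stop T \<theta> n = Suc n \<or> \<theta> < grid T n (grid_stop T \<theta> n)"
      unfolding grid_stop_def by (rule LeastI[of _ "Suc n"]) simp
    then show False using le k \<open>k \<le> n\<close> grid_mono[OF \<open>0 \<le> T\<close> le, of n] by auto
  qed
qed

lemma grid_stop_bounds:
  assumes "0 \<le> T" "0 \<le> \<theta>" "\<theta> \<le> T"
  shows "0 < grid_stop T \<theta> n" "\<theta> \<le> grid T n (grid_stop T \<theta> n)" "grid T n (grid_stop T \<theta> n) \<le> T"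
    "grid T n (grid_stop T \<theta> n) \<le> \<theta> + T / real (Suc n)"
proof -
  show pos: "0 < grid_stop T \<theta> n" using less_grid_stop_iff[of T 0 n \<theta>] assms by simp
  have "grid_stop T \<theta> n = Suc n \<or> \<theta> < grid T n (grid_stop T \<theta> n)"
    unfolding grid_stop_def by (rule LeastI[of _ "Suc n"]) simp
  then show "\<theta> \<le> grid T n (grid_stop T \<theta> n)" using assms by auto
  show "grid T n (grid_stop T \<theta> n) \<le> T"
    using grid_bounds[OF assms(1) grid_stop_le] by simp
  obtain k where k: "grid_stop T \<theta> n = Suc k" using pos by (cases "grid_stop T \<theta> n") auto
  then have "grid T n k \<le> \<theta>"
    using less_grid_stop_iff[of T k n \<theta>] assms grid_stop_le[of T \<theta> n] by simp
  then show "grid T n (grid_stop T \<theta> n) \<le> \<theta> + T / real (Suc n)" unfolding k grid_Suc by simp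
qed

lemma tendsto_grid_stop:
  assumes "0 \<le> T" "0 \<le> \<theta>" "\<theta> \<le> T"
  shows "(\<lambda>n. grid T n (grid_stop T \<theta> n)) \<longlonglongrightarrow> \<theta>"
proof (rule tendsto_sandwich[of "\<lambda>_. \<theta>" _ _ "\<lambda>n. \<theta> + T / real (Suc n)"])
  show "(\<lambda>n. \<theta> + T / real (Suc n)) \<longlonglongrightarrow> \<theta>"
    using tendsto_add[OF tendsto_const LIMSEQ_Suc[OF lim_const_over_n[of T]]] by simp
  show "(\<lambda>_. \<theta>) \<longlonglongrightarrow> \<theta>" by simp
  show "eventually (\<lambda>n. \<theta> \<le> grid T n (grid_stop T \<theta> n)) sequentially"
    using grid_stop_bounds(2)[OF assms] by simp
  show "eventually (\<lambda>n. grid T n (grid_stop T \<theta> n) \<le> \<theta> + T / real (Suc n)) sequentially"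
    using grid_stop_bounds(4)[OF assms] by (intro always_eventually allI)
qed

section \<open>Riemann sums and the telescoped supergradient inequality\<close>

lemma grid_interval_index:
  assumes "0 < T" "0 < s" "s \<le> T"
  obtains k where "k \<le> n" "\<And>l. grid T n l < s \<and> s \<le> grid T n (Suc l) \<longleftrightarrow> l = k"
proof -
  \<comment> \<open>Cells are open on the left and closed on the right, hence the ceiling minus
    one.\<close>
  define k where "k = nat \<lceil>s * real (Suc n) / T\<rceil> - 1"
  let ?y = "s * real (Suc n) / T"
  have y: "0 < ?y" "?y \<le> real (Suc n)"
    using assms mult_right_mono[of s T "real (Suc n)"] by (auto simp: divide_le_eq mult.commute)
  then have c: "1 \<le> \<lceil>?y\<rceil>" "\<lceil>?y\<rceil> \<le> int (Suc n)"
    by (simp_all only: one_le_ceiling ceiling_le_iff of_int_of_nat_eq)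
  then have k: "int k = \<lceil>?y\<rceil> - 1" unfolding k_def by linarith
  have 1: "grid T n l < s \<longleftrightarrow> real l < ?y" for l
    using assms by (simp add: grid_def field_simps)
  have 2: "s \<le> grid T n (Suc l) \<longleftrightarrow> ?y \<le> real (Suc l)" for l
    unfolding grid_def using assms by (simp add: field_simps del: of_nat_Suc)
  show ?thesis
  proof (rule that)
    show "k \<le> n" using k c(2) by linarith
    fix l
    have "real l < ?y \<and> ?y \<le> real (Suc l) \<longleftrightarrow> \<lceil>?y\<rceil> = int l + 1"
      by (subst ceiling_eq_iff) auto
    then show "grid T n l < s \<and> s \<le> grid T n (Suc l) \<longleftrightarrow> l = k"
      unfolding 1 2 using k by auto
  qed
qed

text \<open>\<open>\<beta>\<close> is merely integrable, so only \<open>h\<close> is discretised: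
  the sum is the integral of \<open>\<beta>\<close> against a step function with left-end values,
  and dominated convergence applies. Before \<open>\<theta>\<close> the left ends tend to
  \<open>s\<close>; after \<open>\<theta>\<close> the cells in use eventually end before
  \<open>s\<close>.\<close>

lemma stopped_riemann_sums:
  fixes h \<beta> :: "real \<Rightarrow> 'a::euclidean_space"
  assumes T: "0 < T" and \<theta>: "0 \<le> \<theta>" "\<theta> \<le> T"
    and h: "continuous_on {0..\<theta>} h" and \<beta>: "set_integrable lborel {0..T} \<beta>"
  shows "(\<lambda>n. \<Sum>k<grid_stop T \<theta> n. h (grid T n k) \<bullet>
      ((LINT s:{0..grid T n (Suc k)}|lborel. \<beta> s) - (LINT s:{0..grid T n k}|lborel. \<beta> s)))
    \<longlonglongrightarrow> (LINT s:{0..\<theta>}|lborel. h s \<bullet> \<beta> s)"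
proof -
  note kb = grid_stop_bounds[OF less_imp_le[OF T] \<theta>]
  have "compact (h ` {0..\<theta>})" using h by (intro compact_continuous_image) auto
  then obtain C where C: "\<And>s. s \<in> {0..\<theta>} \<Longrightarrow> norm (h s) \<le> C"
    using compact_imp_bounded bounded_iff by (metis imageI)
  define b where "b s = indicator {0..T} s *\<^sub>R \<beta> s" for s
  have bi: "integrable lborel b" using \<beta> unfolding set_integrable_def b_def .
  have bm [measurable]: "b \<in> borel_measurable lborel" using bi by simp
  define f where "f n s = (\<Sum>k<grid_stop T \<theta> n. indicator {grid T n k<..grid T n (Suc k)} s * (h (grid T n k) \<bullet> b s))" for n s
  have stop_grid: "0 \<le> grid T n k" "grid T n k \<le> \<theta>" "grid T n (Suc k) \<le> T" "k \<le> n" if "k < grid_stop T \<theta> n" for n k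
  proof -
    show kn: "k \<le> n" using that grid_stop_le[of T \<theta> n] by simp
    show "grid T n k \<le> \<theta>" using that less_grid_stop_iff[of T k n \<theta>] kn T by simp
    show "0 \<le> grid T n k" "grid T n (Suc k) \<le> T" using grid_bounds[of T _ n] kn T by simp_all
  qed
  have f_eq: "LINT s|lborel. f n s = (\<Sum>k<grid_stop T \<theta> n. h (grid T n k) \<bullet>
      ((LINT s:{0..grid T n (Suc k)}|lborel. \<beta> s) - (LINT s:{0..grid T n k}|lborel. \<beta> s)))" for n
  proof -
    have "LINT s|lborel. f n s = (\<Sum>k<grid_stop T \<theta> n. LINT s|lborel. h (grid T n k) \<bullet> (indicator {grid T n k<..grid T n (Suc k)} s *\<^sub>R b s))"
      unfolding f_def
      by (subst Bochner_Integration.integral_sum)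
        (auto intro!: sum.cong integrable_mult_indicator[OF _ bi] simp flip: inner_scaleR_right)
    also have "\<dots> = (\<Sum>k<grid_stop T \<theta> n. h (grid T n k) \<bullet>
      ((LINT s:{0..grid T n (Suc k)}|lborel. \<beta> s) - (LINT s:{0..grid T n k}|lborel. \<beta> s)))"
    proof (intro sum.cong refl)
      fix k assume "k \<in> {..<grid_stop T \<theta> n}"
      then have k: "k < grid_stop T \<theta> n" by simp
      have le: "grid T n k \<le> grid T n (Suc k)" using T by (intro grid_mono) auto
      have i: "integrable lborel (\<lambda>s. indicator {0..q} s *\<^sub>R \<beta> s)" if "q \<le> T" for q
        using set_integrable_subset[OF \<beta>, of "{0..q}"] that unfolding set_integrable_def by auto
      have "(LINT s:{0..grid T n (Suc k)}|lborel. \<beta> s) - (LINT s:{0..grid T n k}|lborel. \<beta> s) =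
        (LINT s|lborel. indicator {0..grid T n (Suc k)} s *\<^sub>R \<beta> s - indicator {0..grid T n k} s *\<^sub>R \<beta> s)"
        unfolding set_lebesgue_integral_def
        using i stop_grid[OF k] le by (subst Bochner_Integration.integral_diff) auto
      also have "\<dots> = (LINT s|lborel. indicator {grid T n k<..grid T n (Suc k)} s *\<^sub>R b s)"
        using stop_grid[OF k] le by (intro Bochner_Integration.integral_cong) (auto simp: b_def indicator_def)
      finally show "(LINT s|lborel. h (grid T n k) \<bullet> (indicator {grid T n k<..grid T n (Suc k)} s *\<^sub>R b s)) =
        h (grid T n k) \<bullet> ((LINT s:{0..grid T n (Suc k)}|lborel. \<beta> s) - (LINT s:{0..grid T n k}|lborel. \<beta> s))"
        by (simp only: integral_inner_right[OF integrable_mult_indicator[OF _ bi]] sets_lborel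
          greaterThanAtMost_borel)
    qed
    finally show ?thesis .
  qed
  have outside: "f n s = 0" if "s \<notin> {0<..T}" for n s
  proof -
    have "indicator {grid T n k<..grid T n (Suc k)} s = (0::real)" if "k < grid_stop T \<theta> n" for k
      using stop_grid[OF that] \<open>s \<notin> {0<..T}\<close> by (auto simp: indicator_def)
    then show ?thesis unfolding f_def by simp
  qed
  have inside: "\<exists>k\<le>n. grid T n k < s \<and> s \<le> grid T n (Suc k) \<and>
    f n s = (if k < grid_stop T \<theta> n then h (grid T n k) \<bullet> b s else 0)" if s: "s \<in> {0<..T}" for n s
  proof -
    from s have "0 < s" "s \<le> T" by auto
    then obtain k where k: "k \<le> n" "\<And>l. grid T n l < s \<and> s \<le> grid T n (Suc l) \<longleftrightarrow> l = k"
      using grid_interval_index[OF T] by metis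
    have "f n s = (\<Sum>l<grid_stop T \<theta> n. if l = k then h (grid T n l) \<bullet> b s else 0)"
      unfolding f_def by (intro sum.cong) (use k(2) in \<open>auto simp: indicator_def\<close>)
    then show ?thesis using k by (intro exI[of _ k]) (auto simp: sum.delta)
  qed
  have "(\<lambda>n. LINT s|lborel. f n s) \<longlonglongrightarrow> (LINT s|lborel. indicator {0..\<theta>} s * (h s \<bullet> b s))"
  proof (rule integral_dominated_convergence[where w = "\<lambda>s. C * norm (b s)"])
    have hm: "(\<lambda>s. indicator {0..\<theta>} s *\<^sub>R h s) \<in> borel_measurable borel"
      using h by (intro borel_measurable_continuous_on_indicator) auto
    have "(\<lambda>s. indicator {0..\<theta>} s * (h s \<bullet> b s)) = (\<lambda>s. (indicator {0..\<theta>} s *\<^sub>R h s) \<bullet> b s)"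
      by auto
    also have "\<dots> \<in> borel_measurable lborel" using hm bm by measurable
    finally show "(\<lambda>s. indicator {0..\<theta>} s * (h s \<bullet> b s)) \<in> borel_measurable lborel" .
    show "f n \<in> borel_measurable lborel" for n unfolding f_def[abs_def] by measurable
    show "integrable lborel (\<lambda>s. C * norm (b s))" using bi by simp
    show "AE s in lborel. norm (f n s) \<le> C * norm (b s)" for n
    proof (rule AE_I2)
      fix s :: real
      have C0: "0 \<le> C" using C[of 0] \<theta> norm_ge_zero[of "h 0"] by (auto simp del: norm_ge_zero)
      show "norm (f n s) \<le> C * norm (b s)"
      proof (cases "s \<in> {0<..T}")
        case True
        from inside[OF True, of n] obtain k where k: "k \<le> n"
          "f n s = (if k < grid_stop T \<theta> n then h (grid T n k) \<bullet> b s else 0)" by auto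
        have "\<bar>h (grid T n k) \<bullet> b s\<bar> \<le> C * norm (b s)" if "k < grid_stop T \<theta> n"
          by (rule order_trans[OF Cauchy_Schwarz_ineq2 mult_right_mono])
            (use C[of "grid T n k"] stop_grid[OF that] in auto)
        then show ?thesis using k C0 by simp
      qed (use outside C0 in simp)
    qed
    \<comment> \<open>Time 0 belongs to no cell, and at \<open>\<theta>\<close> neither of the two
      cases below applies.\<close>
    have "AE s in lborel. s \<noteq> \<theta> \<and> s \<noteq> 0"
      using AE_lborel_singleton[of \<theta>] AE_lborel_singleton[of 0] by eventually_elim simp
    then show "AE s in lborel. (\<lambda>n. f n s) \<longlonglongrightarrow> indicator {0..\<theta>} s * (h s \<bullet> b s)"
    proof eventually_elim
      case (elim s)
      show ?case
      proof (cases "s \<in> {0<..T}")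
        case False
        with elim show ?thesis using \<theta> outside[of s] by (auto simp: indicator_def)
      next
        case True
        have "\<forall>n. \<exists>k\<le>n. grid T n k < s \<and> s \<le> grid T n (Suc k) \<and>
          f n s = (if k < grid_stop T \<theta> n then h (grid T n k) \<bullet> b s else 0)"
          using inside[OF True] by blast
        then obtain k where k: "\<And>n. k n \<le> n" "\<And>n. grid T n (k n) < s" "\<And>n. s \<le> grid T n (Suc (k n))"
          "\<And>n. f n s = (if k n < grid_stop T \<theta> n then h (grid T n (k n)) \<bullet> b s else 0)" by metis
        show ?thesis
        proof (cases "s < \<theta>")
          case True
          have *: "k n < grid_stop T \<theta> n" for n
            using less_grid_stop_iff[of T "k n" n \<theta>] k(1,2)[of n] T True by simp
          have "(\<lambda>n. grid T n (k n)) \<longlonglongrightarrow> s"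
          proof (rule tendsto_sandwich)
            show "(\<lambda>n. s - T / real (Suc n)) \<longlonglongrightarrow> s"
              using tendsto_diff[OF tendsto_const LIMSEQ_Suc[OF lim_const_over_n[of T]]] by simp
            show "(\<lambda>_. s) \<longlonglongrightarrow> s" by simp
            show "eventually (\<lambda>n. s - T / real (Suc n) \<le> grid T n (k n)) sequentially"
              using k(3) by (auto simp: grid_Suc algebra_simps)
            show "eventually (\<lambda>n. grid T n (k n) \<le> s) sequentially" using k(2) by (simp add: less_imp_le)
          qed
          then have "(\<lambda>n. h (grid T n (k n))) \<longlonglongrightarrow> h s"
            using * stop_grid True \<open>s \<in> {0<..T}\<close>
            by (intro continuous_on_tendsto_compose[OF h]) auto
          then have "(\<lambda>n. h (grid T n (k n)) \<bullet> b s) \<longlonglongrightarrow> h s \<bullet> b s" by (intro tendsto_intros)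
          then show ?thesis using * k(4) True \<open>s \<in> {0<..T}\<close> by simp
        next
          case False
          with elim have "\<theta> < s" by simp
          have "eventually (\<lambda>n. grid T n (grid_stop T \<theta> n) < s) sequentially"
            by (rule order_tendstoD(2)[OF tendsto_grid_stop[OF less_imp_le[OF T] \<theta>] \<open>\<theta> < s\<close>])
          then have "eventually (\<lambda>n. f n s = 0) sequentially"
          proof eventually_elim
            case (elim n)
            have "\<not> k n < grid_stop T \<theta> n"
              using k(3)[of n] elim grid_mono[of T "Suc (k n)" "grid_stop T \<theta> n" n] T by auto
            then show ?case using k(4) by simp
          qed
          then have "(\<lambda>n. f n s) \<longlonglongrightarrow> 0" by (rule tendsto_eventually)
          then show ?thesis using \<open>\<theta> < s\<close> by simp
        qed
      qed
    qed
  qed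
  moreover have "(LINT s|lborel. indicator {0..\<theta>} s * (h s \<bullet> b s)) = (LINT s:{0..\<theta>}|lborel. h s \<bullet> \<beta> s)"
    unfolding set_lebesgue_integral_def
    by (intro Bochner_Integration.integral_cong) (use \<theta> in \<open>auto simp: b_def indicator_def\<close>)
  ultimately show ?thesis unfolding f_eq by simp
qed

text \<open>The supergradient inequality between consecutive grid points is telescoped, and the
  increments of \<open>X\<close> are split into drift and remainder, the drift sums being
  convergent. The last grid point may have passed \<open>\<theta>\<close> and left \<open>K\<close>,
  but by continuity it lies in the open set \<open>U\<close> for fine grids: hence the inequality
  for all \<open>z \<in> U\<close>, and a conclusion that holds only eventually.\<close>

lemma supergradient_path_inequality:
  fixes X \<beta> :: "real \<Rightarrow> 'a::euclidean_space" and V :: "'a \<Rightarrow> real"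
  assumes T: "0 < T" and \<theta>: "0 \<le> \<theta>" "\<theta> \<le> T"
    and X: "continuous_on {0..T} X" "\<And>s. 0 \<le> s \<Longrightarrow> s \<le> \<theta> \<Longrightarrow> X s \<in> K"
    and \<beta>: "set_integrable lborel {0..T} \<beta>"
    and U: "open U" "K \<subseteq> U" and V: "continuous_on U V" and g: "continuous_on K g"
    and sup: "\<And>y z. y \<in> K \<Longrightarrow> z \<in> U \<Longrightarrow> V z \<le> V y + g y \<bullet> (z - y)"
  obtains l where "l \<longlonglongrightarrow> V (X \<theta>) - (LINT s:{0..\<theta>}|lborel. g (X s) \<bullet> \<beta> s)"
    "eventually (\<lambda>n. l n \<le> V (X 0) + (\<Sum>k<grid_stop T \<theta> n. g (X (grid T n k)) \<bullet>
      ((X (grid T n (Suc k)) - x - (LINT s:{0..grid T n (Suc k)}|lborel. \<beta> s)) -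
       (X (grid T n k) - x - (LINT s:{0..grid T n k}|lborel. \<beta> s))))) sequentially"
proof -
  let ?\<kappa> = "grid_stop T \<theta>"
  let ?I = "\<lambda>t. LINT s:{0..t}|lborel. \<beta> s"
  note kb = grid_stop_bounds[OF less_imp_le[OF T] \<theta>]
  define l where "l n = V (X (grid T n (?\<kappa> n))) -
    (\<Sum>k<?\<kappa> n. g (X (grid T n k)) \<bullet> (?I (grid T n (Suc k)) - ?I (grid T n k)))" for n
  have XT: "(\<lambda>n. X (grid T n (?\<kappa> n))) \<longlonglongrightarrow> X \<theta>"
  proof (rule continuous_on_tendsto_compose[OF X(1) tendsto_grid_stop[OF less_imp_le[OF T] \<theta>]])
    show "eventually (\<lambda>n. grid T n (?\<kappa> n) \<in> {0..T}) sequentially"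
      using kb(2,3) \<theta> by (intro always_eventually) (auto intro: order_trans)
  qed (use \<theta> in auto)
  have X\<theta>: "X \<theta> \<in> U" using X(2)[of \<theta>] \<theta> U by auto
  have in_K: "X (grid T n k) \<in> K" if "k < ?\<kappa> n" for n k
  proof -
    have "k \<le> n" using that grid_stop_le[of T \<theta> n] by simp
    then show ?thesis
      using that less_grid_stop_iff[of T k n \<theta>] grid_bounds[of T k n] T by (intro X(2)) auto
  qed
  have "continuous_on {0..\<theta>} (\<lambda>s. g (X s))"
    using X g \<theta> by (intro continuous_on_compose2[OF g] continuous_on_subset[OF X(1)]) auto
  from stopped_riemann_sums[OF T \<theta> this \<beta>]
  have "l \<longlonglongrightarrow> V (X \<theta>) - (LINT s:{0..\<theta>}|lborel. g (X s) \<bullet> \<beta> s)"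
    unfolding l_def
    by (intro tendsto_diff isCont_tendsto_compose[OF _ XT]) (use V U(1) X\<theta> in \<open>auto simp: continuous_on_eq_continuous_at\<close>)
  moreover have "eventually (\<lambda>n. X (grid T n (?\<kappa> n)) \<in> U) sequentially"
    using topological_tendstoD[OF XT U(1) X\<theta>] .
  then have "eventually (\<lambda>n. l n \<le> V (X 0) + (\<Sum>k<?\<kappa> n. g (X (grid T n k)) \<bullet>
      ((X (grid T n (Suc k)) - x - ?I (grid T n (Suc k))) - (X (grid T n k) - x - ?I (grid T n k))))) sequentially"
  proof eventually_elim
    case (elim n)
    have "V (X (grid T n (Suc k))) - V (X (grid T n k)) \<le> g (X (grid T n k)) \<bullet> (X (grid T n (Suc k)) - X (grid T n k))"
      if "k < ?\<kappa> n" for k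
    proof -
      have "X (grid T n (Suc k)) \<in> U"
        using elim in_K[of "Suc k" n] that U(2) by (cases "Suc k = ?\<kappa> n") auto
      then show ?thesis using sup[OF in_K[OF that]] by force
    qed
    then have "(\<Sum>k<?\<kappa> n. V (X (grid T n (Suc k))) - V (X (grid T n k))) \<le>
      (\<Sum>k<?\<kappa> n. g (X (grid T n k)) \<bullet> (X (grid T n (Suc k)) - X (grid T n k)))"
      by (intro sum_mono) auto
    also have "(\<Sum>k<?\<kappa> n. V (X (grid T n (Suc k))) - V (X (grid T n k))) = V (X (grid T n (?\<kappa> n))) - V (X 0)"
      by (subst sum_lessThan_telescope) simp
    finally have le: "V (X (grid T n (?\<kappa> n))) - V (X 0) \<le>
      (\<Sum>k<?\<kappa> n. g (X (grid T n k)) \<bullet> (X (grid T n (Suc k)) - X (grid T n k)))" .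
    have split: "g y \<bullet> ((a - x - i) - (c - x - j)) = g y \<bullet> (a - c) - g y \<bullet> (i - j)" for y a c i j
      by (simp add: inner_diff_right)
    show ?case
      unfolding l_def split sum_subtractf using le by simp
  qed
  ultimately show ?thesis by (rule that)
qed

section \<open>Ito processes and their lifetime in a closed set\<close>

text \<open>Adaptedness is required of the coefficients only; that of \<open>X\<close> follows from
  the equation, in \<open>X_adapted\<close>. To avoid circularity the coefficients are processes in
  their own right and not functions of the state.\<close>

locale ito_process = brownian_motion M B for M :: "'w measure" and B +
  fixes x :: "'a::euclidean_space" and \<beta> \<sigma> X :: "real \<Rightarrow> 'w \<Rightarrow> 'a"
  assumes paths: "AE \<omega> in M. continuous_on {0..} (\<lambda>t. X t \<omega>)"
    and integrable_coefficients: "AE \<omega> in M. \<forall>t\<ge>0. set_integrable lborel {0..t} (\<lambda>s. \<beta> s \<omega>) \<and>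
      set_integrable lborel {0..t} (\<lambda>s. (norm (\<sigma> s \<omega>))\<^sup>2)"
    and \<beta>_meas: "(\<lambda>(s, \<omega>). \<beta> s \<omega>) \<in> borel_measurable (restrict_space borel {0..} \<Otimes>\<^sub>M M)"
    and \<beta>_adapted: "\<And>s. 0 \<le> s \<Longrightarrow> \<beta> s \<in> borel_measurable (completed_filtration M B s)"
    and \<sigma>_meas: "(\<lambda>(s, \<omega>). \<sigma> s \<omega>) \<in> borel_measurable (restrict_space borel {0..} \<Otimes>\<^sub>M M)"
    and \<sigma>_adapted: "\<And>s. 0 \<le> s \<Longrightarrow> \<sigma> s \<in> borel_measurable (completed_filtration M B s)"
    and X_meas: "\<And>t. 0 \<le> t \<Longrightarrow> X t \<in> borel_measurable M"
    and ito: "\<And>t. 0 \<le> t \<Longrightarrow> has_ito_integral M B \<sigma> t (\<lambda>\<omega>. X t \<omega> - x - (LINT s:{0..t}|lborel. \<beta> s \<omega>))"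
begin

text \<open>A version of the stochastic integral of \<open>\<sigma>\<close> up to time
  \<open>t\<close>; \<open>qv\<close> is its quadratic variation.\<close>

definition N :: "real \<Rightarrow> 'w \<Rightarrow> 'a" where
  "N t \<omega> = X t \<omega> - x - (LINT s:{0..t}|lborel. \<beta> s \<omega>)"

definition qv :: "real \<Rightarrow> 'w \<Rightarrow> real" where
  "qv t \<omega> = (LINT s:{0..t}|lborel. (norm (\<sigma> s \<omega>))\<^sup>2)"

lemma N_adapted: "0 \<le> t \<Longrightarrow> N t \<in> borel_measurable (\<G> t)"
  using has_ito_integral_adapted[OF ito] unfolding N_def[abs_def] .

lemma qv_adapted:
  assumes "0 \<le> t" shows "qv t \<in> borel_measurable (\<G> t)"
  unfolding qv_def[abs_def]
proof (rule time_integral_adapted[OF _ _ _ assms])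
  show "(\<lambda>(s, \<omega>). (norm (\<sigma> s \<omega>))\<^sup>2) \<in> borel_measurable (restrict_space borel {0..} \<Otimes>\<^sub>M M)"
    using \<sigma>_meas by measurable
  show "(\<lambda>\<omega>. (norm (\<sigma> s \<omega>))\<^sup>2) \<in> borel_measurable (\<G> s)" if "0 \<le> s" for s
    using \<sigma>_adapted[OF that] by measurable
  show "AE \<omega> in M. set_integrable lborel {0..t} (\<lambda>s. (norm (\<sigma> s \<omega>))\<^sup>2)"
    using integrable_coefficients by eventually_elim (use assms in auto)
qed

text \<open>The drift integral is adapted coordinate by coordinate. Its expansion in coordinates
  holds only where the drift is integrable, so completion is used once more; measurability of
  \<open>D\<close> in \<open>M\<close> is read off from the equation.\<close>

lemma X_adapted:
  assumes t: "0 \<le> t" shows "X t \<in> borel_measurable (\<G> t)"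
proof -
  define D where "D \<omega> = (LINT s:{0..t}|lborel. \<beta> s \<omega>)" for \<omega>
  have "D = (\<lambda>\<omega>. X t \<omega> - x - N t \<omega>)" by (auto simp: D_def N_def)
  then have DM: "D \<in> borel_measurable M"
    using X_meas[OF t] measurable_completedD[OF N_adapted[OF t]] by simp
  have comp: "(\<lambda>\<omega>. LINT s:{0..t}|lborel. \<beta> s \<omega> \<bullet> b) \<in> borel_measurable (\<G> t)" for b
  proof (rule time_integral_adapted[OF _ _ _ t])
    show "(\<lambda>(s, \<omega>). \<beta> s \<omega> \<bullet> b) \<in> borel_measurable (restrict_space borel {0..} \<Otimes>\<^sub>M M)"
      using \<beta>_meas by measurable
    show "(\<lambda>\<omega>. \<beta> s \<omega> \<bullet> b) \<in> borel_measurable (\<G> s)" if "0 \<le> s" for s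
      using \<beta>_adapted[OF that] by measurable
    show "AE \<omega> in M. set_integrable lborel {0..t} (\<lambda>s. \<beta> s \<omega> \<bullet> b)"
      using integrable_coefficients
    proof eventually_elim
      case (elim \<omega>)
      then have "integrable lborel (\<lambda>s. (indicator {0..t} s *\<^sub>R \<beta> s \<omega>) \<bullet> b)"
        using t unfolding set_integrable_def by (intro integrable_inner_left) auto
      then show ?case unfolding set_integrable_def by simp
    qed
  qed
  have "AE \<omega> in M. D \<omega> = (\<Sum>b\<in>Basis. (LINT s:{0..t}|lborel. \<beta> s \<omega> \<bullet> b) *\<^sub>R b)"
    using integrable_coefficients
  proof eventually_elim
    case (elim \<omega>)
    then have i: "integrable lborel (\<lambda>s. indicator {0..t} s *\<^sub>R \<beta> s \<omega>)"
      using t unfolding set_integrable_def by auto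
    have "(LINT s:{0..t}|lborel. \<beta> s \<omega> \<bullet> b) = D \<omega> \<bullet> b" for b
      unfolding set_lebesgue_integral_def D_def
      using integral_inner_left[of b lborel "\<lambda>s. indicator {0..t} s *\<^sub>R \<beta> s \<omega>"] i by simp
    then show ?case by (simp add: euclidean_representation)
  qed
  then have "D \<in> borel_measurable (\<G> t)"
    by (rule completed_filtration_AE_eq[OF DM, rotated])
      (intro borel_measurable_sum borel_measurable_scaleR comp borel_measurable_const)
  moreover have "X t = (\<lambda>\<omega>. N t \<omega> + x + D \<omega>)" by (auto simp: N_def D_def)
  ultimately show ?thesis using N_adapted[OF t] by simp
qed

lemma X_start: "AE \<omega> in M. X 0 \<omega> = x"
proof -
  have "(LINT s:{0..0}|lborel. \<beta> s \<omega>) = 0" for \<omega>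
    unfolding set_lebesgue_integral_def
    by (rule integral_eq_zero_AE) (use AE_lborel_singleton[of 0] in eventually_elim, auto)
  then show ?thesis using has_ito_integral_at_0[OF ito[of 0]] by simp
qed

text \<open>
  The event that the path has stayed in \<open>K\<close> is tested at rational times only, which keeps it
  measurable; for continuous paths and closed \<open>K\<close> nothing is lost.
\<close>

definition alive :: "'a set \<Rightarrow> real \<Rightarrow> real \<Rightarrow> 'w \<Rightarrow> bool" where
  "alive K R t \<omega> \<longleftrightarrow> X t \<omega> \<in> K \<and> (\<forall>q\<in>\<rat> \<inter> {0..t}. X q \<omega> \<in> K) \<and> qv t \<omega> \<le> R"

definition life :: "'a set \<Rightarrow> real \<Rightarrow> real \<Rightarrow> 'w \<Rightarrow> real" where
  "life K R T \<omega> = Sup {t\<in>{0..T}. (\<forall>s\<in>{0..t}. X s \<omega> \<in> K) \<and> qv t \<omega> \<le> R}"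

lemma alive_measurable:
  assumes t: "0 \<le> t" and K: "closed K"
  shows "{\<omega>\<in>space M. alive K R t \<omega>} \<in> sets (\<G> t)"
proof -
  have 1: "{\<omega>\<in>space M. X s \<omega> \<in> K} \<in> sets (\<G> t)" if "0 \<le> s" "s \<le> t" for s
  proof -
    have "X s \<in> borel_measurable (\<G> t)" using measurable_completed_mono[OF X_adapted] that by blast
    from measurable_sets[OF this, of K] show ?thesis
      using K by (simp add: vimage_def Int_def conj_commute)
  qed
  have 2: "{\<omega>\<in>space M. qv t \<omega> \<le> R} \<in> sets (\<G> t)"
    using borel_measurable_le[OF qv_adapted[OF t], of "\<lambda>_. R"] by simp
  have "countable (\<rat> \<inter> {0..t})" using countable_rat by blast
  then have 3: "{\<omega>\<in>space (\<G> t). \<forall>q\<in>\<rat> \<inter> {0..t}. X q \<omega> \<in> K} \<in> sets (\<G> t)"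
    using 1 by (intro sets.sets_Collect_countable_All') auto
  have "{\<omega>\<in>space M. alive K R t \<omega>} = {\<omega>\<in>space M. X t \<omega> \<in> K} \<inter>
    {\<omega>\<in>space (\<G> t). \<forall>q\<in>\<rat> \<inter> {0..t}. X q \<omega> \<in> K} \<inter> {\<omega>\<in>space M. qv t \<omega> \<le> R}"
    unfolding alive_def by auto
  then show ?thesis using 1[OF t order_refl] 2 3 by simp
qed

definition regular :: "'w \<Rightarrow> bool" where
  "regular \<omega> \<longleftrightarrow> continuous_on {0..} (\<lambda>t. X t \<omega>) \<and> X 0 \<omega> = x \<and> (\<forall>t\<ge>0. set_integrable lborel {0..t} (\<lambda>s. \<beta> s \<omega>) \<and>
      set_integrable lborel {0..t} (\<lambda>s. (norm (\<sigma> s \<omega>))\<^sup>2))"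

lemma AE_regular: "AE \<omega> in M. regular \<omega>"
  using paths X_start integrable_coefficients by eventually_elim (simp add: regular_def)

lemma qv_0: "qv 0 \<omega> = 0"
  unfolding qv_def set_lebesgue_integral_def
  by (rule integral_eq_zero_AE) (use AE_lborel_singleton[of 0] in eventually_elim, auto)

lemma qv_mono:
  assumes "regular \<omega>" "0 \<le> s" "s \<le> t"
  shows "qv s \<omega> \<le> qv t \<omega>"
proof -
  have "integrable lborel (\<lambda>r. indicator {0..q} r *\<^sub>R (norm (\<sigma> r \<omega>))\<^sup>2)" if "0 \<le> q" for q
    using assms(1) that unfolding regular_def set_integrable_def by auto
  then show ?thesis unfolding qv_def set_lebesgue_integral_def
    using assms by (intro integral_mono) (auto simp: indicator_def)
qed

lemma qv_continuous:
  assumes "regular \<omega>" "0 \<le> T"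
  shows "continuous_on {0..T} (\<lambda>t. qv t \<omega>)"
proof -
  have i: "set_integrable lborel {0..t} (\<lambda>s. (norm (\<sigma> s \<omega>))\<^sup>2)" if "0 \<le> t" for t
    using assms(1) that unfolding regular_def by auto
  have "continuous_on {0..T} (\<lambda>t. integral {0..t} (\<lambda>s. (norm (\<sigma> s \<omega>))\<^sup>2))"
    by (rule indefinite_integral_continuous_1, rule set_borel_integral_eq_integral(1)[OF i[OF \<open>0 \<le> T\<close>]])
  then show ?thesis
    by (rule continuous_on_eq) (use set_borel_integral_eq_integral(2)[OF i] in \<open>auto simp: qv_def\<close>)
qed

text \<open>For a regular path the supremum is attained, since \<open>K\<close> is closed and both
  \<open>X\<close> and \<open>qv\<close> are continuous. The equivalence of \<open>alive\<close>
  with not having passed \<open>life\<close> links a pathwise random time to adapted coefficients on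
  a grid.\<close>

lemma life_props:
  assumes \<omega>: "regular \<omega>" and K: "closed K" "x \<in> K" and "0 \<le> R" "0 \<le> T"
  shows "0 \<le> life K R T \<omega>" "life K R T \<omega> \<le> T"
    "\<And>s. 0 \<le> s \<Longrightarrow> s \<le> life K R T \<omega> \<Longrightarrow> X s \<omega> \<in> K"
    "qv (life K R T \<omega>) \<omega> \<le> R"
    "\<And>t. 0 \<le> t \<Longrightarrow> t \<le> T \<Longrightarrow> alive K R t \<omega> \<longleftrightarrow> t \<le> life K R T \<omega>"
    "\<And>t. 0 \<le> t \<Longrightarrow> t \<le> T \<Longrightarrow> (\<And>s. 0 \<le> s \<Longrightarrow> s \<le> t \<Longrightarrow> X s \<omega> \<in> K) \<Longrightarrow> qv t \<omega> \<le> R \<Longrightarrow> t \<le> life K R T \<omega>"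
proof -
  let ?A = "{t\<in>{0..T}. (\<forall>s\<in>{0..t}. X s \<omega> \<in> K) \<and> qv t \<omega> \<le> R}"
  define \<theta> where "\<theta> = life K R T \<omega>"
  have \<theta>: "\<theta> = Sup ?A" by (simp add: \<theta>_def life_def)
  have zero: "0 \<in> ?A" using \<omega> K assms by (auto simp: regular_def qv_0)
  have bdd: "bdd_above ?A" by (rule bdd_aboveI[of _ T]) auto
  have up: "t \<le> \<theta>" if "t \<in> ?A" for t unfolding \<theta> using that bdd by (rule cSup_upper)
  show 0: "0 \<le> life K R T \<omega>" using up[OF zero] unfolding \<theta>_def .
  show T: "life K R T \<omega> \<le> T" unfolding \<theta>_def[symmetric] \<theta> by (rule cSup_least) (use zero in auto)
  have contX: "continuous_on {0..T} (\<lambda>t. X t \<omega>)"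
    using \<omega> by (auto simp: regular_def intro: continuous_on_subset)
  have before: "X s \<omega> \<in> K \<and> qv s \<omega> \<le> R" if s: "0 \<le> s" "s < \<theta>" for s
  proof -
    have "?A \<noteq> {}" using zero by blast
    then obtain t where t: "t \<in> ?A" "s < t" using less_cSupE[OF s(2)[unfolded \<theta>]] by blast
    then have "qv s \<omega> \<le> qv t \<omega>" by (intro qv_mono[OF \<omega> s(1)]) simp
    then show ?thesis using s(1) t by simp
  qed
  have at: "X \<theta> \<omega> \<in> K \<and> qv \<theta> \<omega> \<le> R"
  proof (cases "\<theta> = 0")
    case True
    then show ?thesis using zero by simp
  next
    case False
    then have pos: "0 < \<theta>" using 0 \<theta>_def by simp
    \<comment> \<open>\<open>\<theta>\<close> is an accumulation point of the times before it, so
      membership in \<open>K\<close> and the bound on \<open>qv\<close> pass to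
      \<open>\<theta>\<close> by limits from the left.\<close>
    have "\<exists>t\<in>{0..<\<theta>}. \<theta> - t < \<delta>" if "0 < \<delta>" for \<delta>
      using pos that by (intro bexI[of _ "max 0 (\<theta> - \<delta> / 2)"]) auto
    then have nt: "at \<theta> within {0..<\<theta>} \<noteq> bot"
      by (simp add: trivial_limit_within islimpt_approachable_real)
    have "\<theta> \<in> {0..T}" "{0..<\<theta>} \<subseteq> {0..T}" using 0 T unfolding \<theta>_def[symmetric] by auto
    then have lim: "((\<lambda>t. X t \<omega>) \<longlongrightarrow> X \<theta> \<omega>) (at \<theta> within {0..<\<theta>})"
      "((\<lambda>t. qv t \<omega>) \<longlongrightarrow> qv \<theta> \<omega>) (at \<theta> within {0..<\<theta>})"
      using contX qv_continuous[OF \<omega> \<open>0 \<le> T\<close>] unfolding continuous_on_def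
      by (blast intro: tendsto_within_subset)+
    have ev: "eventually (\<lambda>t. X t \<omega> \<in> K) (at \<theta> within {0..<\<theta>})"
      "eventually (\<lambda>t. qv t \<omega> \<le> R) (at \<theta> within {0..<\<theta>})"
      unfolding eventually_at_filter using before by (auto intro!: always_eventually)
    show ?thesis
      using Lim_in_closed_set[OF K(1) ev(1) nt lim(1)] tendsto_upperbound[OF lim(2) ev(2) nt] by simp
  qed
  show stay: "X s \<omega> \<in> K" if "0 \<le> s" "s \<le> life K R T \<omega>" for s
    using before[of s] at that \<theta>_def by (cases "s = \<theta>") auto
  show q: "qv (life K R T \<omega>) \<omega> \<le> R" using at \<theta>_def by simp
  show last: "t \<le> life K R T \<omega>" if "0 \<le> t" "t \<le> T" "\<And>s. 0 \<le> s \<Longrightarrow> s \<le> t \<Longrightarrow> X s \<omega> \<in> K" "qv t \<omega> \<le> R" for t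
    using up[of t] that unfolding \<theta>_def by auto
  show "alive K R t \<omega> \<longleftrightarrow> t \<le> life K R T \<omega>" if t: "0 \<le> t" "t \<le> T" for t
  proof
    assume "t \<le> life K R T \<omega>"
    then show "alive K R t \<omega>"
      using stay t q qv_mono[OF \<omega> t(1), of "life K R T \<omega>"] unfolding alive_def by auto
  next
    assume a: "alive K R t \<omega>"
    have "X s \<omega> \<in> K" if s: "0 \<le> s" "s \<le> t" for s
    proof (cases "s = t")
      case False
      then have "s < t" using s by simp
      \<comment> \<open>Rational times are taken to the right of \<open>s\<close> and below
        \<open>t\<close>; the time \<open>t\<close> itself is tested explicitly in
        \<open>alive\<close>.\<close>
      have "s \<in> closure (\<rat> \<inter> {s<..<t})"
      proof -
        have "\<exists>q\<in>\<rat> \<inter> {s<..<t}. dist q s < e" if e: "0 < e" for e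
        proof -
          obtain q where "q \<in> \<rat>" "s < q" "q < min t (s + e)"
            using Rats_dense_in_real[of s "min t (s + e)"] \<open>s < t\<close> e by auto
          then show ?thesis by (intro bexI[of _ q]) (auto simp: dist_real_def)
        qed
        then show ?thesis unfolding closure_approachable by blast
      qed
      then obtain q where q: "\<And>n. q n \<in> \<rat> \<inter> {s<..<t}" "q \<longlonglongrightarrow> s" unfolding closure_sequential by blast
      have conv: "(\<lambda>n. X (q n) \<omega>) \<longlonglongrightarrow> X s \<omega>"
      proof (rule continuous_on_tendsto_compose[OF contX q(2)])
        show "eventually (\<lambda>n. q n \<in> {0..T}) sequentially"
        proof (intro always_eventually allI)
          fix n show "q n \<in> {0..T}" using q(1)[of n] s t by auto
        qed
      qed (use s t in auto)
      have "\<forall>n. X (q n) \<omega> \<in> K"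
      proof
        fix n
        have "q n \<in> \<rat> \<inter> {0..t}" using q(1)[of n] s by auto
        then show "X (q n) \<omega> \<in> K" using a unfolding alive_def by blast
      qed
      then have "eventually (\<lambda>n. X (q n) \<omega> \<in> K) sequentially" by (rule always_eventually)
      then show ?thesis by (rule Lim_in_closed_set[OF K(1) _ sequentially_bot conv])
    qed (use a in \<open>auto simp: alive_def\<close>)
    then show "t \<le> life K R T \<omega>" using last t a unfolding alive_def by auto
  qed
qed

end

section \<open>Verification by a concave function\<close>

lemma concat_list_integral:
  "list_integral B (concat (map f [0..<n])) \<omega> = (\<Sum>k<n. list_integral B (f k) \<omega>)"
  by (induction n) (auto simp: list_integral_append, simp add: list_integral_def)

lemma concat_list_process:
  "list_process (concat (map f [0..<n])) s \<omega> = (\<Sum>k<n. list_process (f k) s \<omega>)"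
  by (induction n) (auto simp: list_process_append, simp add: list_process_def)

lemma (in brownian_motion) adapted_steps_concat:
  assumes "\<And>k. k < n \<Longrightarrow> adapted_steps (f k)"
  shows "adapted_steps (concat (map f [0..<n]))"
proof -
  have "adapted_steps (concat (map f [0..<k]))" if "k \<le> n" for k
    using that
  proof (induction k)
    case (Suc k)
    then have "adapted_steps (concat (map f [0..<k]))" "adapted_steps (f k)" using assms by simp_all
    then show ?case unfolding adapted_steps_def by (simp add: ball_Un)
  qed (simp add: adapted_steps_def)
  then show ?thesis by simp
qed

lemma (in ito_process) \<sigma>_path_measurable:
  assumes "\<omega> \<in> space M"
  shows "(\<lambda>s. indicator {0..} s *\<^sub>R \<sigma> s \<omega>) \<in> borel_measurable borel"
proof -
  have "(\<lambda>s. (s, \<omega>)) \<in> restrict_space borel {0..} \<rightarrow>\<^sub>M (restrict_space borel {0..} \<Otimes>\<^sub>M M)"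
    using assms by measurable
  from measurable_compose[OF this \<sigma>_meas]
  have "(\<lambda>s. \<sigma> s \<omega>) \<in> borel_measurable (restrict_space borel {0..})" by simp
  then show ?thesis by (subst (asm) borel_measurable_restrict_space_iff) auto
qed

text \<open>The expected final value of \<open>V\<close> minus the drift integral should be at most
  \<open>V x\<close>. Measurability of that quantity is not at hand, so the bound is expressed
  through a measurable majorant \<open>W\<close>. The slack \<open>\<epsilon>\<close> comes from
  truncating the stochastic sums from below to make Fatou's lemma applicable; their uniform bound in
  L2 makes the loss small.\<close>

lemma (in ito_process) verification:
  fixes V :: "'a \<Rightarrow> real" and g :: "'a \<Rightarrow> 'a"
  assumes K: "compact K" "x \<in> K" and U: "open U" "K \<subseteq> U"
    and V: "continuous_on U V" and g: "continuous_on K g"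
    and sup: "\<And>y z. y \<in> K \<Longrightarrow> z \<in> U \<Longrightarrow> V z \<le> V y + g y \<bullet> (z - y)"
    and V_nonneg: "\<And>y. y \<in> K \<Longrightarrow> 0 \<le> V y"
    and drift: "\<And>y s \<omega>. y \<in> K \<Longrightarrow> 0 \<le> s \<Longrightarrow> \<omega> \<in> space M \<Longrightarrow> g y \<bullet> \<beta> s \<omega> \<le> 0"
    and T: "0 < T" and R: "0 \<le> R" and \<epsilon>: "0 < \<epsilon>"
  obtains W where "W \<in> borel_measurable M" "(\<integral>\<^sup>+\<omega>. W \<omega> \<partial>M) \<le> ennreal (V x + \<epsilon>)"
    "AE \<omega> in M. ennreal (V (X (life K R T \<omega>) \<omega>) -
       (LINT s:{0..life K R T \<omega>}|lborel. g (X s \<omega>) \<bullet> \<beta> s \<omega>)) \<le> W \<omega>"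
proof -
  have cK: "closed K" using K(1) by (rule compact_imp_closed)
  have T0: "0 \<le> T" using T by simp
  have "bounded (g ` K)" using K(1) g by (intro compact_imp_bounded compact_continuous_image)
  then obtain C where C: "\<And>y. y \<in> K \<Longrightarrow> norm (g y) \<le> C" "0 \<le> C"
    unfolding bounded_iff using K(2) by (metis imageI norm_ge_zero order_trans)
  \<comment> \<open>The gradient frozen at the left end of a cell and switched off once the path is
    no longer alive; this is how stopping enters.\<close>
  define \<gamma> where "\<gamma> n k \<omega> = (if alive K R (grid T n k) \<omega> then g (X (grid T n k) \<omega>) else 0)" for n k \<omega>
  have gm: "(\<lambda>y. indicator K y *\<^sub>R g y) \<in> borel_measurable borel"
    using g cK by (intro borel_measurable_continuous_on_indicator) auto
  have \<gamma>_meas: "\<gamma> n k \<in> borel_measurable (\<G> (grid T n k))" if "k \<le> Suc n" for n k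
  proof -
    have t: "0 \<le> grid T n k" using grid_bounds[OF T0 that] by simp
    have "\<gamma> n k = (\<lambda>\<omega>. if alive K R (grid T n k) \<omega> then
       indicator K (X (grid T n k) \<omega>) *\<^sub>R g (X (grid T n k) \<omega>) else 0)"
      by (auto simp: \<gamma>_def alive_def)
    also have "\<dots> \<in> borel_measurable (\<G> (grid T n k))"
      using alive_measurable[OF t cK, of R] measurable_compose[OF X_adapted[OF t] gm]
      by (intro measurable_If) auto
    finally show ?thesis .
  qed
  have \<gamma>_bdd: "norm (\<gamma> n k \<omega>) \<le> C" for n k \<omega>
    using C by (auto simp: \<gamma>_def alive_def)
  \<comment> \<open>\<open>n + 3\<close> counts the exceptional events of stage \<open>n\<close>:
    one for the L2 distance and one for each of the \<open>n + 2\<close> grid points. The factor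
    \<open>2 * C + 1\<close> also absorbs an error of \<open>2 * C * e n\<close> in each of the
    \<open>n + 1\<close> cells.\<close>
  define e where "e n = (1 / 2) ^ n / (real (n + 3) * (2 * C + 1))" for n :: nat
  have e_pos: "0 < e n" for n unfolding e_def using C(2) by (intro divide_pos_pos mult_pos_pos) auto
  have e_eq: "real (n + 3) * (2 * C + 1) * e n = (1 / 2) ^ n" for n
  proof -
    have "real (n + 3) * (2 * C + 1) \<noteq> 0" using C(2) by simp
    then show ?thesis unfolding e_def by (metis nonzero_mult_div_cancel_left times_divide_eq_right)
  qed
  have e1: "real (n + 3) * e n \<le> (1 / 2) ^ n" for n
    using e_eq[of n] e_pos[of n] mult_left_mono[of 1 "2 * C + 1" "real (n + 3) * e n"] C(2)
    by (simp add: mult_ac)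
  have e2: "real (Suc n) * (2 * C * e n) \<le> (1 / 2) ^ n" for n
  proof -
    have "real (Suc n) * (2 * C) \<le> real (n + 3) * (2 * C + 1)" using C(2) by (intro mult_mono) auto
    then have "real (Suc n) * (2 * C) * e n \<le> (1 / 2) ^ n"
      unfolding e_eq[symmetric] using e_pos[of n] by (intro mult_right_mono) auto
    then show ?thesis by (simp only: mult.assoc)
  qed
  have e3: "e n \<le> 1" for n
  proof -
    have "1 * e n \<le> real (n + 3) * e n" using e_pos[of n] by (intro mult_right_mono) auto
    also have "\<dots> \<le> (1 / 2) ^ n" by (rule e1)
    also have "\<dots> \<le> 1" by (rule power_le_one) auto
    finally show ?thesis by simp
  qed
  \<comment> \<open>Bundling the step data into a triple lets one choice over \<open>n\<close>
    produce all three sequences.\<close>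
  define approx where "approx n z \<longleftrightarrow> (case z of (m, r, f) \<Rightarrow>
    step_data M B T m r f \<and> step_distance T \<sigma> m r f \<in> borel_measurable M \<and>
    prob {\<omega>\<in>space M. ennreal (e n) < step_distance T \<sigma> m r f \<omega>} \<le> e n \<and>
    (\<forall>t. 0 \<le> t \<longrightarrow> t \<le> T \<longrightarrow> prob {\<omega>\<in>space M. e n < norm (stopped_step_integral B m r f t \<omega> - N t \<omega>)} \<le> e n))"
    for n z
  have "\<exists>z. approx n z" for n
  proof -
    have "has_ito_integral M B \<sigma> t (N t)" if "0 \<le> t" for t using ito[OF that] unfolding N_def[abs_def] .
    then show ?thesis
    proof (rule ito_approximant_uniform[OF _ T0 e_pos[of n] \<sigma>_path_measurable])
      fix m r f
      assume "step_data M B T m r f" "step_distance T \<sigma> m r f \<in> borel_measurable M"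
        "prob {\<omega>\<in>space M. ennreal (e n) < step_distance T \<sigma> m r f \<omega>} \<le> e n"
        "\<And>t. 0 \<le> t \<Longrightarrow> t \<le> T \<Longrightarrow> prob {\<omega>\<in>space M. e n < norm (stopped_step_integral B m r f t \<omega> - N t \<omega>)} \<le> e n"
      then have "approx n (m, r, f)" unfolding approx_def by simp
      then show "\<exists>z. approx n z" ..
    qed
  qed
  then obtain z where z: "\<And>n. approx n (z n)" by metis
  define m where "m n = fst (z n)" for n
  define r where "r n = fst (snd (z n))" for n
  define f where "f n = snd (snd (z n))" for n
  have mrf: "z n = (m n, r n, f n)" for n by (simp add: m_def r_def f_def)
  have sd: "\<And>n. step_data M B T (m n) (r n) (f n)"
    and sdm: "\<And>n. step_distance T \<sigma> (m n) (r n) (f n) \<in> borel_measurable M"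
    and p1: "\<And>n. prob {\<omega>\<in>space M. ennreal (e n) < step_distance T \<sigma> (m n) (r n) (f n) \<omega>} \<le> e n"
    and p2: "\<And>n t. 0 \<le> t \<Longrightarrow> t \<le> T \<Longrightarrow>
      prob {\<omega>\<in>space M. e n < norm (stopped_step_integral B (m n) (r n) (f n) t \<omega> - N t \<omega>)} \<le> e n"
    using z unfolding mrf approx_def by simp_all
  define I where "I n = stopped_step_integral B (m n) (r n) (f n)" for n
  \<comment> \<open>Off \<open>A n\<close> the approximant is right at all points of the n-th grid
    simultaneously and close to \<open>\<sigma>\<close> in L2; the probabilities are
    summable.\<close>
  define A where "A n = {\<omega>\<in>space M. ennreal (e n) < step_distance T \<sigma> (m n) (r n) (f n) \<omega>} \<union>
    (\<Union>k\<in>{..Suc n}. {\<omega>\<in>space M. e n < norm (I n (grid T n k) \<omega> - N (grid T n k) \<omega>)})" for n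
  have N_M: "N t \<in> borel_measurable M" if "0 \<le> t" for t using measurable_completedD[OF N_adapted[OF that]] .
  have I_M: "I n t \<in> borel_measurable M" if "0 \<le> t" for n t
    unfolding I_def by (rule measurable_stopped_step_integral[OF sd that])
  have ev1: "{\<omega>\<in>space M. ennreal (e n) < step_distance T \<sigma> (m n) (r n) (f n) \<omega>} \<in> events" for n
    using sdm by measurable
  have ev2: "{\<omega>\<in>space M. e n < norm (I n (grid T n k) \<omega> - N (grid T n k) \<omega>)} \<in> events" if "k \<le> Suc n" for n k
  proof -
    have "0 \<le> grid T n k" using grid_bounds[OF T0 that] by simp
    from N_M[OF this] I_M[OF this] show ?thesis by measurable
  qed
  have A_ev: "A n \<in> events" for n unfolding A_def using ev1 ev2 by auto
  have A_prob: "prob (A n) \<le> (1 / 2) ^ n" for n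
  proof -
    have "prob (A n) \<le> prob {\<omega>\<in>space M. ennreal (e n) < step_distance T \<sigma> (m n) (r n) (f n) \<omega>} +
      prob (\<Union>k\<in>{..Suc n}. {\<omega>\<in>space M. e n < norm (I n (grid T n k) \<omega> - N (grid T n k) \<omega>)})"
      unfolding A_def using ev1 ev2 by (intro measure_Un_le) auto
    also have "\<dots> \<le> e n + (\<Sum>k\<in>{..Suc n}. e n)"
    proof (intro add_mono p1)
      have "prob (\<Union>k\<in>{..Suc n}. {\<omega>\<in>space M. e n < norm (I n (grid T n k) \<omega> - N (grid T n k) \<omega>)}) \<le>
        (\<Sum>k\<in>{..Suc n}. prob {\<omega>\<in>space M. e n < norm (I n (grid T n k) \<omega> - N (grid T n k) \<omega>)})"
        using ev2 by (intro measure_UNION_le) auto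
      also have "\<dots> \<le> (\<Sum>k\<in>{..Suc n}. e n)"
        unfolding I_def using grid_bounds[OF T0] by (intro sum_mono p2) auto
      finally show "prob (\<Union>k\<in>{..Suc n}. {\<omega>\<in>space M. e n < norm (I n (grid T n k) \<omega> - N (grid T n k) \<omega>)}) \<le> (\<Sum>k\<in>{..Suc n}. e n)" .
    qed
    also have "\<dots> = real (n + 3) * e n" by (simp add: algebra_simps)
    finally show ?thesis using e1[of n] by simp
  qed
  define xs where "xs n = concat (map (\<lambda>k. window_steps (m n) (r n) (f n) (grid T n k) (grid T n (Suc k)) (\<gamma> n k)) [0..<Suc n])" for n
  have rm: "\<forall>i<m n. r n i \<le> r n (Suc i)" for n using sd[of n] by (simp add: step_data_def)
  have xs_ad: "adapted_steps (xs n)" for n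
  proof -
    have "adapted_steps (window_steps (m n) (r n) (f n) (grid T n k) (grid T n (Suc k)) (\<gamma> n k))" if "k < Suc n" for k
      using grid_bounds[OF T0, of k n] that
      by (intro adapted_steps_window[OF sd _ \<gamma>_meas \<gamma>_bdd]) auto
    then show ?thesis unfolding xs_def by (rule adapted_steps_concat)
  qed
  have xs_int: "list_integral B (xs n) \<omega> = (\<Sum>k<Suc n. \<gamma> n k \<omega> \<bullet> (I n (grid T n (Suc k)) \<omega> - I n (grid T n k) \<omega>))" for n \<omega>
    unfolding xs_def concat_list_integral I_def
    by (intro sum.cong refl list_integral_window_steps rm grid_mono[OF T0]) simp
  have xs_proc: "list_process (xs n) s \<omega> = (\<Sum>k<Suc n. indicator {grid T n k..<grid T n (Suc k)} s *
    (\<gamma> n k \<omega> \<bullet> step_process (m n) (r n) (f n) s \<omega>))" for n s \<omega>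
    unfolding xs_def concat_list_process
    by (intro sum.cong refl list_process_window_steps rm)
  define L where "L = 2 * C\<^sup>2 * (R + 2)"
  have L: "0 \<le> L" using R by (simp add: L_def)
  define cutoff where "cutoff n Z \<longleftrightarrow> Z \<in> borel_measurable M \<and> integrable M Z \<and> expectation Z = 0 \<and>
    integrable M (\<lambda>\<omega>. (Z \<omega>)\<^sup>2) \<and> expectation (\<lambda>\<omega>. (Z \<omega>)\<^sup>2) \<le> L \<and>
    (\<forall>\<omega>. (\<integral>\<^sup>+s. ennreal ((list_process (xs n) s \<omega>)\<^sup>2) \<partial>lborel) \<le> ennreal L \<longrightarrow> Z \<omega> = list_integral B (xs n) \<omega>)"
    for n Z
  have "\<exists>Z. cutoff n Z" for n
    by (rule list_integral_cutoff[OF xs_ad[of n] L]) (auto simp: cutoff_def)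
  then obtain S where "\<And>n. cutoff n (S n)" by metis
  then have S: "\<And>n. S n \<in> borel_measurable M" "\<And>n. integrable M (S n)" "\<And>n. expectation (S n) = 0"
    "\<And>n. integrable M (\<lambda>\<omega>. (S n \<omega>)\<^sup>2)" "\<And>n. expectation (\<lambda>\<omega>. (S n \<omega>)\<^sup>2) \<le> L"
    "\<And>n \<omega>. (\<integral>\<^sup>+s. ennreal ((list_process (xs n) s \<omega>)\<^sup>2) \<partial>lborel) \<le> ennreal L \<Longrightarrow> S n \<omega> = list_integral B (xs n) \<omega>"
    unfolding cutoff_def by simp_all
  define Y where "Y \<omega> = V (X (life K R T \<omega>) \<omega>) - (LINT s:{0..life K R T \<omega>}|lborel. g (X s \<omega>) \<bullet> \<beta> s \<omega>)" for \<omega>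
  have path: "0 \<le> Y \<omega> \<and> (\<exists>l. l \<longlonglongrightarrow> Y \<omega> \<and> eventually (\<lambda>n. l n \<le> V x + S n \<omega>) sequentially)"
    if \<omega>: "regular \<omega>" "\<omega> \<in> space M" and ev: "eventually (\<lambda>n. \<omega> \<notin> A n) sequentially" for \<omega>
  proof -
    define \<theta> where "\<theta> = life K R T \<omega>"
    let ?\<kappa> = "grid_stop T \<theta>"
    note life = life_props[OF \<omega>(1) cK K(2) R T0, folded \<theta>_def]
    note kb = grid_stop_bounds[OF T0 life(1,2)]
    have cX: "continuous_on {0..T} (\<lambda>t. X t \<omega>)"
      using \<omega>(1) by (auto simp: regular_def intro: continuous_on_subset)
    have \<beta>i: "set_integrable lborel {0..T} (\<lambda>s. \<beta> s \<omega>)" using \<omega>(1) T0 by (simp add: regular_def)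
    have X0: "X 0 \<omega> = x" using \<omega>(1) by (simp add: regular_def)
    obtain l where l: "l \<longlonglongrightarrow> V (X \<theta> \<omega>) - (LINT s:{0..\<theta>}|lborel. g (X s \<omega>) \<bullet> \<beta> s \<omega>)"
      "eventually (\<lambda>n. l n \<le> V (X 0 \<omega>) + (\<Sum>k<?\<kappa> n. g (X (grid T n k) \<omega>) \<bullet>
        ((X (grid T n (Suc k)) \<omega> - x - (LINT s:{0..grid T n (Suc k)}|lborel. \<beta> s \<omega>)) -
         (X (grid T n k) \<omega> - x - (LINT s:{0..grid T n k}|lborel. \<beta> s \<omega>))))) sequentially"
      by (rule supergradient_path_inequality[OF T life(1,2) cX life(3) \<beta>i U V g sup])
    have \<gamma>_eq: "\<gamma> n k \<omega> = (if k < ?\<kappa> n then g (X (grid T n k) \<omega>) else 0)" if "k \<le> n" for n k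
      using life(5)[of "grid T n k"] grid_bounds[OF T0, of k n] less_grid_stop_iff[OF T0 that, of \<theta>] that
      by (simp add: \<gamma>_def)
    \<comment> \<open>Extending the sum to the full grid removes the random index: the indicator
      inside \<open>\<gamma>\<close> does the stopping.\<close>
    have N_sum: "(\<Sum>k<?\<kappa> n. g (X (grid T n k) \<omega>) \<bullet> (N (grid T n (Suc k)) \<omega> - N (grid T n k) \<omega>)) =
      (\<Sum>k<Suc n. \<gamma> n k \<omega> \<bullet> (N (grid T n (Suc k)) \<omega> - N (grid T n k) \<omega>))" for n
      by (rule sum.mono_neutral_cong_left) (use grid_stop_le[of T \<theta> n] \<gamma>_eq in auto)
    have "eventually (\<lambda>n. l n \<le> V x + (\<Sum>k<?\<kappa> n. g (X (grid T n k) \<omega>) \<bullet>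
      (N (grid T n (Suc k)) \<omega> - N (grid T n k) \<omega>))) sequentially"
      using l(2) unfolding X0 N_def .
    then have lN: "eventually (\<lambda>n. l n \<le> V x + (\<Sum>k<Suc n. \<gamma> n k \<omega> \<bullet> (N (grid T n (Suc k)) \<omega> - N (grid T n k) \<omega>))) sequentially"
      unfolding N_sum .
    have diff: "\<bar>(\<Sum>k<Suc n. \<gamma> n k \<omega> \<bullet> (N (grid T n (Suc k)) \<omega> - N (grid T n k) \<omega>)) - list_integral B (xs n) \<omega>\<bar> \<le> (1 / 2) ^ n"
      if "\<omega> \<notin> A n" for n
    proof -
      have close: "norm (I n (grid T n k) \<omega> - N (grid T n k) \<omega>) \<le> e n" if "k \<le> Suc n" for k
        using \<open>\<omega> \<notin> A n\<close> that \<omega>(2) unfolding A_def by (auto simp: not_less)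
      have "\<bar>\<gamma> n k \<omega> \<bullet> (N (grid T n (Suc k)) \<omega> - N (grid T n k) \<omega>) - \<gamma> n k \<omega> \<bullet> (I n (grid T n (Suc k)) \<omega> - I n (grid T n k) \<omega>)\<bar> \<le> 2 * C * e n"
        if "k < Suc n" for k
      proof -
        let ?d = "(I n (grid T n k) \<omega> - N (grid T n k) \<omega>) - (I n (grid T n (Suc k)) \<omega> - N (grid T n (Suc k)) \<omega>)"
        have "norm ?d \<le> e n + e n"
          by (rule order_trans[OF norm_triangle_ineq4 add_mono]) (use that in \<open>auto intro: close\<close>)
        then have "norm (\<gamma> n k \<omega>) * norm ?d \<le> C * (e n + e n)"
          using \<gamma>_bdd C(2) by (intro mult_mono) auto
        moreover have "\<bar>\<gamma> n k \<omega> \<bullet> ?d\<bar> \<le> norm (\<gamma> n k \<omega>) * norm ?d" by (rule Cauchy_Schwarz_ineq2)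
        moreover have "\<gamma> n k \<omega> \<bullet> (N (grid T n (Suc k)) \<omega> - N (grid T n k) \<omega>) - \<gamma> n k \<omega> \<bullet> (I n (grid T n (Suc k)) \<omega> - I n (grid T n k) \<omega>) = \<gamma> n k \<omega> \<bullet> ?d"
          by (simp add: inner_diff_right)
        ultimately show ?thesis by simp
      qed
      then have "(\<Sum>k<Suc n. \<bar>\<gamma> n k \<omega> \<bullet> (N (grid T n (Suc k)) \<omega> - N (grid T n k) \<omega>) - \<gamma> n k \<omega> \<bullet> (I n (grid T n (Suc k)) \<omega> - I n (grid T n k) \<omega>)\<bar>)
        \<le> (\<Sum>k<Suc n. 2 * C * e n)" by (intro sum_mono) auto
      also have "\<dots> = real (Suc n) * (2 * C * e n)" by (simp only: sum_constant card_lessThan)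
      also have "\<dots> \<le> (1 / 2) ^ n" by (rule e2)
      finally show ?thesis
        unfolding xs_int sum_subtractf[symmetric] by (rule order_trans[OF sum_abs])
    qed
    \<comment> \<open>The grid passes \<open>\<theta>\<close> by up to one cell, so \<open>R\<close>
      is replaced by \<open>R + 1\<close>, which holds for fine grids by continuity of
      \<open>qv\<close>.\<close>
    have qv_ev: "eventually (\<lambda>n. qv (grid T n (?\<kappa> n)) \<omega> < R + 1) sequentially"
    proof -
      have "(\<lambda>n. qv (grid T n (?\<kappa> n)) \<omega>) \<longlonglongrightarrow> qv \<theta> \<omega>"
      proof (rule continuous_on_tendsto_compose[OF qv_continuous[OF \<omega>(1) T0] tendsto_grid_stop[OF T0 life(1,2)]])
        show "eventually (\<lambda>n. grid T n (?\<kappa> n) \<in> {0..T}) sequentially"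
          using kb(2,3) life(1) by (intro always_eventually) (auto intro: order_trans)
      qed (use life in auto)
      then show ?thesis by (rule order_tendstoD(2)) (use life(4) in simp)
    qed
    \<comment> \<open>Off \<open>A n\<close> and with the overshoot under control, the quadratic
      variation of the step process stays below \<open>L\<close>, so the cut-off is
      inactive.\<close>
    have cut: "S n \<omega> = list_integral B (xs n) \<omega>" if "\<omega> \<notin> A n" "qv (grid T n (?\<kappa> n)) \<omega> < R + 1" for n
    proof (rule S(6))
      let ?t = "grid T n (?\<kappa> n)" and ?H = "\<lambda>s. step_process (m n) (r n) (f n) s \<omega>"
      have t: "0 \<le> ?t" "?t \<le> T" using kb(2,3)[of n] life(1) by auto
      have bound: "\<bar>list_process (xs n) s \<omega>\<bar> \<le> C * norm (?H s) * indicator {0..?t} s" for s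
      proof -
        have "\<bar>list_process (xs n) s \<omega>\<bar> \<le> (\<Sum>k<Suc n. indicator {grid T n k..<grid T n (Suc k)} s * \<bar>\<gamma> n k \<omega> \<bullet> ?H s\<bar>)"
          unfolding xs_proc by (rule order_trans[OF sum_abs]) (simp add: abs_mult)
        also have "\<dots> = (\<Sum>k<?\<kappa> n. indicator {grid T n k..<grid T n (Suc k)} s * \<bar>\<gamma> n k \<omega> \<bullet> ?H s\<bar>)"
          by (rule sum.mono_neutral_cong_right) (use grid_stop_le[of T \<theta> n] \<gamma>_eq in auto)
        also have "\<dots> \<le> (\<Sum>k<?\<kappa> n. indicator {grid T n k..<grid T n (Suc k)} s * (C * norm (?H s)))"
          by (intro sum_mono mult_left_mono order_trans[OF Cauchy_Schwarz_ineq2] mult_right_mono \<gamma>_bdd) auto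
        \<comment> \<open>The cells before index \<open>?\<kappa> n\<close> tile the interval from 0
          to \<open>?t\<close>, and written as differences their indicators telescope.\<close>
        also have "\<dots> = (\<Sum>k<?\<kappa> n. indicator {..<grid T n (Suc k)} s - indicator {..<grid T n k} s) * (C * norm (?H s))"
          unfolding sum_distrib_right
        proof (intro sum.cong refl arg_cong2[where f = "(*)"])
          fix k
          have "grid T n k \<le> grid T n (Suc k)" using T0 by (intro grid_mono) auto
          then show "(indicator {grid T n k..<grid T n (Suc k)} s :: real) = indicator {..<grid T n (Suc k)} s - indicator {..<grid T n k} s"
            by (auto simp: indicator_def)
        qed
        also have "\<dots> = (indicator {..<?t} s - indicator {..<0} s) * (C * norm (?H s))"
          by (subst sum_lessThan_telescope) simp
        also have "\<dots> \<le> C * norm (?H s) * indicator {0..?t} s"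
          using C(2) t by (auto simp: indicator_def)
        finally show ?thesis .
      qed
      let ?f = "\<lambda>s. ennreal ((norm (?H s - \<sigma> s \<omega>))\<^sup>2) * indicator {0..T} s"
      let ?g = "\<lambda>s. ennreal ((norm (\<sigma> s \<omega>))\<^sup>2) * indicator {0..?t} s"
      define h where "h s = indicator {0..} s *\<^sub>R \<sigma> s \<omega>" for s
      have [measurable]: "h \<in> borel_measurable borel"
        unfolding h_def[abs_def] by (rule \<sigma>_path_measurable[OF \<omega>(2)])
      have fg: "?f = (\<lambda>s. ennreal ((norm (?H s - h s))\<^sup>2) * indicator {0..T} s)"
        "?g = (\<lambda>s. ennreal ((norm (h s))\<^sup>2) * indicator {0..?t} s)"
        by (auto simp: h_def indicator_def)
      note [measurable] = step_process_measurable
      have fgm: "?f \<in> borel_measurable lborel" "?g \<in> borel_measurable lborel"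
        unfolding fg by measurable
      have "(\<integral>\<^sup>+s. ennreal ((list_process (xs n) s \<omega>)\<^sup>2) \<partial>lborel) \<le> (\<integral>\<^sup>+s. ennreal (2 * C\<^sup>2) * (?f s + ?g s) \<partial>lborel)"
      proof (rule nn_integral_mono)
        fix s
        show "ennreal ((list_process (xs n) s \<omega>)\<^sup>2) \<le> ennreal (2 * C\<^sup>2) * (?f s + ?g s)"
        proof (cases "s \<in> {0..?t}")
          case True
          then have "\<bar>list_process (xs n) s \<omega>\<bar> \<le> C * norm (?H s)" using bound[of s] by simp
          then have "(list_process (xs n) s \<omega>)\<^sup>2 \<le> (C * norm (?H s))\<^sup>2"
            using C(2) by (simp add: abs_le_square_iff[symmetric])
          also have "\<dots> = C\<^sup>2 * (norm (?H s - 0))\<^sup>2" by (simp add: power_mult_distrib)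
          also have "\<dots> \<le> C\<^sup>2 * (2 * ((norm (?H s - \<sigma> s \<omega>))\<^sup>2 + (norm (0 - \<sigma> s \<omega>))\<^sup>2))"
            by (intro mult_left_mono norm_diff_sq_le) simp
          finally have "ennreal ((list_process (xs n) s \<omega>)\<^sup>2) \<le>
            ennreal (2 * C\<^sup>2 * ((norm (?H s - \<sigma> s \<omega>))\<^sup>2 + (norm (\<sigma> s \<omega>))\<^sup>2))"
            by (intro ennreal_leI) (simp add: distrib_left mult_ac)
          also have "\<dots> = ennreal (2 * C\<^sup>2) * (?f s + ?g s)"
            using True t by (simp add: ennreal_mult' ennreal_plus del: ennreal_numeral)
          finally show ?thesis .
        next
          case False
          then have "list_process (xs n) s \<omega> = 0" using bound[of s] by simp
          then show ?thesis by simp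
        qed
      qed
      also have "\<dots> = ennreal (2 * C\<^sup>2) * ((\<integral>\<^sup>+s. ?f s \<partial>lborel) + (\<integral>\<^sup>+s. ?g s \<partial>lborel))"
        using fgm by (simp add: nn_integral_cmult nn_integral_add)
      also have "(\<integral>\<^sup>+s. ?g s \<partial>lborel) = ennreal (qv ?t \<omega>)"
      proof -
        have "integrable lborel (\<lambda>s. indicator {0..?t} s *\<^sub>R (norm (\<sigma> s \<omega>))\<^sup>2)"
          using \<omega>(1) t unfolding regular_def set_integrable_def by auto
        then have "(\<integral>\<^sup>+s. ennreal (indicator {0..?t} s *\<^sub>R (norm (\<sigma> s \<omega>))\<^sup>2) \<partial>lborel) = ennreal (qv ?t \<omega>)"
          unfolding qv_def set_lebesgue_integral_def by (rule nn_integral_eq_integral) simp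
        then show ?thesis by (simp add: ennreal_mult' ennreal_indicator mult.commute)
      qed
      also have "(\<integral>\<^sup>+s. ?f s \<partial>lborel) \<le> ennreal 1"
      proof -
        have "step_distance T \<sigma> (m n) (r n) (f n) \<omega> \<le> ennreal (e n)"
          using that(1) \<omega>(2) unfolding A_def by (auto simp: not_less)
        also have "\<dots> \<le> ennreal 1" using e3 by (rule ennreal_leI)
        finally show ?thesis unfolding step_distance_def .
      qed
      also have "ennreal (qv ?t \<omega>) \<le> ennreal (R + 1)" using that(2) by (intro ennreal_leI) simp
      also have "ennreal (2 * C\<^sup>2) * (ennreal 1 + ennreal (R + 1)) = ennreal L"
        unfolding L_def using R by (simp add: ennreal_mult' ennreal_plus[symmetric] add.commute del: ennreal_plus ennreal_1)
      finally show "(\<integral>\<^sup>+s. ennreal ((list_process (xs n) s \<omega>)\<^sup>2) \<partial>lborel) \<le> ennreal L"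
        by (simp add: add_mono mult_left_mono)
    qed
    have "(\<lambda>n. l n - (1 / 2) ^ n) \<longlonglongrightarrow> Y \<omega> - 0"
      using l(1) unfolding Y_def \<theta>_def by (intro tendsto_diff LIMSEQ_power_zero) auto
    moreover have "eventually (\<lambda>n. l n - (1 / 2) ^ n \<le> V x + S n \<omega>) sequentially"
      using ev qv_ev lN
    proof eventually_elim
      case (elim n)
      then show ?case using diff[OF elim(1)] cut[OF elim(1,2)] by linarith
    qed
    moreover have "0 \<le> Y \<omega>"
    proof -
      have "0 \<le> (LINT s|lborel. - (indicator {0..\<theta>} s *\<^sub>R (g (X s \<omega>) \<bullet> \<beta> s \<omega>)))"
        by (rule Bochner_Integration.integral_nonneg) (use drift life(3) \<omega>(2) in \<open>auto simp: indicator_def\<close>)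
      then have "(LINT s:{0..\<theta>}|lborel. g (X s \<omega>) \<bullet> \<beta> s \<omega>) \<le> 0"
        unfolding set_lebesgue_integral_def by simp
      then show ?thesis using V_nonneg[OF life(3)[OF life(1) order_refl]] unfolding Y_def \<theta>_def by simp
    qed
    ultimately show ?thesis by auto
  qed
  \<comment> \<open>Chosen so that \<open>((V x)\<^sup>2 + L) / (4 * a) \<le> \<epsilon>\<close>,
    which is the cost of truncating at \<open>- a\<close>; the summand 1 keeps \<open>a\<close>
    positive.\<close>
  define a where "a = ((V x)\<^sup>2 + L + 1) / (4 * \<epsilon>)"
  have a: "0 < a" unfolding a_def using \<epsilon> L by (intro divide_pos_pos add_nonneg_pos add_nonneg_nonneg) auto
  define Z where "Z n \<omega> = ennreal (max (V x + S n \<omega>) (- a) + a)" for n \<omega>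
  have Z_m [measurable]: "Z n \<in> borel_measurable M" for n unfolding Z_def[abs_def] using S(1) by measurable
  have Z_int: "(\<integral>\<^sup>+\<omega>. Z n \<omega> \<partial>M) \<le> ennreal (V x + a + \<epsilon>)" for n
  proof -
    let ?w = "\<lambda>\<omega>. V x + S n \<omega>"
    let ?q = "\<lambda>\<omega>. ?w \<omega> + a + (?w \<omega>)\<^sup>2 / (4 * a)"
    have sq: "(?w \<omega>)\<^sup>2 = (V x)\<^sup>2 + 2 * V x * S n \<omega> + (S n \<omega>)\<^sup>2" for \<omega> by (simp add: power2_sum)
    have iq: "integrable M ?q" unfolding sq using S(2,4) by simp
    have q0: "0 \<le> w + a + w\<^sup>2 / (4 * a)" for w
    proof -
      have "w + a + w\<^sup>2 / (4 * a) = (w + 2 * a)\<^sup>2 / (4 * a)"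
        using a by (simp add: field_simps power2_eq_square)
      then show ?thesis using a by simp
    qed
    \<comment> \<open>For \<open>w < - a\<close> the left side is 0 and the right side is the square
      \<open>(w + 2 * a)\<^sup>2 / (4 * a)\<close>; otherwise only a nonnegative quadratic term is
      added.\<close>
    have qmax: "max w (- a) + a \<le> w + a + w\<^sup>2 / (4 * a)" for w
      using q0[of w] a by (auto simp: max_def)
    have "(\<integral>\<^sup>+\<omega>. Z n \<omega> \<partial>M) \<le> (\<integral>\<^sup>+\<omega>. ennreal (?q \<omega>) \<partial>M)"
      unfolding Z_def by (intro nn_integral_mono ennreal_leI qmax)
    also have "\<dots> = ennreal (expectation ?q)"
      by (rule nn_integral_eq_integral[OF iq]) (use q0 in simp)
    also have "expectation ?q = V x + a + ((V x)\<^sup>2 + expectation (\<lambda>\<omega>. (S n \<omega>)\<^sup>2)) / (4 * a)"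
      unfolding sq using S(2,3,4) by (simp add: prob_space)
    also have "\<dots> \<le> V x + a + ((V x)\<^sup>2 + L) / (4 * a)"
      using S(5)[of n] a by (intro add_left_mono divide_right_mono) auto
    also have "((V x)\<^sup>2 + L) / (4 * a) \<le> \<epsilon>"
    proof -
      have "4 * a * \<epsilon> = (V x)\<^sup>2 + L + 1" unfolding a_def using \<epsilon> by simp
      then show ?thesis using a by (simp add: divide_le_eq mult_ac)
    qed
    finally show ?thesis by (simp add: ennreal_leI)
  qed
  \<comment> \<open>Fatou's lemma is applied to the nonnegative \<open>Z n\<close>, which contain a
    shift by \<open>a\<close>; the shift is taken back here.\<close>
  define W where "W \<omega> = liminf (\<lambda>n. Z n \<omega>) - ennreal a" for \<omega>
  have le: "AE \<omega> in M. ennreal (Y \<omega>) + ennreal a \<le> liminf (\<lambda>n. Z n \<omega>)"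
    using AE_regular AE_eventually_not_in[OF A_ev A_prob] AE_space
  proof eventually_elim
    case (elim \<omega>)
    obtain l where Y: "0 \<le> Y \<omega>" and l: "l \<longlonglongrightarrow> Y \<omega>" "eventually (\<lambda>n. l n \<le> V x + S n \<omega>) sequentially"
      using path[OF elim(1,3,2)] by blast
    have "(\<lambda>n. ennreal (l n + a)) \<longlonglongrightarrow> ennreal (Y \<omega> + a)"
      using l(1) by (intro tendsto_intros)
    then have "ennreal (Y \<omega> + a) = liminf (\<lambda>n. ennreal (l n + a))"
      by (rule lim_imp_Liminf[symmetric, rotated]) simp
    also have "\<dots> \<le> liminf (\<lambda>n. Z n \<omega>)"
      unfolding Z_def
      by (rule Liminf_mono) (use l(2) in eventually_elim, auto intro!: ennreal_leI)
    finally show ?case using Y a by simp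
  qed
  show ?thesis
  proof (rule that)
    show "W \<in> borel_measurable M" unfolding W_def[abs_def] by measurable
    have "(\<integral>\<^sup>+\<omega>. W \<omega> \<partial>M) = (\<integral>\<^sup>+\<omega>. liminf (\<lambda>n. Z n \<omega>) \<partial>M) - (\<integral>\<^sup>+\<omega>. ennreal a \<partial>M)"
      unfolding W_def
    proof (rule nn_integral_diff)
      show "AE \<omega> in M. ennreal a \<le> liminf (\<lambda>n. Z n \<omega>)"
        using le by eventually_elim (auto intro: order_trans[rotated])
    qed (auto simp: emeasure_space_1)
    also have "(\<integral>\<^sup>+\<omega>. ennreal a \<partial>M) = ennreal a" by (simp add: emeasure_space_1)
    also have "(\<integral>\<^sup>+\<omega>. liminf (\<lambda>n. Z n \<omega>) \<partial>M) \<le> liminf (\<lambda>n. \<integral>\<^sup>+\<omega>. Z n \<omega> \<partial>M)"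
      by (rule nn_integral_liminf) simp
    also have "\<dots> \<le> liminf (\<lambda>n::nat. ennreal (V x + a + \<epsilon>))"
      by (intro Liminf_mono always_eventually allI Z_int)
    also have "\<dots> = ennreal (V x + a + \<epsilon>)" by (simp add: Liminf_const)
    also have "ennreal (V x + a + \<epsilon>) - ennreal a = ennreal (V x + \<epsilon>)"
      using a by (simp add: ennreal_minus)
    finally show "(\<integral>\<^sup>+\<omega>. W \<omega> \<partial>M) \<le> ennreal (V x + \<epsilon>)" by (simp add: ennreal_minus_mono)
    show "AE \<omega> in M. ennreal (V (X (life K R T \<omega>) \<omega>) -
       (LINT s:{0..life K R T \<omega>}|lborel. g (X s \<omega>) \<bullet> \<beta> s \<omega>)) \<le> W \<omega>"
      using le
    proof eventually_elim
      case (elim \<omega>)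
      then have "ennreal (Y \<omega>) + ennreal a - ennreal a \<le> W \<omega>" unfolding W_def by (rule ennreal_minus_mono) simp
      then show ?case unfolding Y_def by simp
    qed
  qed
qed

section \<open>The function \<open>calB\<close> and the bequest\<close>

definition weight :: "real \<Rightarrow> state \<Rightarrow> real" where
  "weight p = (\<lambda>(F, f, A, v). A + (p - 1) * v)"

definition slope :: "real \<Rightarrow> state \<Rightarrow> real" where
  "slope p x = fst (snd x) / weight p x"

text \<open>The domain is not open, and a path sampled on a grid may step out of it. The wedge is an
  open set around it on which the formula for \<open>calB\<close> and the supergradient inequality
  persist; it also contains the exit points used for the lower bound.\<close>

definition wedge :: "real \<Rightarrow> state set" where
  "wedge p = {x. 0 < fst (snd x) \<and> 0 < weight p x}"

definition calB_grad :: "real \<Rightarrow> state \<Rightarrow> state" where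
  "calB_grad p x = ((p / (p - 1)) powr p,
     - (p powr p / (p - 1) * p * slope p x powr (p - 1)),
     p powr p * slope p x powr p, p powr p * (p - 1) * slope p x powr p)"

lemma weight_continuous [continuous_intros]: "continuous_on S (weight p)"
  unfolding weight_def split_beta' by (intro continuous_intros)

lemma open_wedge: "open (wedge p)"
  unfolding wedge_def
  by (intro open_Collect_conj open_Collect_less continuous_intros)

lemma domain_D_subset_wedge: "1 < p \<Longrightarrow> domain_D p \<subseteq> wedge p"
  by (auto simp: domain_D_def wedge_def weight_def add_pos_pos)

lemma slope_pos: "x \<in> wedge p \<Longrightarrow> 0 < slope p x"
  by (simp add: wedge_def slope_def)

lemma slope_continuous: "continuous_on (wedge p) (slope p)"
  unfolding slope_def[abs_def] by (intro continuous_intros) (auto simp: wedge_def)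

lemma calB_alt:
  "calB p x = (p / (p - 1)) powr p * fst x -
     p powr p / (p - 1) * (fst (snd x) powr p / weight p x powr (p - 1))"
  unfolding calB_def weight_def by (simp split: prod.split)

lemma calB_continuous: "continuous_on (wedge p) (calB p)"
proof -
  have "continuous_on (wedge p) (\<lambda>x. (p / (p - 1)) powr p * fst x -
     p powr p / (p - 1) * (fst (snd x) powr p / weight p x powr (p - 1)))"
    by (intro continuous_intros) (auto simp: wedge_def)
  then show ?thesis by (subst continuous_on_cong[OF refl calB_alt])
qed

lemma calB_grad_continuous: "continuous_on (wedge p) (calB_grad p)"
  unfolding calB_grad_def[abs_def]
  by (intro continuous_intros slope_continuous) (use slope_pos in force)+

text \<open>The tangent to the power function at \<open>l\<close> lies below its graph. It is
  obtained from the weighted arithmetic-geometric mean inequality with weights \<open>1 / p\<close>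
  and \<open>(p - 1) / p\<close>.\<close>

lemma powr_tangent_le:
  fixes p l m :: real
  assumes "1 < p" "0 < l" "0 < m"
  shows "p * l powr (p - 1) * m - (p - 1) * l powr p \<le> m powr p"
proof -
  have "(m powr p) powr (1 / p) * (l powr p) powr ((p - 1) / p) \<le> 1 / p * m powr p + (p - 1) / p * l powr p"
    by (rule Youngs_inequality_0) (use assms in \<open>auto simp: field_simps\<close>)
  then have "m * l powr (p - 1) \<le> 1 / p * m powr p + (p - 1) / p * l powr p"
    using assms by (simp add: powr_powr)
  then have "p * (m * l powr (p - 1)) \<le> p * (1 / p * m powr p + (p - 1) / p * l powr p)"
    using assms by (intro mult_left_mono) auto
  also have "\<dots> = m powr p + (p - 1) * l powr p" using assms by (simp add: distrib_left)
  finally show ?thesis by (simp add: mult_ac)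
qed

lemma grad_inner:
  assumes "1 < p"
  shows "calB_grad p x \<bullet> z = (p / (p - 1)) powr p * fst z -
    p powr p / (p - 1) * (p * slope p x powr (p - 1) * fst (snd z) - (p - 1) * slope p x powr p * weight p z)"
  using assms unfolding calB_grad_def weight_def
  by (cases z) (simp add: inner_Pair field_simps)

text \<open>The perspective \<open>f\<^sup>p / w\<^bsup>p-1\<^esup>\<close> of a power is 1-homogeneous and convex, so its tangent planes pass through the origin.\<close>

lemma perspective_powr:
  fixes p f w :: real
  assumes "1 < p" "0 < f" "0 < w"
  shows "f powr p / w powr (p - 1) = w * (f / w) powr p"
  using assms by (simp add: powr_divide powr_diff)

text \<open>Euler's identity for a function homogeneous of degree one.\<close>

lemma calB_eq_grad:
  assumes p: "1 < p" and x: "x \<in> wedge p"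
  shows "calB p x = calB_grad p x \<bullet> x"
proof -
  have x0: "0 < fst (snd x)" "0 < weight p x" using x by (auto simp: wedge_def)
  have l: "slope p x powr (p - 1) * fst (snd x) = slope p x powr p * weight p x"
  proof -
    have "slope p x powr p = slope p x powr (p - 1) * slope p x"
      using powr_add[of "slope p x" "p - 1" 1] slope_pos[OF x] by simp
    then show ?thesis using x0 by (simp add: slope_def)
  qed
  have "fst (snd x) powr p / weight p x powr (p - 1) = weight p x * slope p x powr p"
    unfolding slope_def by (rule perspective_powr[OF p x0])
  also have "\<dots> = p * (slope p x powr (p - 1) * fst (snd x)) - (p - 1) * slope p x powr p * weight p x"
    unfolding l by (simp add: algebra_simps)
  finally show ?thesis unfolding grad_inner[OF p] calB_alt by (simp add: mult.assoc)
qed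

text \<open>By Euler's identity it remains to show
  \<open>calB p z \<le> calB_grad p x \<bullet> z\<close>. This is the tangent inequality for the
  p-th power between the slopes at \<open>x\<close> and \<open>z\<close>, multiplied by the weight
  of \<open>z\<close>.\<close>

lemma calB_supergradient:
  assumes p: "1 < p" and x: "x \<in> wedge p" and z: "z \<in> wedge p"
  shows "calB p z \<le> calB p x + calB_grad p x \<bullet> (z - x)"
proof -
  have z0: "0 < fst (snd z)" "0 < weight p z" using z by (auto simp: wedge_def)
  have "weight p z * (p * slope p x powr (p - 1) * slope p z - (p - 1) * slope p x powr p) \<le>
    weight p z * slope p z powr p"
    using powr_tangent_le[OF p slope_pos[OF x] slope_pos[OF z]] z0 by (intro mult_left_mono) auto
  also have "\<dots> = fst (snd z) powr p / weight p z powr (p - 1)"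
    unfolding slope_def by (rule perspective_powr[OF p z0, symmetric])
  also have "weight p z * (p * slope p x powr (p - 1) * slope p z - (p - 1) * slope p x powr p) =
    p * slope p x powr (p - 1) * fst (snd z) - (p - 1) * slope p x powr p * weight p z"
    using z0 by (simp add: slope_def[of p z] algebra_simps)
  finally have "calB p z \<le> calB_grad p x \<bullet> z"
    unfolding calB_alt grad_inner[OF p] using p by (intro diff_left_mono mult_left_mono) auto
  then show ?thesis using calB_eq_grad[OF p x] by (simp add: inner_diff_right)
qed

lemma grad_drift:
  assumes "1 < p"
  shows "calB_grad p x \<bullet> drift u y = - payoff_density p u x"
  unfolding calB_grad_def drift_def payoff_density_def slope_def weight_def
  by (cases u, cases x) (simp add: inner_Pair)

text \<open>Dropping \<open>A\<close> from the weight and inserting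
  \<open>f powr p \<le> F * v powr (p - 1)\<close> cancels the powers of \<open>v\<close>, and the
  constant left over is exactly \<open>(p / (p - 1)) powr p\<close>.\<close>

lemma calB_nonneg:
  assumes p: "1 < p" and x: "x \<in> domain_D p"
  shows "0 \<le> calB p x"
proof -
  obtain F f A v where x_eq: "x = (F, f, A, v)" by (cases x)
  have D: "0 < F" "0 < f" "0 < A" "0 < v" "f powr p \<le> F * v powr (p - 1)"
    using x by (auto simp: domain_D_def x_eq)
  have "(p - 1) * v \<le> A + (p - 1) * v" using D by simp
  then have le: "((p - 1) * v) powr (p - 1) \<le> (A + (p - 1) * v) powr (p - 1)"
    using D p by (intro powr_mono2) auto
  have "f powr p / (A + (p - 1) * v) powr (p - 1) \<le> (F * v powr (p - 1)) / ((p - 1) * v) powr (p - 1)"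
    using D p le by (intro frac_le) auto
  also have "\<dots> = F / (p - 1) powr (p - 1)"
    using D p by (simp add: powr_mult)
  finally have "p powr p / (p - 1) * (f powr p / (A + (p - 1) * v) powr (p - 1)) \<le>
    p powr p / (p - 1) * (F / (p - 1) powr (p - 1))"
    using p by (intro mult_left_mono) auto
  also have "\<dots> = (p / (p - 1)) powr p * F"
  proof -
    have "(p - 1) * (p - 1) powr (p - 1) = (p - 1) powr p"
      using powr_add[of "p - 1" 1 "p - 1"] p by simp
    then show ?thesis using p by (simp add: powr_divide mult.assoc[symmetric])
  qed
  finally show ?thesis by (simp add: calB_def x_eq)
qed

section \<open>Compact exhaustion of the domain and the bequest\<close>

definition exhaustion :: "real \<Rightarrow> nat \<Rightarrow> state set" where
  "exhaustion p n = {x \<in> domain_D p. 1 / real (Suc n) \<le> fst x \<and> 1 / real (Suc n) \<le> fst (snd x) \<and>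
     1 / real (Suc n) \<le> fst (snd (snd x)) \<and> norm x \<le> real n}"

lemma exhaustion_subset: "exhaustion p n \<subseteq> domain_D p"
  by (auto simp: exhaustion_def)

text \<open>With \<open>F\<close>, \<open>f\<close> and \<open>A\<close> kept away from 0 the strict
  inequalities of the domain become closed conditions; the lower bound for \<open>v\<close> comes
  from \<open>v \<ge> A\<close>.\<close>

lemma compact_exhaustion:
  assumes p: "1 < p"
  shows "compact (exhaustion p n)"
proof -
  define \<delta> where "\<delta> = 1 / real (Suc n)"
  have \<delta>: "0 < \<delta>" by (simp add: \<delta>_def)
  define Q where "Q = {x :: state. \<delta> \<le> fst x \<and> \<delta> \<le> fst (snd x) \<and> \<delta> \<le> fst (snd (snd x)) \<and>
    fst (snd (snd x)) \<le> snd (snd (snd x)) \<and> norm x \<le> real n}"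
  have Q: "closed Q" unfolding Q_def
    by (intro closed_Collect_conj closed_Collect_le continuous_intros)
  have "exhaustion p n = {x \<in> Q. fst (snd x) powr p \<le> fst x * snd (snd (snd x)) powr (p - 1)}"
    using \<delta> unfolding exhaustion_def Q_def domain_D_def \<delta>_def[symmetric] by (auto split: prod.splits)
  also have "closed \<dots>"
    by (rule continuous_on_closed_Collect_le[OF _ _ Q]; intro continuous_intros)
      (use \<delta> in \<open>auto simp: Q_def\<close>)
  finally have "closed (exhaustion p n)" .
  moreover have "bounded (exhaustion p n)"
    unfolding bounded_iff exhaustion_def by auto
  ultimately show ?thesis by (simp add: compact_eq_bounded_closed)
qed

text \<open>On a compact time interval the least of \<open>F\<close>, \<open>f\<close> and
  \<open>A\<close> attains a positive minimum along the path, and the norm is bounded.\<close>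

lemma path_in_exhaustion:
  fixes X :: "real \<Rightarrow> state"
  assumes X: "continuous_on {0..t} X" "\<And>s. 0 \<le> s \<Longrightarrow> s \<le> t \<Longrightarrow> X s \<in> domain_D p" and "0 \<le> t"
  obtains n0 where "\<And>n s. n0 \<le> n \<Longrightarrow> 0 \<le> s \<Longrightarrow> s \<le> t \<Longrightarrow> X s \<in> exhaustion p n"
proof -
  define h where "h x = min (fst x) (min (fst (snd x)) (fst (snd (snd x))))" for x :: state
  have "continuous_on {0..t} (\<lambda>s. h (X s))"
    unfolding h_def using X(1) by (intro continuous_intros)
  then obtain s0 where s0: "s0 \<in> {0..t}" "\<And>s. s \<in> {0..t} \<Longrightarrow> h (X s0) \<le> h (X s)"
    using continuous_attains_inf[of "{0..t}" "\<lambda>s. h (X s)"] \<open>0 \<le> t\<close> by auto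
  have pos: "0 < h (X s0)" using X(2)[of s0] s0(1) by (auto simp: h_def domain_D_def split: prod.splits)
  have "bounded (X ` {0..t})" using X(1) by (intro compact_imp_bounded compact_continuous_image) auto
  then obtain C where C: "\<And>s. s \<in> {0..t} \<Longrightarrow> norm (X s) \<le> C"
    unfolding bounded_iff by (metis imageI)
  obtain n1 where n1: "1 / real (Suc n1) < h (X s0)" using nat_approx_posE[OF pos] by blast
  obtain n2 :: nat where n2: "C \<le> real n2" using real_arch_simple by blast
  show ?thesis
  proof (rule that[of "max n1 n2"])
    fix n s assume n: "max n1 n2 \<le> n" and s: "0 \<le> s" "s \<le> t"
    have "1 / real (Suc n) \<le> 1 / real (Suc n1)" using n by (intro divide_left_mono) auto
    then have "1 / real (Suc n) \<le> h (X s)" using n1 s0(2)[of s] s by simp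
    moreover have "norm (X s) \<le> real n" using C[of s] s n n2 by simp
    ultimately show "X s \<in> exhaustion p n"
      using X(2)[OF s] unfolding exhaustion_def h_def by simp
  qed
qed

text \<open>Equality holds by continuity at accumulation points of the domain. Elsewhere the lower
  limit is taken along the trivial filter and equals \<infinity>.\<close>

lemma calB_le_bequest:
  assumes z: "z \<in> wedge p"
  shows "ereal (calB p z) \<le> bequest p z"
proof (cases "at z within domain_D p = bot")
  case True
  show ?thesis unfolding bequest_def Liminf_def True
    by (rule SUP_upper2[of "\<lambda>_. False"]) simp_all
next
  case False
  have "isCont (calB p) z"
    using calB_continuous open_wedge z by (simp add: continuous_on_eq_continuous_at)
  then have "(calB p \<longlongrightarrow> calB p z) (at z within domain_D p)"
    unfolding isCont_def by (rule tendsto_within_subset) simp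
  then have "((\<lambda>y. ereal (calB p y)) \<longlongrightarrow> ereal (calB p z)) (at z within domain_D p)" by simp
  from lim_imp_Liminf[OF False this] show ?thesis by (simp add: bequest_def)
qed

text \<open>\<open>F\<close> may be increased without leaving the domain.\<close>

lemma at_within_domain_D_nontrivial:
  assumes z: "z \<in> domain_D p"
  shows "at z within domain_D p \<noteq> bot"
proof -
  obtain F f A v where z_eq: "z = (F, f, A, v)" by (cases z)
  have "\<exists>y\<in>domain_D p. y \<noteq> z \<and> dist y z < e" if "0 < e" for e
  proof (rule bexI[of _ "(F + e / 2, f, A, v)"])
    show "(F + e / 2, f, A, v) \<noteq> z \<and> dist (F + e / 2, f, A, v) z < e"
      using that by (simp add: z_eq dist_Pair_Pair dist_real_def)
    have "F * v powr (p - 1) \<le> (F + e / 2) * v powr (p - 1)" using that by (intro mult_right_mono) auto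
    moreover have "f powr p \<le> F * v powr (p - 1)" using z by (simp add: z_eq domain_D_def)
    ultimately have "f powr p \<le> (F + e / 2) * v powr (p - 1)" by simp
    then show "(F + e / 2, f, A, v) \<in> domain_D p"
      using z that by (auto simp: z_eq domain_D_def)
  qed
  then show ?thesis by (simp add: trivial_limit_within islimpt_approachable)
qed

text \<open>The lower limit defining \<open>bequest\<close> omits the point \<open>z\<close> itself,
  whereas \<open>y\<close> may take the value \<open>z\<close>. Inside the domain continuity of
  \<open>calB\<close> settles this; outside it \<open>y\<close> avoids \<open>z\<close>.\<close>

lemma bequest_le_liminf:
  assumes p: "1 < p" and y: "\<And>n. y n \<in> domain_D p" "y \<longlonglongrightarrow> z"
  shows "bequest p z \<le> liminf (\<lambda>n. ereal (calB p (y n)))"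
proof (cases "z \<in> domain_D p")
  case True
  then have z: "z \<in> wedge p" using domain_D_subset_wedge[OF p] by blast
  have cont: "isCont (calB p) z"
    using calB_continuous open_wedge z by (simp add: continuous_on_eq_continuous_at)
  then have "(calB p \<longlongrightarrow> calB p z) (at z within domain_D p)"
    unfolding isCont_def by (rule tendsto_within_subset) simp
  then have "((\<lambda>y. ereal (calB p y)) \<longlongrightarrow> ereal (calB p z)) (at z within domain_D p)" by simp
  from lim_imp_Liminf[OF at_within_domain_D_nontrivial[OF True] this]
  have "bequest p z = ereal (calB p z)" by (simp add: bequest_def)
  moreover have "(\<lambda>n. ereal (calB p (y n))) \<longlonglongrightarrow> ereal (calB p z)"
    using isCont_tendsto_compose[OF cont y(2)] by simp
  then have "liminf (\<lambda>n. ereal (calB p (y n))) = ereal (calB p z)" by (intro lim_imp_Liminf) simp_all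
  ultimately show ?thesis by simp
next
  case False
  then have "filterlim y (at z within domain_D p) sequentially"
    using y by (auto simp: filterlim_at intro!: always_eventually)
  then have ev: "eventually (\<lambda>n. P (y n)) sequentially" if "eventually P (at z within domain_D p)" for P
    using that by (simp add: filterlim_iff)
  show ?thesis unfolding bequest_def Liminf_def[of "at z within domain_D p"]
  proof (rule SUP_least)
    fix P assume "P \<in> {P. eventually P (at z within domain_D p)}"
    then have "eventually (\<lambda>n. P (y n)) sequentially" using ev by simp
    then have "eventually (\<lambda>n. (INF w\<in>Collect P. ereal (calB p w)) \<le> ereal (calB p (y n))) sequentially"
      by eventually_elim (auto intro: INF_lower)
    then show "(INF w\<in>Collect P. ereal (calB p w)) \<le> liminf (\<lambda>n. ereal (calB p (y n)))"
      by (rule Liminf_bounded)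
  qed
qed

section \<open>The value function\<close>

lemma ennreal_liminf_add:
  fixes a b :: "nat \<Rightarrow> ennreal"
  shows "liminf a + liminf b \<le> liminf (\<lambda>n. a n + b n)"
  unfolding liminf_SUP_INF
proof (subst ennreal_SUP_add[symmetric])
  show "incseq (\<lambda>n. INF m\<in>{n..}. a m)" "incseq (\<lambda>n. INF m\<in>{n..}. b m)"
    by (auto intro!: incseq_SucI INF_superset_mono)
  show "(SUP n. (INF m\<in>{n..}. a m) + (INF m\<in>{n..}. b m)) \<le> (SUP n. INF m\<in>{n..}. a m + b m)"
    by (intro SUP_mono bexI INF_greatest add_mono INF_lower) auto
qed

text \<open>Positive parts are subadditive; \<open>b\<close> may be negative or infinite, as a
  bequest may be a priori.\<close>

lemma e2ennreal_add_le: "e2ennreal (enn2ereal a + b) \<le> a + e2ennreal b"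
proof (cases "0 \<le> b")
  case True
  then have "enn2ereal a + b = enn2ereal (a + e2ennreal b)"
    by (simp add: plus_ennreal.rep_eq enn2ereal_e2ennreal)
  then show ?thesis by simp
next
  case False
  then have "enn2ereal a + b \<le> enn2ereal a + 0" by (intro add_left_mono) simp
  then have "e2ennreal (enn2ereal a + b) \<le> e2ennreal (enn2ereal a)" by (intro e2ennreal_mono) simp
  then show ?thesis by (simp add: add_increasing2)
qed

lemma set_integrable_inner_continuous:
  fixes h \<beta> :: "real \<Rightarrow> 'a::euclidean_space"
  assumes h: "continuous_on {0..t} h" and \<beta>: "set_integrable lborel {0..t} \<beta>"
  shows "set_integrable lborel {0..t} (\<lambda>s. h s \<bullet> \<beta> s)"
proof -
  have "compact (h ` {0..t})" using h by (intro compact_continuous_image) auto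
  then obtain C where C: "\<And>s. s \<in> {0..t} \<Longrightarrow> norm (h s) \<le> C"
    using compact_imp_bounded bounded_iff by (metis imageI)
  have [measurable]: "(\<lambda>s. indicator {0..t} s *\<^sub>R \<beta> s) \<in> borel_measurable lborel"
    "(\<lambda>s. indicator {0..t} s *\<^sub>R h s) \<in> borel_measurable borel"
    using \<beta> h by (auto simp: set_integrable_def intro!: borel_measurable_continuous_on_indicator)
  have eq: "(\<lambda>s. indicator {0..t} s *\<^sub>R (h s \<bullet> \<beta> s)) =
    (\<lambda>s. (indicator {0..t} s *\<^sub>R h s) \<bullet> (indicator {0..t} s *\<^sub>R \<beta> s))"
    by (auto simp: indicator_def)
  show ?thesis unfolding set_integrable_def
  proof (rule Bochner_Integration.integrable_bound)
    show "integrable lborel (\<lambda>s. C * norm (indicator {0..t} s *\<^sub>R \<beta> s))"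
      using \<beta> unfolding set_integrable_def by (intro integrable_mult_right integrable_norm)
    show "(\<lambda>s. indicator {0..t} s *\<^sub>R (h s \<bullet> \<beta> s)) \<in> borel_measurable lborel"
      unfolding eq by measurable
    show "AE s in lborel. norm (indicator {0..t} s *\<^sub>R (h s \<bullet> \<beta> s)) \<le> norm (C * norm (indicator {0..t} s *\<^sub>R \<beta> s))"
    proof (rule AE_I2)
      fix s
      show "norm (indicator {0..t} s *\<^sub>R (h s \<bullet> \<beta> s)) \<le> norm (C * norm (indicator {0..t} s *\<^sub>R \<beta> s))"
      proof (cases "s \<in> {0..t}")
        case True
        have "\<bar>h s \<bullet> \<beta> s\<bar> \<le> \<bar>C\<bar> * norm (\<beta> s)"
          using C[OF True] by (intro order_trans[OF Cauchy_Schwarz_ineq2 mult_right_mono]) auto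
        then show ?thesis using True by (simp add: abs_mult)
      qed simp
    qed
  qed
qed

section \<open>The upper bound\<close>

lemma drift_eq: "drift u y = (0, 0, - snd (snd (snd (snd u))), 0)"
  by (simp add: drift_def split: prod.split)

lemma diffusion_eq: "diffusion u y = (fst u, fst (snd u), fst (snd (snd u)), fst (snd (snd (snd u))))"
  by (simp add: diffusion_def split: prod.split)

lemma payoff_density_nonneg: "u \<in> control_set \<Longrightarrow> 0 \<le> payoff_density p u y"
  by (auto simp: payoff_density_def control_set_def split: prod.split)

lemma ext_integral_nonneg:
  assumes "\<And>s. s \<in> space N \<Longrightarrow> 0 \<le> f s"
  shows "ext_integral N (\<lambda>s. ereal (f s)) = enn2ereal (\<integral>\<^sup>+s. ennreal (f s) \<partial>N)"
proof -
  have "(\<integral>\<^sup>+s. e2ennreal (- ereal (f s)) \<partial>N) = (\<integral>\<^sup>+s. 0 \<partial>N)"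
    by (rule nn_integral_cong) (use assms in \<open>auto intro!: ennreal_neg\<close>)
  then show ?thesis unfolding ext_integral_def by (simp add: zero_ennreal.rep_eq)
qed

context brownian_motion
begin

text \<open>\<open>drift\<close> and \<open>diffusion\<close> are functions of the control alone, so
  an adapted control makes the coefficients adapted before anything is known about
  \<open>X\<close>.\<close>

lemma controlled_ito_process:
  assumes u: "u \<in> controls M B control_set" and X: "solves M B drift diffusion x u X"
  shows "ito_process M B x (\<lambda>s \<omega>. drift (u s \<omega>) (X s \<omega>)) (\<lambda>s \<omega>. diffusion (u s \<omega>) (X s \<omega>)) X"
proof
  have m: "(\<lambda>u. (0, 0, - snd (snd (snd (snd u))), 0) :: state) \<in> borel_measurable (borel :: control measure)"
    "(\<lambda>u. (fst u, fst (snd u), fst (snd (snd u)), fst (snd (snd (snd u)))) :: state) \<in> borel_measurable (borel :: control measure)"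
    by (intro borel_measurable_continuous_onI continuous_intros)+
  have joint: "(\<lambda>(s, \<omega>). u s \<omega>) \<in> borel_measurable (restrict_space borel {0..} \<Otimes>\<^sub>M M)"
    and ad: "\<And>s. 0 \<le> s \<Longrightarrow> u s \<in> borel_measurable (\<G> s)"
    using u by (auto simp: controls_def intro: measurable_naturalD)
  show "AE \<omega> in M. continuous_on {0..} (\<lambda>t. X t \<omega>)"
    "AE \<omega> in M. \<forall>t\<ge>0. set_integrable lborel {0..t} (\<lambda>s. drift (u s \<omega>) (X s \<omega>)) \<and>
      set_integrable lborel {0..t} (\<lambda>s. (norm (diffusion (u s \<omega>) (X s \<omega>)))\<^sup>2)"
    "\<And>t. 0 \<le> t \<Longrightarrow> X t \<in> borel_measurable M"
    "\<And>t. 0 \<le> t \<Longrightarrow> has_ito_integral M B (\<lambda>s \<omega>. diffusion (u s \<omega>) (X s \<omega>)) t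
       (\<lambda>\<omega>. X t \<omega> - x - (LINT s:{0..t}|lborel. drift (u s \<omega>) (X s \<omega>)))"
    using X by (auto simp: solves_def)
  show "(\<lambda>(s, \<omega>). drift (u s \<omega>) (X s \<omega>)) \<in> borel_measurable (restrict_space borel {0..} \<Otimes>\<^sub>M M)"
    "(\<lambda>(s, \<omega>). diffusion (u s \<omega>) (X s \<omega>)) \<in> borel_measurable (restrict_space borel {0..} \<Otimes>\<^sub>M M)"
    using measurable_compose[OF joint m(1)] measurable_compose[OF joint m(2)]
    unfolding drift_eq diffusion_eq by (simp_all add: split_beta')
  show "(\<lambda>\<omega>. drift (u s \<omega>) (X s \<omega>)) \<in> borel_measurable (\<G> s)"
    "(\<lambda>\<omega>. diffusion (u s \<omega>) (X s \<omega>)) \<in> borel_measurable (\<G> s)" if "0 \<le> s" for s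
    using measurable_compose[OF ad[OF that] m(1)] measurable_compose[OF ad[OF that] m(2)]
    unfolding drift_eq diffusion_eq by simp_all
qed

text \<open>The verification inequality is used on each member of the exhaustion. The limit is first
  taken path by path, with Fatou's lemma in time for the payoff and \<open>bequest_le_liminf\<close>
  for the end value, and then in expectation by Fatou's lemma again. Discarding the negative part of
  the total only enlarges the performance.\<close>

lemma performance_le_calB:
  assumes p: "1 < p" and x: "x \<in> domain_D p"
    and u: "u \<in> controls M B control_set" and X: "solves M B drift diffusion x u X"
  shows "performance M (payoff_density p) (bequest p) (domain_D p) u X \<le> ereal (calB p x)"
proof -
  interpret I: ito_process M B x "\<lambda>s \<omega>. drift (u s \<omega>) (X s \<omega>)" "\<lambda>s \<omega>. diffusion (u s \<omega>) (X s \<omega>)" X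
    by (rule controlled_ito_process[OF u X])
  let ?K = "exhaustion p" and ?\<eta> = "\<lambda>s \<omega>. payoff_density p (u s \<omega>) (X s \<omega>)"
  note K_D = exhaustion_subset[of p] and D_W = domain_D_subset_wedge[OF p]
  have \<eta>0: "0 \<le> ?\<eta> s \<omega>" if "0 \<le> s" "\<omega> \<in> space M" for s \<omega>
    using u that by (intro payoff_density_nonneg) (auto simp: controls_def)
  obtain n0 where n0: "\<And>n. n0 \<le> n \<Longrightarrow> x \<in> ?K n"
    using path_in_exhaustion[of 0 "\<lambda>_. x" p] x by (metis continuous_on_const order_refl)
  \<comment> \<open>Set, quadratic variation and horizon are relaxed by the same index; the shift by
    \<open>n0\<close> keeps \<open>x\<close> inside every set.\<close>
  define \<theta> where "\<theta> n = I.life (?K (n0 + n)) (real n) (real (Suc n))" for n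
  define Y where "Y n \<omega> = calB p (X (\<theta> n \<omega>) \<omega>) -
    (LINT s:{0..\<theta> n \<omega>}|lborel. calB_grad p (X s \<omega>) \<bullet> drift (u s \<omega>) (X s \<omega>))" for n \<omega>
  have "\<exists>W. W \<in> borel_measurable M \<and> (\<integral>\<^sup>+\<omega>. W \<omega> \<partial>M) \<le> ennreal (calB p x + 1 / real (Suc n)) \<and>
    (AE \<omega> in M. ennreal (Y n \<omega>) \<le> W \<omega>)" for n
  proof (rule I.verification[of "?K (n0 + n)" "wedge p" "calB p" "calB_grad p" "real (Suc n)" "real n" "1 / real (Suc n)"])
    show "compact (?K (n0 + n))" by (rule compact_exhaustion[OF p])
    show "x \<in> ?K (n0 + n)" by (rule n0) simp
    show "?K (n0 + n) \<subseteq> wedge p" using K_D D_W by blast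
    show "continuous_on (?K (n0 + n)) (calB_grad p)"
      using K_D D_W by (intro continuous_on_subset[OF calB_grad_continuous]) blast
    show "calB p z \<le> calB p y + calB_grad p y \<bullet> (z - y)" if "y \<in> ?K (n0 + n)" "z \<in> wedge p" for y z
      using calB_supergradient[OF p _ that(2)] that(1) K_D D_W by blast
    show "0 \<le> calB p y" if "y \<in> ?K (n0 + n)" for y using calB_nonneg[OF p] that K_D by blast
    show "calB_grad p y \<bullet> drift (u s \<omega>) (X s \<omega>) \<le> 0" if "y \<in> ?K (n0 + n)" "0 \<le> s" "\<omega> \<in> space M" for y s \<omega>
      using payoff_density_nonneg[of "u s \<omega>" p y] u that unfolding grad_drift[OF p] by (auto simp: controls_def)
    show "open (wedge p)" by (rule open_wedge)
    show "continuous_on (wedge p) (calB p)" by (rule calB_continuous)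
    fix W assume "W \<in> borel_measurable M" "(\<integral>\<^sup>+\<omega>. W \<omega> \<partial>M) \<le> ennreal (calB p x + 1 / real (Suc n))"
      "AE \<omega> in M. ennreal (calB p (X (I.life (?K (n0 + n)) (real n) (real (Suc n)) \<omega>) \<omega>) -
        (LINT s:{0..I.life (?K (n0 + n)) (real n) (real (Suc n)) \<omega>}|lborel.
          calB_grad p (X s \<omega>) \<bullet> drift (u s \<omega>) (X s \<omega>))) \<le> W \<omega>"
    then show ?thesis unfolding Y_def \<theta>_def by blast
  qed simp_all
  then obtain W where W: "\<And>n. W n \<in> borel_measurable M"
    "\<And>n. (\<integral>\<^sup>+\<omega>. W n \<omega> \<partial>M) \<le> ennreal (calB p x + 1 / real (Suc n))"
    "\<And>n. AE \<omega> in M. ennreal (Y n \<omega>) \<le> W n \<omega>" by metis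
  define \<tau> where "\<tau> = exit_time (domain_D p) X"
  define total where "total \<omega> = ext_integral (restrict_space lborel {s. 0 \<le> s \<and> ereal s < \<tau> \<omega>}) (\<lambda>s. ereal (?\<eta> s \<omega>)) +
    (if \<tau> \<omega> < \<infinity> then bequest p (X (real_of_ereal (\<tau> \<omega>)) \<omega>) else 0)" for \<omega>
  have path: "e2ennreal (total \<omega>) \<le> liminf (\<lambda>n. ennreal (Y n \<omega>))" if \<omega>: "I.regular \<omega>" "\<omega> \<in> space M" for \<omega>
  proof -
    define S where "S = {s. 0 \<le> s \<and> ereal s < \<tau> \<omega>}"
    have cX: "continuous_on {0..} (\<lambda>t. X t \<omega>)" and X0: "X 0 \<omega> = x"
      using \<omega>(1) by (auto simp: I.regular_def)
    note life = I.life_props[OF \<omega>(1) compact_imp_closed[OF compact_exhaustion[OF p]] n0[OF le_add1]]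
    have \<theta>0: "0 \<le> \<theta> n \<omega>" for n unfolding \<theta>_def
      by (rule life(1)) auto
    have \<theta>K: "X s \<omega> \<in> ?K (n0 + n)" if "0 \<le> s" "s \<le> \<theta> n \<omega>" for s n
      using that unfolding \<theta>_def
      by (intro life(3)) auto
    have \<theta>_ge: "t \<le> \<theta> n \<omega>" if "0 \<le> t" "t \<le> real (Suc n)" "\<And>s. 0 \<le> s \<Longrightarrow> s \<le> t \<Longrightarrow> X s \<omega> \<in> ?K (n0 + n)"
      "I.qv t \<omega> \<le> real n" for t n
      unfolding \<theta>_def using that
      by (intro life(6)) auto
    \<comment> \<open>\<open>exit_time\<close> looks at positive times only, so time 0 is settled by
      the starting point.\<close>
    have before: "X s \<omega> \<in> domain_D p" if "s \<in> S" for s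
    proof (rule ccontr)
      assume "X s \<omega> \<notin> domain_D p"
      moreover have "s \<noteq> 0" using calculation X0 x by auto
      ultimately have "\<tau> \<omega> \<le> ereal s"
        using that unfolding \<tau>_def exit_time_def S_def by (intro Inf_lower) auto
      then show False using that by (auto simp: S_def dest: leD)
    qed
    have \<theta>_le: "ereal (\<theta> n \<omega>) \<le> \<tau> \<omega>" for n
      unfolding \<tau>_def exit_time_def
    proof (rule Inf_greatest, clarify)
      fix s :: real assume "0 < s" "X s \<omega> \<notin> domain_D p"
      then have "\<not> s \<le> \<theta> n \<omega>" using \<theta>K[of s n] K_D by auto
      then show "ereal (\<theta> n \<omega>) \<le> ereal s" by simp
    qed
    \<comment> \<open>Up to a time before exit the path is a compact subset of the domain, so for
      large \<open>n\<close> the set, the horizon and the bound on \<open>qv\<close> all leave it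
      room.\<close>
    have \<theta>_ev: "eventually (\<lambda>n. t \<le> \<theta> n \<omega>) sequentially" if "t \<in> S" for t
    proof -
      have t: "0 \<le> t" "ereal t < \<tau> \<omega>" using that by (auto simp: S_def)
      have D: "X s \<omega> \<in> domain_D p" if "0 \<le> s" "s \<le> t" for s
        using that le_less_trans[of "ereal s" "ereal t" "\<tau> \<omega>"] t by (intro before) (simp add: S_def)
      obtain n1 where n1: "\<And>n s. n1 \<le> n \<Longrightarrow> 0 \<le> s \<Longrightarrow> s \<le> t \<Longrightarrow> X s \<omega> \<in> ?K n"
        using path_in_exhaustion[of t "\<lambda>s. X s \<omega>" p] D t continuous_on_subset[OF cX, of "{0..t}"] by force
      obtain n2 :: nat where n2: "max t (I.qv t \<omega>) \<le> real n2" using real_arch_simple by blast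
      have "t \<le> \<theta> n \<omega>" if "max n1 n2 \<le> n" for n
        using that n1 n2 t by (intro \<theta>_ge) auto
      then show ?thesis unfolding eventually_sequentially by blast
    qed
    have S_meas: "S \<in> sets borel"
    proof (cases "\<tau> \<omega>")
      case (real r)
      then have "S = {0..<r}" by (auto simp: S_def)
      then show ?thesis by simp
    next
      case PInf
      then have "S = {0..}" by (auto simp: S_def)
      then show ?thesis by simp
    next
      case MInf
      then have "S = {}" by (auto simp: S_def)
      then show ?thesis by simp
    qed
    define P where "P n = (\<integral>\<^sup>+s. ennreal (?\<eta> s \<omega>) * indicator {0..\<theta> n \<omega>} s \<partial>lborel)" for n
    have int: "set_integrable lborel {0..\<theta> n \<omega>} (\<lambda>s. calB_grad p (X s \<omega>) \<bullet> drift (u s \<omega>) (X s \<omega>))" for n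
    proof (rule set_integrable_inner_continuous)
      show "continuous_on {0..\<theta> n \<omega>} (\<lambda>s. calB_grad p (X s \<omega>))"
        using \<theta>K[of _ n] K_D D_W
        by (intro continuous_on_compose2[OF calB_grad_continuous] continuous_on_subset[OF cX]) fastforce+
      show "set_integrable lborel {0..\<theta> n \<omega>} (\<lambda>s. drift (u s \<omega>) (X s \<omega>))"
        using \<omega>(1) \<theta>0 by (auto simp: I.regular_def)
    qed
    then have int\<eta>: "integrable lborel (\<lambda>s. indicator {0..\<theta> n \<omega>} s *\<^sub>R ?\<eta> s \<omega>)" for n
      using integrable_minus[OF int[unfolded set_integrable_def], of n] unfolding grad_drift[OF p] by simp
    have P_meas: "(\<lambda>s. ennreal (?\<eta> s \<omega>) * indicator {0..\<theta> n \<omega>} s) \<in> borel_measurable lborel" for n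
    proof -
      have "(\<lambda>s. ennreal (indicator {0..\<theta> n \<omega>} s *\<^sub>R ?\<eta> s \<omega>)) \<in> borel_measurable lborel"
        using int\<eta>[of n] by measurable
      moreover have "(\<lambda>s. ennreal (?\<eta> s \<omega>) * indicator {0..\<theta> n \<omega>} s) =
        (\<lambda>s. ennreal (indicator {0..\<theta> n \<omega>} s *\<^sub>R ?\<eta> s \<omega>))" by (auto simp: indicator_def)
      ultimately show ?thesis by simp
    qed
    have P_eq: "P n = ennreal (- (LINT s:{0..\<theta> n \<omega>}|lborel. calB_grad p (X s \<omega>) \<bullet> drift (u s \<omega>) (X s \<omega>)))" for n
    proof -
      have "P n = (\<integral>\<^sup>+s. ennreal (indicator {0..\<theta> n \<omega>} s *\<^sub>R ?\<eta> s \<omega>) \<partial>lborel)"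
        unfolding P_def by (intro nn_integral_cong) (auto simp: indicator_def)
      also have "\<dots> = ennreal (LINT s|lborel. indicator {0..\<theta> n \<omega>} s *\<^sub>R ?\<eta> s \<omega>)"
        by (rule nn_integral_eq_integral[OF int\<eta>]) (use \<eta>0 \<omega>(2) in \<open>auto simp: indicator_def\<close>)
      finally show ?thesis unfolding grad_drift[OF p] set_lebesgue_integral_def by simp
    qed
    have V0: "0 \<le> calB p (X (\<theta> n \<omega>) \<omega>)" for n
      using calB_nonneg[OF p] \<theta>K[OF \<theta>0 order_refl] K_D by blast
    have Y_eq: "ennreal (Y n \<omega>) = P n + ennreal (calB p (X (\<theta> n \<omega>) \<omega>))" for n
    proof -
      have "0 \<le> - (LINT s:{0..\<theta> n \<omega>}|lborel. calB_grad p (X s \<omega>) \<bullet> drift (u s \<omega>) (X s \<omega>))"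
        unfolding grad_drift[OF p] set_lebesgue_integral_def
        by (simp, rule Bochner_Integration.integral_nonneg) (use \<eta>0 \<omega>(2) in \<open>auto simp: indicator_def\<close>)
      then show ?thesis unfolding Y_def P_eq using V0[of n] by (simp add: ennreal_plus[symmetric] del: ennreal_plus)
    qed
    have fatou: "(\<integral>\<^sup>+s. ennreal (?\<eta> s \<omega>) * indicator S s \<partial>lborel) \<le> liminf P"
    proof -
      have "(\<integral>\<^sup>+s. ennreal (?\<eta> s \<omega>) * indicator S s \<partial>lborel) \<le>
        (\<integral>\<^sup>+s. liminf (\<lambda>n. ennreal (?\<eta> s \<omega>) * indicator {0..\<theta> n \<omega>} s) \<partial>lborel)"
      proof (rule nn_integral_mono)
        fix s
        show "ennreal (?\<eta> s \<omega>) * indicator S s \<le> liminf (\<lambda>n. ennreal (?\<eta> s \<omega>) * indicator {0..\<theta> n \<omega>} s)"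
        proof (cases "s \<in> S")
          case True
          then have "0 \<le> s" by (simp add: S_def)
          have "eventually (\<lambda>n. ennreal (?\<eta> s \<omega>) * indicator S s \<le> ennreal (?\<eta> s \<omega>) * indicator {0..\<theta> n \<omega>} s) sequentially"
            using \<theta>_ev[OF True] by eventually_elim (use True \<open>0 \<le> s\<close> in simp)
          then show ?thesis by (rule Liminf_bounded)
        qed simp
      qed
      also have "\<dots> \<le> liminf P" unfolding P_def by (rule nn_integral_liminf[OF P_meas])
      finally show ?thesis .
    qed
    have payoff: "ext_integral (restrict_space lborel S) (\<lambda>s. ereal (?\<eta> s \<omega>)) \<le> enn2ereal (liminf P)"
    proof -
      have "ext_integral (restrict_space lborel S) (\<lambda>s. ereal (?\<eta> s \<omega>)) =
        enn2ereal (\<integral>\<^sup>+s. ennreal (?\<eta> s \<omega>) \<partial>restrict_space lborel S)"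
        by (rule ext_integral_nonneg) (use \<eta>0[OF _ \<omega>(2)] in \<open>simp add: S_def space_restrict_space\<close>)
      also have "(\<integral>\<^sup>+s. ennreal (?\<eta> s \<omega>) \<partial>restrict_space lborel S) = (\<integral>\<^sup>+s. ennreal (?\<eta> s \<omega>) * indicator S s \<partial>lborel)"
        by (rule nn_integral_restrict_space) (use S_meas in simp)
      finally show ?thesis using fatou by (simp add: less_eq_ennreal.rep_eq)
    qed
    \<comment> \<open>If the exit time is finite, the times \<open>\<theta> n \<omega>\<close> tend
      to it, so the states there form a sequence in the domain tending to the exit point. The exit
      point may lie inside or outside the domain, and \<open>bequest_le_liminf\<close> covers
      both.\<close>
    have end_value: "e2ennreal (if \<tau> \<omega> < \<infinity> then bequest p (X (real_of_ereal (\<tau> \<omega>)) \<omega>) else 0) \<le>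
      liminf (\<lambda>n. ennreal (calB p (X (\<theta> n \<omega>) \<omega>)))"
    proof (cases "\<tau> \<omega> < \<infinity>")
      case True
      have "0 \<le> \<tau> \<omega>" using \<theta>_le[of 0] \<theta>0[of 0] by (metis ereal_less_eq(5) order_trans)
      then obtain r where r: "\<tau> \<omega> = ereal r" "0 \<le> r" using True by (cases "\<tau> \<omega>") auto
      have "(\<lambda>n. \<theta> n \<omega>) \<longlonglongrightarrow> r"
      proof (rule order_tendstoI)
        fix a assume "a < r"
        show "eventually (\<lambda>n. a < \<theta> n \<omega>) sequentially"
        \<comment> \<open>Exit may be immediate, with \<open>r = 0\<close>; then no time precedes
          it, and \<open>0 \<le> \<theta> n \<omega>\<close> takes over.\<close>
        proof (cases "0 < r")
          case True
          have "max 0 ((a + r) / 2) \<in> S" using \<open>a < r\<close> True r by (auto simp: S_def)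
          from \<theta>_ev[OF this] show ?thesis by eventually_elim (use \<open>a < r\<close> in auto)
        next
          case False
          then have "a < 0" using \<open>a < r\<close> by simp
          then show ?thesis using \<theta>0 less_le_trans by (intro always_eventually) blast
        qed
      next
        fix a assume "r < a"
        have "\<theta> n \<omega> \<le> r" for n using \<theta>_le[of n] r by simp
        then show "eventually (\<lambda>n. \<theta> n \<omega> < a) sequentially"
          using \<open>r < a\<close> by (intro always_eventually allI) (rule le_less_trans)
      qed
      then have conv: "(\<lambda>n. X (\<theta> n \<omega>) \<omega>) \<longlonglongrightarrow> X r \<omega>"
        by (rule continuous_on_tendsto_compose[OF cX]) (use r \<theta>0 in auto)
      have "X (\<theta> n \<omega>) \<omega> \<in> domain_D p" for n using \<theta>K[OF \<theta>0 order_refl] K_D by blast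
      then have "bequest p (X r \<omega>) \<le> liminf (\<lambda>n. ereal (calB p (X (\<theta> n \<omega>) \<omega>)))"
        by (rule bequest_le_liminf[OF p _ conv])
      then have "e2ennreal (bequest p (X r \<omega>)) \<le> e2ennreal (liminf (\<lambda>n. ereal (calB p (X (\<theta> n \<omega>) \<omega>))))"
        by (rule e2ennreal_mono)
      also have "\<dots> = liminf (\<lambda>n. e2ennreal (ereal (calB p (X (\<theta> n \<omega>) \<omega>))))"
        by (rule Liminf_compose_continuous_mono[OF continuous_on_e2ennreal, symmetric])
          (auto intro: monoI e2ennreal_mono)
      finally show ?thesis using r by simp
    qed simp
    have "e2ennreal (total \<omega>) \<le> e2ennreal (enn2ereal (liminf P) + (if \<tau> \<omega> < \<infinity> then bequest p (X (real_of_ereal (\<tau> \<omega>)) \<omega>) else 0))"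
      unfolding total_def S_def[symmetric] by (intro e2ennreal_mono add_right_mono payoff)
    also have "\<dots> \<le> liminf P + e2ennreal (if \<tau> \<omega> < \<infinity> then bequest p (X (real_of_ereal (\<tau> \<omega>)) \<omega>) else 0)"
      by (rule e2ennreal_add_le)
    also have "\<dots> \<le> liminf P + liminf (\<lambda>n. ennreal (calB p (X (\<theta> n \<omega>) \<omega>)))"
      by (intro add_left_mono end_value)
    also have "\<dots> \<le> liminf (\<lambda>n. P n + ennreal (calB p (X (\<theta> n \<omega>) \<omega>)))" by (rule ennreal_liminf_add)
    finally show ?thesis unfolding Y_eq .
  qed
  have "AE \<omega> in M. \<forall>n. ennreal (Y n \<omega>) \<le> W n \<omega>" using W(3) by (simp add: AE_all_countable)
  then have "AE \<omega> in M. e2ennreal (total \<omega>) \<le> liminf (\<lambda>n. W n \<omega>)"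
    using I.AE_regular AE_space
  proof eventually_elim
    case (elim \<omega>)
    then show ?case
      by (intro order_trans[OF path] Liminf_mono always_eventually) auto
  qed
  then have "(\<integral>\<^sup>+\<omega>. e2ennreal (total \<omega>) \<partial>M) \<le> (\<integral>\<^sup>+\<omega>. liminf (\<lambda>n. W n \<omega>) \<partial>M)"
    by (rule nn_integral_mono_AE)
  also have "\<dots> \<le> liminf (\<lambda>n. \<integral>\<^sup>+\<omega>. W n \<omega> \<partial>M)" by (rule nn_integral_liminf[OF W(1)])
  also have "\<dots> \<le> liminf (\<lambda>n. ennreal (calB p x + 1 / real (Suc n)))"
    by (intro Liminf_mono always_eventually allI W(2))
  also have "\<dots> = ennreal (calB p x)"
  proof (rule lim_imp_Liminf)
    have "(\<lambda>n. calB p x + 1 / real (Suc n)) \<longlonglongrightarrow> calB p x + 0"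
      by (intro tendsto_add tendsto_const LIMSEQ_Suc[OF lim_const_over_n])
    then show "(\<lambda>n. ennreal (calB p x + 1 / real (Suc n))) \<longlonglongrightarrow> ennreal (calB p x)"
      by (intro tendsto_ennrealI) simp
  qed simp
  finally have le: "enn2ereal (\<integral>\<^sup>+\<omega>. e2ennreal (total \<omega>) \<partial>M) \<le> ereal (calB p x)"
    using calB_nonneg[OF p x] by (simp add: less_eq_ennreal.rep_eq enn2ereal_ennreal)
  have "ext_integral M total \<le> enn2ereal (\<integral>\<^sup>+\<omega>. e2ennreal (total \<omega>) \<partial>M)"
    unfolding ext_integral_def by (rule ereal_diff_le_self) simp
  also note le
  finally show ?thesis unfolding performance_def total_def[abs_def] \<tau>_def .
qed

section \<open>The lower bound\<close>

lemma prob_increment_small: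
  assumes "0 < t" "0 \<le> c"
  shows "prob {\<omega>\<in>space M. \<bar>B t \<omega> - B 0 \<omega>\<bar> \<le> c} \<le> 2 * c / sqrt t"
proof -
  have [measurable]: "B t \<in> borel_measurable M" "B 0 \<in> borel_measurable M" using assms measurable_B by auto
  have d: "distributed M lborel (\<lambda>\<omega>. B t \<omega> - B 0 \<omega>) (normal_density 0 (sqrt t))"
    using normal_increments[of 0 t] assms by simp
  have set_eq: "{\<omega>\<in>space M. \<bar>B t \<omega> - B 0 \<omega>\<bar> \<le> c} = (\<lambda>\<omega>. B t \<omega> - B 0 \<omega>) -` {-c..c} \<inter> space M"
    by auto
  have dens: "normal_density 0 (sqrt t) y \<le> 1 / sqrt t" for y
  proof -
    have "sqrt t \<le> sqrt (2 * pi * t)"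
      using assms pi_gt3 mult_right_mono[of 1 "2 * pi" t] by (intro real_sqrt_le_mono) auto
    then have "1 / sqrt (2 * pi * t) \<le> 1 / sqrt t" using assms by (intro divide_left_mono) auto
    moreover have "exp (- y\<^sup>2 / (2 * t)) \<le> 1" using assms by (simp add: divide_nonpos_pos)
    ultimately have "1 / sqrt (2 * pi * t) * exp (- y\<^sup>2 / (2 * t)) \<le> 1 / sqrt t * 1"
      using assms by (intro mult_mono) auto
    then show ?thesis using assms by (simp add: normal_density_def)
  qed
  have "emeasure M ((\<lambda>\<omega>. B t \<omega> - B 0 \<omega>) -` {-c..c} \<inter> space M) =
    (\<integral>\<^sup>+y. ennreal (normal_density 0 (sqrt t) y) * indicator {-c..c} y \<partial>lborel)"
    by (rule distributed_emeasure[OF d]) simp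
  also have "\<dots> \<le> (\<integral>\<^sup>+y. ennreal (1 / sqrt t) * indicator {-c..c} y \<partial>lborel)"
    by (intro nn_integral_mono mult_right_mono ennreal_leI dens) simp
  also have "\<dots> = ennreal (2 * c / sqrt t)"
    using assms by (simp add: nn_integral_cmult_indicator ennreal_mult'[symmetric])
  finally show ?thesis
    unfolding set_eq emeasure_eq_measure using assms by (subst (asm) ennreal_le_iff) auto
qed

text \<open>At time \<open>n + 1\<close> the increment lies in a fixed interval with probability of
  order one over the square root of the time, so staying in it at all positive integer times is a
  null event.\<close>

lemma increments_unbounded:
  assumes "0 \<le> c"
  shows "AE \<omega> in M. \<exists>t>0. c < \<bar>B t \<omega> - B 0 \<omega>\<bar>"
proof -
  let ?E = "{\<omega>\<in>space M. \<forall>n::nat. \<bar>B (real (Suc n)) \<omega> - B 0 \<omega>\<bar> \<le> c}"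
  have [measurable]: "B (real (Suc n)) \<in> borel_measurable M" "B 0 \<in> borel_measurable M" for n
    using measurable_B by auto
  have E: "?E \<in> events" by measurable
  have "prob ?E \<le> 2 * c / sqrt (real (Suc n))" for n
  proof -
    have "{\<omega>\<in>space M. \<bar>B (real (Suc n)) \<omega> - B 0 \<omega>\<bar> \<le> c} \<in> events" by measurable
    then have "prob ?E \<le> prob {\<omega>\<in>space M. \<bar>B (real (Suc n)) \<omega> - B 0 \<omega>\<bar> \<le> c}"
      by (intro finite_measure_mono) auto
    also have "\<dots> \<le> 2 * c / sqrt (real (Suc n))" by (rule prob_increment_small) (use assms in auto)
    finally show ?thesis .
  qed
  moreover have "(\<lambda>n. 2 * c / sqrt (real (Suc n))) \<longlonglongrightarrow> 0"
    by (rule real_tendsto_divide_at_top[OF tendsto_const])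
      (rule filterlim_compose[OF sqrt_at_top filterlim_compose[OF filterlim_real_sequentially filterlim_Suc]])
  ultimately have "prob ?E \<le> 0" by (intro tendsto_lowerbound) auto
  then have "prob ?E = 0" by (simp add: measure_le_0_iff)
  then have "AE \<omega> in M. \<omega> \<notin> ?E" using E by (subst (asm) prob_eq_0) auto
  then show ?thesis using AE_space
  proof eventually_elim
    case (elim \<omega>)
    then obtain n :: nat where "c < \<bar>B (real (Suc n)) \<omega> - B 0 \<omega>\<bar>" by (auto simp: not_le)
    then show ?case by (intro exI[of _ "real (Suc n)"]) simp
  qed
qed

lemma has_ito_integral_const:
  fixes \<sigma> :: "'a::euclidean_space"
  assumes "0 \<le> t"
  shows "has_ito_integral M B (\<lambda>s \<omega>. \<sigma>) t (\<lambda>\<omega>. (B t \<omega> - B 0 \<omega>) *\<^sub>R \<sigma>)"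
proof -
  define r where "r i = (if i = 0 then 0 else t)" for i :: nat
  have sd: "step_data M B t 1 r (\<lambda>i \<omega>. \<sigma>)"
    using assms by (auto simp: step_data_def r_def)
  have "step_distance t (\<lambda>s \<omega>. \<sigma>) 1 r (\<lambda>i \<omega>. \<sigma>) \<omega> = (\<integral>\<^sup>+s. 0 \<partial>(lborel :: real measure))" for \<omega> :: 'w
    unfolding step_distance_def
  proof (rule nn_integral_cong_AE)
    \<comment> \<open>The single half-open step misses only the endpoint \<open>t\<close>.\<close>
    show "AE s in lborel. ennreal ((norm (step_process 1 r (\<lambda>i \<omega>. \<sigma>) s \<omega> - \<sigma>))\<^sup>2) * indicator {0..t} s = 0"
      using AE_lborel_singleton[of t]
      by eventually_elim (auto simp: step_process_def r_def indicator_def)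
  qed
  then have "step_distance t (\<lambda>s \<omega>. \<sigma>) 1 r (\<lambda>i \<omega>. \<sigma>) = (\<lambda>\<omega> :: 'w. 0)" by auto
  then have 1: "null_in_prob M (\<lambda>n. step_distance t (\<lambda>s \<omega>. \<sigma>) 1 r (\<lambda>i \<omega>. \<sigma>))"
    by (simp only: null_in_prob_def) simp
  have 2: "null_in_prob M (\<lambda>n \<omega>. ennreal (norm (step_integral B 1 r (\<lambda>i \<omega>. \<sigma>) \<omega> - (B t \<omega> - B 0 \<omega>) *\<^sub>R \<sigma>)))"
    unfolding null_in_prob_def by (simp add: step_integral_def r_def)
  have "B t \<in> borel_measurable M" "B 0 \<in> borel_measurable M" using assms measurable_B by auto
  then have 3: "(\<lambda>\<omega>. (B t \<omega> - B 0 \<omega>) *\<^sub>R \<sigma>) \<in> borel_measurable M" by measurable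
  show ?thesis
    unfolding has_ito_integral_def
    using sd 1 2 3 unfolding step_distance_def[abs_def]
    by (intro conjI exI[of _ "\<lambda>_. 1"] exI[of _ "\<lambda>_. r"] exI[of _ "\<lambda>_ i \<omega>. \<sigma>"]) auto
qed

lemma calB_le_bellman_g:
  assumes p: "1 < p" and x: "x \<in> domain_D p"
  shows "ereal (calB p x) \<le> bellman_g M B p x"
proof -
  define \<sigma> :: state where "\<sigma> = (0, 0, -(p - 1), 1)"
  define u :: "real \<Rightarrow> 'w \<Rightarrow> control" where "u s \<omega> = (0, 0, -(p - 1), 1, 0)" for s \<omega>
  \<comment> \<open>Subtracting \<open>B 0\<close>, which vanishes only almost surely, makes the
    process start at \<open>x\<close> on every path.\<close>
  define X where "X t \<omega> = x + (B t \<omega> - B 0 \<omega>) *\<^sub>R \<sigma>" for t \<omega>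
  have u: "u \<in> controls M B control_set"
    by (auto simp: controls_def u_def[abs_def] control_set_def)
  have dr: "drift (u s \<omega>) y = 0" and di: "diffusion (u s \<omega>) y = \<sigma>" for s \<omega> y
    by (simp_all add: drift_def diffusion_def u_def \<sigma>_def zero_prod_def)
  have X: "solves M B drift diffusion x u X"
    unfolding solves_def dr di
  proof (intro conjI allI impI)
    show "AE \<omega> in M. continuous_on {0..} (\<lambda>t. X t \<omega>)"
      using continuous_paths by eventually_elim (auto simp: X_def intro!: continuous_intros)
    show "AE \<omega> in M. \<forall>t\<ge>0. set_integrable lborel {0..t::real} (\<lambda>s. 0::state) \<and> set_integrable lborel {0..t} (\<lambda>s. (norm \<sigma>)\<^sup>2)"
      unfolding set_integrable_def
      by (intro AE_I2 allI impI conjI integrable_scaleR_left integrable_real_indicator) auto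
    fix t :: real assume t: "0 \<le> t"
    have "B t \<in> borel_measurable M" "B 0 \<in> borel_measurable M" using t measurable_B by auto
    then show "X t \<in> borel_measurable M" unfolding X_def[abs_def] by measurable
    show "has_ito_integral M B (\<lambda>s \<omega>. \<sigma>) t (\<lambda>\<omega>. X t \<omega> - x - (LINT s:{0..t}|lborel. 0))"
      using has_ito_integral_const[OF t, of \<sigma>] by (simp add: X_def set_lebesgue_integral_def)
  qed
  obtain F f A v where x_eq: "x = (F, f, A, v)" by (cases x)
  have "fst (x + c *\<^sub>R \<sigma>) = fst x" "fst (snd (x + c *\<^sub>R \<sigma>)) = fst (snd x)"
    "weight p (x + c *\<^sub>R \<sigma>) = weight p x" for c
    by (simp_all add: x_eq \<sigma>_def weight_def algebra_simps)
  then have on_line: "fst (X t \<omega>) = fst x" "fst (snd (X t \<omega>)) = fst (snd x)"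
    "weight p (X t \<omega>) = weight p x" for t \<omega>
    unfolding X_def by blast+
  have line_wedge: "X t \<omega> \<in> wedge p" for t \<omega>
    using domain_D_subset_wedge[OF p] x by (auto simp: wedge_def on_line)
  have line_calB: "calB p (X t \<omega>) = calB p x" for t \<omega>
    unfolding calB_alt by (simp add: on_line)
  \<comment> \<open>With \<open>c\<close> the increment, the last coordinate \<open>v + c\<close> is
    positive only for \<open>- c < v\<close>, and the third, \<open>A - c * (p - 1)\<close>, only
    for \<open>c < A / (p - 1)\<close>.\<close>
  define R where "R = max v (A / (p - 1))"
  have R: "0 \<le> R" using x by (auto simp: R_def x_eq domain_D_def)
  have leave: "X t \<omega> \<notin> domain_D p" if "R < \<bar>B t \<omega> - B 0 \<omega>\<bar>" for t \<omega>
  proof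
    define c where "c = B t \<omega> - B 0 \<omega>"
    assume "X t \<omega> \<in> domain_D p"
    then have "0 < A - c * (p - 1)" "0 < v + c"
      by (auto simp: X_def x_eq \<sigma>_def domain_D_def c_def[symmetric] algebra_simps)
    then have "c < A / (p - 1)" "- c < v" using p by (simp_all add: field_simps)
    then show False using that unfolding c_def[symmetric] R_def by auto
  qed
  define total where "total \<omega> =
       ext_integral (restrict_space lborel {s. 0 \<le> s \<and> ereal s < exit_time (domain_D p) X \<omega>})
         (\<lambda>s. ereal (payoff_density p (u s \<omega>) (X s \<omega>))) +
       (if exit_time (domain_D p) X \<omega> < \<infinity> then bequest p (X (real_of_ereal (exit_time (domain_D p) X \<omega>)) \<omega>) else 0)" for \<omega>
  have total: "AE \<omega> in M. ereal (calB p x) \<le> total \<omega>"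
    using increments_unbounded[OF R]
  proof eventually_elim
    case (elim \<omega>)
    then obtain t where "0 < t" "X t \<omega> \<notin> domain_D p" using leave by blast
    then have "exit_time (domain_D p) X \<omega> \<le> ereal t" unfolding exit_time_def by (intro Inf_lower) auto
    then have fin: "exit_time (domain_D p) X \<omega> < \<infinity>" using le_less_trans by fastforce
    have "payoff_density p (u s \<omega>) y = 0" for s y
      by (simp add: payoff_density_def u_def split: prod.split)
    then have "total \<omega> = bequest p (X (real_of_ereal (exit_time (domain_D p) X \<omega>)) \<omega>)"
      using fin unfolding total_def by (simp add: ext_integral_def zero_ennreal.rep_eq zero_ereal_def[symmetric])
    then show ?case using calB_le_bequest[OF line_wedge] line_calB by metis
  qed
  have "ennreal (calB p x) = (\<integral>\<^sup>+\<omega>. ennreal (calB p x) \<partial>M)" by (simp add: emeasure_space_1)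
  also have "\<dots> \<le> (\<integral>\<^sup>+\<omega>. e2ennreal (total \<omega>) \<partial>M)"
  proof (rule nn_integral_mono_AE)
    show "AE \<omega> in M. ennreal (calB p x) \<le> e2ennreal (total \<omega>)"
      using total by eventually_elim (metis e2ennreal_ereal e2ennreal_mono)
  qed
  finally have le: "ereal (calB p x) \<le> enn2ereal (\<integral>\<^sup>+\<omega>. e2ennreal (total \<omega>) \<partial>M)"
    using calB_nonneg[OF p x] by (simp add: less_eq_ennreal.rep_eq enn2ereal_ennreal)
  \<comment> \<open>\<open>ext_integral\<close> is a difference, so a lower bound also needs control
    of the negative part; it vanishes because the total is at least \<open>calB p x\<close>, which
    is nonnegative.\<close>
  have "(\<integral>\<^sup>+\<omega>. e2ennreal (- total \<omega>) \<partial>M) = (\<integral>\<^sup>+\<omega>. 0 \<partial>M)"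
  proof (rule nn_integral_cong_AE)
    show "AE \<omega> in M. e2ennreal (- total \<omega>) = 0"
      using total
    proof eventually_elim
      case (elim \<omega>)
      have "0 \<le> ereal (calB p x)" using calB_nonneg[OF p x] by simp
      then have "0 \<le> total \<omega>" using elim by (rule order_trans)
      then show ?case by (intro e2ennreal_neg) (simp add: ereal_uminus_le_0_iff)
    qed
  qed
  then have "ereal (calB p x) \<le> ext_integral M total"
    unfolding ext_integral_def using le by (simp add: zero_ennreal.rep_eq)
  also have "\<dots> = performance M (payoff_density p) (bequest p) (domain_D p) u X"
    unfolding performance_def total_def[abs_def] ..
  also have "\<dots> \<le> bellman_g M B p x"
    unfolding bellman_g_def value_function_def using u X by (intro Sup_upper) blast
  finally show ?thesis .
qed

end

theorem theorem3p1:
  fixes M :: "'w measure" and B :: "real \<Rightarrow> 'w \<Rightarrow> real" and p :: real and x :: state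
  assumes "brownian_motion M B"
    and "1 < p"
    and "x \<in> domain_D p"
  shows "ereal (calB p x) = bellman_g M B p x"
proof (rule antisym)
  interpret brownian_motion M B by fact
  show "ereal (calB p x) \<le> bellman_g M B p x"
    by (rule calB_le_bellman_g) fact+
  show "bellman_g M B p x \<le> ereal (calB p x)"
    unfolding bellman_g_def value_function_def
    using performance_le_calB[OF assms(2,3)] by (auto intro!: Sup_least)
qed

end
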